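(* Fix $\xi>0$, and suppose $K$ is a finite Cartesian product of nonnegative cones, Lorentz (second-order) cones (including rotated Lorentz cones), and positive-semidefinite cones. Let $\bar z=(\bar x,\bar y)\in Z^\star$, and assume there is a neighborhood $V_{\rm SC}$ of $\bar z$ such that every $z^\star=(x^\star,y^\star)\in Z^\star\cap V_{\rm SC}$, with $s^\star=Qx^\star+c-A^*y^\star$, satisfies $x^\star+s^\star\in\operatorname{int}K$. Then there are a neighborhood $V$ of $\bar z$ and a constant $\alpha_\xi>0$ such that $$G_\xi(z;z^\star)\ge\alpha_\xi\operatorname{dist}^2(z,Z^\star)\qquad\text{for all } z\in(K\times Y)\cap V,\ z^\star\in Z^\star\cap V .$$ Moreover, the lifted residual error bound (L), the slack regularity (S) and the normal-cone calmness (N) around $\bar z$ described in the context hold for some positive constants $(\kappa_L,\gamma_L)$, $\kappa_A$ and $\kappa_B$ respectively, and with these constants one may take $$\alpha_\xi=\min\left\{\frac{1}{2\kappa_L^2},\ \frac{1}{4\xi\gamma_L^2},\ \frac{\xi}{2\|(A^* )^\dagger\|^2\kappa_A^2(\|Q\|+\xi+\kappa_B)^2}\right\}$$ (with the third entry read as $+\infty$ if $A=0$).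
   Context: Problem. $E,Y$ are finite-dimensional Euclidean spaces, $A:E\to Y$ is linear with adjoint $A^*$, $Q:E\to E$ is self-adjoint positive semidefinite, $c\in E$, $b\in Y$, and $K\subseteq E$ is a nonempty closed convex cone with dual cone $K^*=\{s:\langle s,x\rangle\ge 0\ \forall x\in K\}$. The problem is $\min\{\tfrac12\langle x,Qx\rangle+\langle c,x\rangle: Ax=b,\ x\in K\}$, with saddle function $\mathcal L(x,y)=\tfrac12\langle x,Qx\rangle+\langle c,x\rangle+\langle y,b-Ax\rangle$ for $x\in K$, $y\in Y$. The KKT set $Z^\star\subseteq E\times Y$ is the set of $(x,y)$ such that, with $s=Qx+c-A^*y$, one has $Ax=b$, $x\in K$, $s\in K^*$, $\langle x,s\rangle=0$; $X^\star,Y^\star$ are its projections onto $E$ and $Y$. Standing assumption: $Z^\star\neq\emptyset$. Norms are Euclidean (product norm on products), $\operatorname{dist}$ is Euclidean distance, and $(A^* )^\dagger$ is the Moore–Penrose pseudoinverse, with norm restricted to $\operatorname{range}A^*$. Cones. Lorentz cone: $\{(v,t):\|v\|\le t\}$; rotated Lorentz cone: $\{(u,v,w):u,v\ge0,\ 2uv\ge\|w\|^2\}$, denoted $\mathcal Q_r$; the positive-semidefinite cone lives in the symmetric matrices with trace inner product. All these cones are self-dual. Smoothed duality gap. For $z=(x,y),\widehat z=(\widehat x,\widehat y)\in K\times Y$, set $\mathcal Q(z,\widehat z)=\mathcal L(x,\widehat y)-\mathcal L(\widehat x,y)$, and for $\dot z=(\dot x,\dot y)\in E\times Y$, $$G_\xi(z;\dot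 z)=\sup_{\widehat x\in K,\ \widehat y\in Y}\Big\{\mathcal Q(z,\widehat z)-\tfrac{\xi}{2}\|\widehat x-\dot x\|^2-\tfrac{\xi}{2}\|\widehat y-\dot y\|^2\Big\}.$$ (L) Lifted residual error bound. Fix a linear $B$ with $Q=B^*B$. The lifted problem in $\chi=(x,u,v,w)$ is $\min\{u+\langle c,x\rangle: Ax=b,\ x\in K,\ v=1,\ w=Bx,\ (u,v,w)\in\mathcal Q_r\}$, with optimal solution set $\mathcal X_L^\star$; $\mathcal A_L\chi:=(Ax,v,w-Bx)$, $\widetilde b:=(b,1,0)$, $\widehat\chi(x):=(x,\tfrac12\|Bx\|^2,1,Bx)$. For $z^\star=(x^\star,y^\star)\in Z^\star$ let $s^\star=Qx^\star+c-A^*y^\star$, $p^\star=(1,\tfrac12\|Bx^\star\|^2,-Bx^\star)$, $\zeta^\star=(s^\star,p^\star)$. (L) with constants $\kappa_L,\gamma_L>0$: there are a neighborhood $V'$ of $\bar z$ and an open neighborhood $\mathcal N$ of $\widehat\chi(\bar x)$ such that for every $z^\star\in Z^\star\cap V'$ and $\chi\in(K\times\mathcal Q_r)\cap\mathcal N$, $\operatorname{dist}(\chi,\mathcal X_L^\star)\le\kappa_L\langle\zeta^\star,\chi\rangle^{1/2}+\gamma_L\|\mathcal A_L\chi-\widetilde b\|$. (S) Slack regularity. Let $\mathcal S^\star=\{Qx+c-A^*y:(x,y)\in Z^\star\}$, $\mathcal D_Q=Qx^\star+c-\operatorname{range}A^*$ (independent of $x^\star\in X^\star$), $\mathcal F_{x^\star}=K^*\cap(x^\star)^\perp$,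 $\bar s=Q\bar x+c-A^*\bar y$. (S) with constant $\kappa_A>0$: there are neighborhoods $V_A$ of $\bar z$ and $W_A$ of $\bar s$ such that for every $(x^\star,y^\star)\in Z^\star\cap V_A$ and $s\in W_A$, $\operatorname{dist}(s,\mathcal S^\star)\le\kappa_A[\operatorname{dist}(s,\mathcal D_Q)+\operatorname{dist}(s,\mathcal F_{x^\star})]$. (N) Normal-cone calmness. $N_K(x)=\{v:\langle v,u-x\rangle\le0\ \forall u\in K\}$ for $x\in K$, with graph $\operatorname{gph}N_K=\{(u,v):u\in K,\ v\in N_K(u)\}$. (N) with constant $\kappa_B>0$: there are neighborhoods $V_B$ of $\bar z$ and $W_B$ of $(\bar x,-\bar s)$ such that for every $(x^\star,y^\star)\in Z^\star\cap V_B$ and $(u,v)\in\operatorname{gph}N_K\cap W_B$, $\operatorname{dist}(v,N_K(x^\star))\le\kappa_B\|u-x^\star\|$. *)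

theory Defs
  imports "HOL-Analysis.Analysis"
begin

section \<open>Products of nonnegative, Lorentz and semidefinite cones\<close>

text \<open>
  The factors of the product have arbitrary, mutually different dimensions, so they are given by
  explicit coordinates of type \<^typ>\<open>nat \<Rightarrow> nat \<Rightarrow> real\<close> that vanish outside a finite index
  set: matrices in the semidefinite case, one-column matrices in the other cases.
\<close>

datatype cone_block =
    Nonneg_Block nat      \<comment> \<open>\<open>\<real>\<^sup>n\<close>\<close>
  | Lorentz_Block nat     \<comment> \<open>\<open>(v, t)\<close> in \<open>\<real>\<^sup>n \<times> \<real>\<close>, with \<open>t\<close> the coordinate of index \<open>n\<close>\<close>
  | Rotated_Block nat     \<comment> \<open>\<open>(u, v, w)\<close> in \<open>\<real> \<times> \<real> \<times> \<real>\<^sup>n\<close>, with \<open>u\<close>, \<open>v\<close> the coordinates of index 0, 1\<close>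
  | PSD_Block nat         \<comment> \<open>symmetric \<open>n \<times> n\<close> matrices\<close>

fun block_index :: "cone_block \<Rightarrow> (nat \<times> nat) set" where
  "block_index (Nonneg_Block n) = {..<n} \<times> {0}"
| "block_index (Lorentz_Block n) = {..<n + 1} \<times> {0}"
| "block_index (Rotated_Block n) = {..<n + 2} \<times> {0}"
| "block_index (PSD_Block n) = {..<n} \<times> {..<n}"

definition supported_on :: "(nat \<times> nat) set \<Rightarrow> (nat \<Rightarrow> nat \<Rightarrow> real) set" where
  "supported_on J = {a. \<forall>i j. (i, j) \<notin> J \<longrightarrow> a i j = 0}"

fun block_space :: "cone_block \<Rightarrow> (nat \<Rightarrow> nat \<Rightarrow> real) set" where
  "block_space (PSD_Block n) =
     {a \<in> supported_on (block_index (PSD_Block n)). \<forall>i j. a i j = a j i}"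
| "block_space blk = supported_on (block_index blk)"

text \<open>On symmetric matrices this is the trace inner product.\<close>

definition block_inner ::
    "cone_block \<Rightarrow> (nat \<Rightarrow> nat \<Rightarrow> real) \<Rightarrow> (nat \<Rightarrow> nat \<Rightarrow> real) \<Rightarrow> real" where
  "block_inner blk a b = (\<Sum>(i, j)\<in>block_index blk. a i j * b i j)"

fun block_cone :: "cone_block \<Rightarrow> (nat \<Rightarrow> nat \<Rightarrow> real) set" where
  "block_cone (Nonneg_Block n) =
     {a \<in> block_space (Nonneg_Block n). \<forall>i<n. 0 \<le> a i 0}"
| "block_cone (Lorentz_Block n) =
     {a \<in> block_space (Lorentz_Block n). sqrt (\<Sum>i<n. (a i 0)\<^sup>2) \<le> a n 0}"
| "block_cone (Rotated_Block n) =
     {a \<in> block_space (Rotated_Block n).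
        0 \<le> a 0 0 \<and> 0 \<le> a 1 0 \<and> (\<Sum>i<n. (a (i + 2) 0)\<^sup>2) \<le> 2 * a 0 0 * a 1 0}"
| "block_cone (PSD_Block n) =
     {a \<in> block_space (PSD_Block n).
        \<forall>h :: nat \<Rightarrow> real. 0 \<le> (\<Sum>i<n. \<Sum>j<n. h i * a i j * h j)}"

text \<open>
  The map \<open>\<phi>\<close> is a linear isometry from the whole space onto the product of the
  block spaces; it identifies \<open>K\<close> with the Cartesian product of the block cones.
\<close>

definition is_cone_product :: "'e::euclidean_space set \<Rightarrow> bool" where
  "is_cone_product K \<longleftrightarrow>
    (\<exists>(blks :: cone_block list) (\<phi> :: 'e \<Rightarrow> nat \<Rightarrow> nat \<Rightarrow> nat \<Rightarrow> real).
       (\<forall>k i j. linear (\<lambda>x. \<phi> x k i j)) \<and>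
       (\<forall>x y. x \<bullet> y = (\<Sum>k<length blks. block_inner (blks ! k) (\<phi> x k) (\<phi> y k))) \<and>
       range \<phi> = {a. (\<forall>k<length blks. a k \<in> block_space (blks ! k)) \<and>
                     (\<forall>k\<ge>length blks. \<forall>i j. a k i j = 0)} \<and>
       K = {x. \<forall>k<length blks. \<phi> x k \<in> block_cone (blks ! k)})"


section \<open>The conic quadratic program\<close>

definition dual_cone :: "'e::real_inner set \<Rightarrow> 'e set" where
  "dual_cone K = {s. \<forall>x\<in>K. 0 \<le> s \<bullet> x}"

definition lagrangian ::
    "('e::euclidean_space \<Rightarrow> 'e) \<Rightarrow> 'e \<Rightarrow> ('e \<Rightarrow> 'y::euclidean_space) \<Rightarrow> 'y \<Rightarrow> 'e \<Rightarrow> 'y \<Rightarrow> real" where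
  "lagrangian Q c A b x y = 1/2 * (x \<bullet> Q x) + c \<bullet> x + y \<bullet> (b - A x)"

definition slack ::
    "('e::euclidean_space \<Rightarrow> 'e) \<Rightarrow> 'e \<Rightarrow> ('e \<Rightarrow> 'y::euclidean_space) \<Rightarrow> 'e \<times> 'y \<Rightarrow> 'e" where
  "slack Q c A z = Q (fst z) + c - adjoint A (snd z)"

definition kkt_set ::
    "('e::euclidean_space \<Rightarrow> 'e) \<Rightarrow> 'e \<Rightarrow> ('e \<Rightarrow> 'y::euclidean_space) \<Rightarrow> 'y \<Rightarrow> 'e set \<Rightarrow> ('e \<times> 'y) set" where
  "kkt_set Q c A b K =
     {z. A (fst z) = b \<and> fst z \<in> K \<and> slack Q c A z \<in> dual_cone K \<and> fst z \<bullet> slack Q c A z = 0}"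

text \<open>The supremum is taken in the extended reals (for \<open>\<xi> > 0\<close> it is finite).\<close>

definition smoothed_gap ::
    "('e::euclidean_space \<Rightarrow> 'e) \<Rightarrow> 'e \<Rightarrow> ('e \<Rightarrow> 'y::euclidean_space) \<Rightarrow> 'y \<Rightarrow> 'e set \<Rightarrow> real \<Rightarrow>
     'e \<times> 'y \<Rightarrow> 'e \<times> 'y \<Rightarrow> ereal" where
  "smoothed_gap Q c A b K \<xi> z zdot =
     (SUP zhat \<in> K \<times> UNIV.
        ereal ((lagrangian Q c A b (fst z) (snd zhat) - lagrangian Q c A b (fst zhat) (snd z))
               - \<xi>/2 * (norm (fst zhat - fst zdot))\<^sup>2
               - \<xi>/2 * (norm (snd zhat - snd zdot))\<^sup>2))"

definition gap_growth ::
    "('e::euclidean_space \<Rightarrow> 'e) \<Rightarrow> 'e \<Rightarrow> ('e \<Rightarrow> 'y::euclidean_space) \<Rightarrow> 'y \<Rightarrow> 'e set \<Rightarrow> real \<Rightarrow>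
     ('e \<times> 'y) set \<Rightarrow> real \<Rightarrow> bool" where
  "gap_growth Q c A b K \<xi> V \<alpha> \<longleftrightarrow>
     (\<forall>z \<in> (K \<times> UNIV) \<inter> V. \<forall>zs \<in> kkt_set Q c A b K \<inter> V.
        ereal (\<alpha> * (infdist z (kkt_set Q c A b K))\<^sup>2) \<le> smoothed_gap Q c A b K \<xi> z zs)"


section \<open>The lifted residual error bound\<close>

definition rotated_lorentz_cone :: "(real \<times> real \<times> 'w::real_normed_vector) set" where
  "rotated_lorentz_cone = {(u, v, w). 0 \<le> u \<and> 0 \<le> v \<and> (norm w)\<^sup>2 \<le> 2 * u * v}"

definition lifted_map ::
    "('e \<Rightarrow> 'y) \<Rightarrow> ('e \<Rightarrow> 'w::real_normed_vector) \<Rightarrow> 'e \<times> real \<times> real \<times> 'w \<Rightarrow> 'y \<times> real \<times> 'w" where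
  "lifted_map A B = (\<lambda>(x, u, v, w). (A x, v, w - B x))"

definition lifted_objective ::
    "'e::real_inner \<Rightarrow> 'e \<times> real \<times> real \<times> 'w \<Rightarrow> real" where
  "lifted_objective c = (\<lambda>(x, u, v, w). u + c \<bullet> x)"

definition lifted_feasible ::
    "('e \<Rightarrow> 'y) \<Rightarrow> 'y \<Rightarrow> 'e set \<Rightarrow> ('e \<Rightarrow> 'w::real_normed_vector) \<Rightarrow> ('e \<times> real \<times> real \<times> 'w) set" where
  "lifted_feasible A b K B =
     {(x, u, v, w). A x = b \<and> x \<in> K \<and> v = 1 \<and> w = B x \<and> (u, v, w) \<in> rotated_lorentz_cone}"

definition lifted_solutions ::
    "'e::real_inner \<Rightarrow> ('e \<Rightarrow> 'y) \<Rightarrow> 'y \<Rightarrow> 'e set \<Rightarrow> ('e \<Rightarrow> 'w::real_normed_vector) \<Rightarrow>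
     ('e \<times> real \<times> real \<times> 'w) set" where
  "lifted_solutions c A b K B =
     {chi \<in> lifted_feasible A b K B.
        \<forall>chi' \<in> lifted_feasible A b K B. lifted_objective c chi \<le> lifted_objective c chi'}"

definition lift :: "('e \<Rightarrow> 'w::real_normed_vector) \<Rightarrow> 'e \<Rightarrow> 'e \<times> real \<times> real \<times> 'w" where
  "lift B x = (x, 1/2 * (norm (B x))\<^sup>2, 1, B x)"

definition lifted_slack ::
    "('e::euclidean_space \<Rightarrow> 'e) \<Rightarrow> 'e \<Rightarrow> ('e \<Rightarrow> 'y::euclidean_space) \<Rightarrow>
     ('e \<Rightarrow> 'w::real_normed_vector) \<Rightarrow> 'e \<times> 'y \<Rightarrow> 'e \<times> real \<times> real \<times> 'w" where
  "lifted_slack Q c A B z = (slack Q c A z, 1, 1/2 * (norm (B (fst z)))\<^sup>2, - B (fst z))"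

text \<open>Here and below, \<open>z \<in> interior V\<close> says that \<open>V\<close> is a neighbourhood of \<open>z\<close>.\<close>

definition lifted_error_bound ::
    "('e::euclidean_space \<Rightarrow> 'e) \<Rightarrow> 'e \<Rightarrow> ('e \<Rightarrow> 'y::euclidean_space) \<Rightarrow> 'y \<Rightarrow> 'e set \<Rightarrow>
     ('e \<Rightarrow> 'w::euclidean_space) \<Rightarrow> 'e \<times> 'y \<Rightarrow> real \<Rightarrow> real \<Rightarrow> bool" where
  "lifted_error_bound Q c A b K B zbar \<kappa>L \<gamma>L \<longleftrightarrow>
     (\<exists>V N. zbar \<in> interior V \<and> open N \<and> lift B (fst zbar) \<in> N \<and>
        (\<forall>zs \<in> kkt_set Q c A b K \<inter> V. \<forall>chi \<in> (K \<times> rotated_lorentz_cone) \<inter> N.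
           infdist chi (lifted_solutions c A b K B)
             \<le> \<kappa>L * sqrt (lifted_slack Q c A B zs \<bullet> chi)
               + \<gamma>L * norm (lifted_map A B chi - (b, 1, 0))))"


section \<open>Slack regularity and calmness of the normal cone\<close>

definition slack_regularity ::
    "('e::euclidean_space \<Rightarrow> 'e) \<Rightarrow> 'e \<Rightarrow> ('e \<Rightarrow> 'y::euclidean_space) \<Rightarrow> 'y \<Rightarrow> 'e set \<Rightarrow>
     'e \<times> 'y \<Rightarrow> real \<Rightarrow> bool" where
  "slack_regularity Q c A b K zbar \<kappa>A \<longleftrightarrow>
     (\<exists>V W. zbar \<in> interior V \<and> slack Q c A zbar \<in> interior W \<and>
        (\<forall>(xs, ys) \<in> kkt_set Q c A b K \<inter> V. \<forall>s \<in> W.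
           infdist s (slack Q c A ` kkt_set Q c A b K)
             \<le> \<kappa>A * (infdist s {Q xs + c - r | r. r \<in> range (adjoint A)}
                     + infdist s {t \<in> dual_cone K. t \<bullet> xs = 0})))"

definition normal_cone :: "'e::real_inner set \<Rightarrow> 'e \<Rightarrow> 'e set" where
  "normal_cone K x = {v. \<forall>u\<in>K. v \<bullet> (u - x) \<le> 0}"

definition normal_cone_graph :: "'e::real_inner set \<Rightarrow> ('e \<times> 'e) set" where
  "normal_cone_graph K = {(u, v). u \<in> K \<and> v \<in> normal_cone K u}"

definition normal_cone_calmness ::
    "('e::euclidean_space \<Rightarrow> 'e) \<Rightarrow> 'e \<Rightarrow> ('e \<Rightarrow> 'y::euclidean_space) \<Rightarrow> 'y \<Rightarrow> 'e set \<Rightarrow>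
     'e \<times> 'y \<Rightarrow> real \<Rightarrow> bool" where
  "normal_cone_calmness Q c A b K zbar \<kappa>B \<longleftrightarrow>
     (\<exists>V W. zbar \<in> interior V \<and> (fst zbar, - slack Q c A zbar) \<in> interior W \<and>
        (\<forall>(xs, ys) \<in> kkt_set Q c A b K \<inter> V. \<forall>(u, v) \<in> normal_cone_graph K \<inter> W.
           infdist v (normal_cone K xs) \<le> \<kappa>B * norm (u - xs)))"


section \<open>The growth constant\<close>

text \<open>The Moore--Penrose pseudoinverse, through the four Penrose equations.\<close>

definition pseudoinverse :: "('a::euclidean_space \<Rightarrow> 'b::euclidean_space) \<Rightarrow> 'b \<Rightarrow> 'a" where
  "pseudoinverse T = (THE S. linear S \<and> T \<circ> S \<circ> T = T \<and> S \<circ> T \<circ> S = S \<and>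
                             adjoint (T \<circ> S) = T \<circ> S \<and> adjoint (S \<circ> T) = S \<circ> T)"

text \<open>The analogue of \<^const>\<open>onorm\<close> for the restriction of a linear map to a subspace.\<close>

definition onorm_on :: "'a::real_normed_vector set \<Rightarrow> ('a \<Rightarrow> 'b::real_normed_vector) \<Rightarrow> real" where
  "onorm_on S f = (SUP x\<in>S. norm (f x) / norm x)"

definition growth_constant ::
    "('e::euclidean_space \<Rightarrow> 'e) \<Rightarrow> ('e \<Rightarrow> 'y::euclidean_space) \<Rightarrow> real \<Rightarrow>
     real \<Rightarrow> real \<Rightarrow> real \<Rightarrow> real \<Rightarrow> real" where
  "growth_constant Q A \<xi> \<kappa>L \<gamma>L \<kappa>A \<kappa>B =
     (let m = min (1 / (2 * \<kappa>L\<^sup>2)) (1 / (4 * \<xi> * \<gamma>L\<^sup>2))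
      in if A = (\<lambda>_. 0) then m
         else min m
           (\<xi> / (2 * (onorm_on (range (adjoint A)) (pseudoinverse (adjoint A)))\<^sup>2
                    * \<kappa>A\<^sup>2 * (onorm Q + \<xi> + \<kappa>B)\<^sup>2)))"

end

theory Submission
  imports Defs
begin

text \<open>
  Every factor of \<open>K\<close> is self-dual, and for each \<open>x \<in> K\<close> the orthogonal projection \<open>p\<close> onto the span
  of the face \<open>K \<inter> x\<^sup>\<bottom>\<close> maps \<open>K\<close> into that face, with \<open>\<bar>t - p t\<bar>\<^sup>2 \<le> C (x \<bullet> t) \<bar>t\<bar>\<close> on \<open>K\<close>. If
  \<open>x + s \<in> int K\<close> and \<open>x \<bullet> s = 0\<close>, applying \<open>p\<close> to a ball around \<open>x + s\<close> shows that \<open>s\<close> is a relative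
  interior point of \<open>K \<inter> x\<^sup>\<bottom>\<close>. As \<open>Z\<^sup>\<star>\<close> is a product, the faces met at KKT points near
  the reference point therefore do not depend on the KKT point, the solution sets are locally affine, and
  (L) and (S) reduce to the linear error bound. Strict complementarity passes to the lifted problem.

  For the growth, evaluate the supremum at \<open>y' = y\<^sup>\<star> + (b - A x) / \<xi>\<close> and at the proximal point
  \<open>x'\<close> of the dual part: this bounds the gap below by the lifted residual of \<open>x\<close> plus
  \<open>\<xi>/2 \<bar>x' - x\<^sup>\<star>\<bar>\<^sup>2\<close>, and (S) with (N) bounds \<open>dist(y, Y\<^sup>\<star>)\<close> by \<open>\<bar>x' - x\<^sup>\<star>\<bar>\<close>.
\<close>

section \<open>Self-adjoint operators and the pseudoinverse\<close>

text \<open>The delicate point is uniformity: (L), (S) and (N) ask for one constant valid for all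
  KKT points near the reference point, whereas a face projector and its \<open>C\<close> depend on
  the cone element at which they are formed. Every constant is therefore taken from a projector
  formed at the reference point or its lift; nearby KKT points are compared with it through relative
  interiors of faces, which costs at most a factor 2 in the pairings. The square root in (L) is that
  of the quadratic estimate for \<open>t - p t\<close>. The same estimate alone would make the
  normal cone only Hoelder continuous of order 1/2; the linear bound in (N) arises because the
  estimate acquires a product of a primal and a dual error, and the dual one cancels. The lifting
  turns the curvature of the objective into a linear pairing with a cone of the same kind, so that
  one theory of faces covers linear and quadratic objectives. The entries of the growth constant
  match the three terms of the lower bound for the gap: pairing, equality residual, proximal
  displacement.\<close>

definition orthonormal :: "'a::real_inner set \<Rightarrow> bool" where
  "orthonormal B \<longleftrightarrow> (\<forall>a\<in>B. \<forall>b\<in>B. a \<bullet> b = (if a = b then 1 else 0))"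

lemma orthonormal_finite:
  fixes B :: "'a::euclidean_space set"
  assumes "orthonormal B"
  shows "finite B" "card B \<le> DIM('a)"
proof -
  have "pairwise orthogonal B"
    using assms by (auto simp: pairwise_def orthogonal_def orthonormal_def)
  moreover have "0 \<notin> B"
    using assms unfolding orthonormal_def by (metis inner_zero_left zero_neq_one)
  ultimately have "independent B"
    by (rule pairwise_orthogonal_independent)
  then show "finite B" "card B \<le> DIM('a)"
    using independent_bound by auto
qed

lemma orthonormal_sum_inner:
  fixes B :: "'a::euclidean_space set"
  assumes "orthonormal B" "C \<subseteq> B" "b \<in> B"
  shows "(\<Sum>c\<in>C. f c *\<^sub>R c) \<bullet> b = (if b \<in> C then f b else 0)"
proof -
  have fin: "finite C"
    using orthonormal_finite(1)[OF assms(1)] assms(2) finite_subset by blast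
  have "(\<Sum>c\<in>C. f c *\<^sub>R c) \<bullet> b = (\<Sum>c\<in>C. if c = b then f c else 0)"
    unfolding inner_sum_left
    using assms by (intro sum.cong) (auto simp: orthonormal_def)
  then show ?thesis
    using fin by simp
qed

lemma orthonormal_inner_sum:
  fixes B :: "'a::euclidean_space set"
  assumes "v = (\<Sum>b\<in>B. (v \<bullet> b) *\<^sub>R b)"
  shows "v \<bullet> w = (\<Sum>b\<in>B. (v \<bullet> b) * (w \<bullet> b))"
proof -
  have "v \<bullet> w = (\<Sum>b\<in>B. (v \<bullet> b) *\<^sub>R b) \<bullet> w"
    by (rule arg_cong[OF assms])
  then show ?thesis
    by (simp add: inner_sum_left inner_commute[of w])
qed

lemma orthonormal_subspace_basis:
  fixes S :: "'a::euclidean_space set"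
  assumes "subspace S"
  obtains B where "B \<subseteq> S" "orthonormal B" "\<And>v. v \<in> S \<Longrightarrow> v = (\<Sum>b\<in>B. (v \<bullet> b) *\<^sub>R b)"
proof -
  obtain B where B: "B \<subseteq> S" "pairwise orthogonal B" "\<And>x. x \<in> B \<Longrightarrow> norm x = 1"
    "independent B" "span B = S"
    using orthonormal_basis_subspace[OF assms] by metis
  have on: "orthonormal B"
    using B(2,3) by (auto simp: orthonormal_def pairwise_def orthogonal_def norm_eq_sqrt_inner)
  have "v = (\<Sum>b\<in>B. (v \<bullet> b) *\<^sub>R b)" if "v \<in> S" for v
  proof -
    let ?u = "v - (\<Sum>b\<in>B. (v \<bullet> b) *\<^sub>R b)"
    have "?u \<in> span B"
      using that B(5) by (auto intro!: span_diff span_sum span_mul intro: span_base)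
    moreover have "orthogonal ?u b" if "b \<in> B" for b
      using orthonormal_sum_inner[OF on order_refl that, of "\<lambda>b. v \<bullet> b"] that
      by (simp add: orthogonal_def inner_diff_left)
    ultimately have "orthogonal ?u ?u"
      using orthogonal_to_span by blast
    then show ?thesis
      by (simp add: orthogonal_self)
  qed
  then show thesis
    using that B(1) on by blast
qed

lemma ex_orthogonal_projection:
  fixes S :: "'a::euclidean_space set"
  assumes "subspace S"
  obtains P where "linear P" "adjoint P = P" "range P \<subseteq> S" "\<And>v. v \<in> S \<Longrightarrow> P v = v"
proof -
  obtain B where B: "B \<subseteq> S" "orthonormal B" "\<And>v. v \<in> S \<Longrightarrow> v = (\<Sum>b\<in>B. (v \<bullet> b) *\<^sub>R b)"
    using orthonormal_subspace_basis[OF assms] by blast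
  define P where "P v = (\<Sum>b\<in>B. (v \<bullet> b) *\<^sub>R b)" for v
  have "linear P"
    unfolding P_def
    by (rule linearI) (simp_all add: inner_add_left scaleR_add_left sum.distrib scaleR_sum_right)
  moreover have "adjoint P = P"
    by (rule adjoint_unique)
      (simp add: P_def inner_sum_left inner_sum_right inner_commute mult.commute)
  moreover have "range P \<subseteq> S"
    using B(1) assms by (auto simp: P_def intro!: subspace_sum subspace_scale)
  moreover have "\<And>v. v \<in> S \<Longrightarrow> P v = v"
    using B(3) by (simp add: P_def)
  ultimately show thesis
    using that by blast
qed

text \<open>The eigenvector maximises the Rayleigh quotient on the unit sphere of \<open>S\<close>.\<close>

lemma self_adjoint_ex_eigenvector:
  fixes T :: "'a::euclidean_space \<Rightarrow> 'a"
  assumes T: "linear T" "\<And>u v. T u \<bullet> v = u \<bullet> T v"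
    and S: "subspace S" "\<And>v. v \<in> S \<Longrightarrow> T v \<in> S" "S \<noteq> {0}"
  obtains v l where "v \<in> S" "norm v = 1" "T v = l *\<^sub>R v"
proof -
  interpret T: linear T by fact
  obtain w0 where w0: "w0 \<in> S" "w0 \<noteq> 0"
    using S(1,3) subspace_0 by blast
  have "compact (sphere 0 1 \<inter> S)"
    using closed_subspace[OF S(1)] by (simp add: compact_Int_closed)
  moreover have "w0 /\<^sub>R norm w0 \<in> sphere 0 1 \<inter> S"
    using w0 S(1) by (simp add: subspace_scale)
  moreover have "continuous_on (sphere 0 1 \<inter> S) (\<lambda>v. v \<bullet> T v)"
    by (intro continuous_on_inner continuous_on_id linear_continuous_on)
      (use T(1) in \<open>simp add: linear_conv_bounded_linear\<close>)
  ultimately obtain v where v: "v \<in> sphere 0 1 \<inter> S" 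
    and max: "\<And>w. w \<in> sphere 0 1 \<inter> S \<Longrightarrow> w \<bullet> T w \<le> v \<bullet> T v"
    using continuous_attains_sup by (metis empty_iff)
  define l where "l = v \<bullet> T v"
  have vv: "v \<bullet> v = 1"
    using v by (simp add: norm_eq_1)
  have bound: "w \<bullet> T w \<le> l * (w \<bullet> w)" if "w \<in> S" for w
  proof (cases "w = 0")
    case False
    have "w /\<^sub>R norm w \<in> sphere 0 1 \<inter> S"
      using that False S(1) by (simp add: subspace_scale)
    from max[OF this] have "(w \<bullet> T w) / (norm w)\<^sup>2 \<le> l"
      by (simp add: T.scale l_def power2_eq_square divide_simps)
    then show ?thesis
      using False by (simp add: divide_simps power2_norm_eq_inner)
  qed (simp add: T.zero)
  have stationary: "w \<bullet> T v = 0" if w: "w \<in> S" "w \<bullet> v = 0" for w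
  proof -
    define d where "d = w \<bullet> T v"
    define k where "k = l * (w \<bullet> w) - w \<bullet> T w"
    have ineq: "2 * e * d \<le> e\<^sup>2 * k" for e
    proof -
      have "v + e *\<^sub>R w \<in> S"
        using v w S(1) by (simp add: subspace_add subspace_scale)
      from bound[OF this] show ?thesis
        using w(2) vv T(2)[of v w]
        by (simp add: T.add T.scale inner_simps inner_commute l_def[symmetric] d_def k_def
            power2_eq_square algebra_simps)
    qed
    \<comment> \<open>The left side is linear and the right side quadratic in \<open>e\<close>,
      which may have either sign; this choice of \<open>e\<close> makes the contradiction
      explicit.\<close>
    have False if "d \<noteq> 0"
    proof -
      have "2 * (d / (\<bar>k\<bar> + 1)) * d \<le> (d / (\<bar>k\<bar> + 1))\<^sup>2 * k"
        by (rule ineq)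
      then have "2 * d * d * (\<bar>k\<bar> + 1) \<le> d * d * k"
        by (simp add: divide_simps power2_eq_square mult_ac split: if_splits)
      then have "d * d * (2 * (\<bar>k\<bar> + 1)) \<le> d * d * k"
        by (simp add: algebra_simps)
      moreover have "d * d > 0"
        using that by (auto simp: zero_less_mult_iff)
      ultimately have "2 * (\<bar>k\<bar> + 1) \<le> k"
        using mult_le_cancel_left_pos by blast
      then show ?thesis
        by (simp add: abs_if split: if_splits)
    qed
    then show ?thesis
      unfolding d_def by blast
  qed
  have "T v - l *\<^sub>R v \<in> S" "(T v - l *\<^sub>R v) \<bullet> v = 0"
    using v S(1,2) vv T(2)[of v v]
    by (auto simp: subspace_diff subspace_scale inner_simps l_def inner_commute)
  moreover from stationary[OF this] have "(T v - l *\<^sub>R v) \<bullet> T v = 0" .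
  ultimately have "(T v - l *\<^sub>R v) \<bullet> (T v - l *\<^sub>R v) = 0"
    by (simp only: inner_diff_right[of "T v - l *\<^sub>R v"] inner_scaleR_right)
  then have "T v = l *\<^sub>R v" by simp
  then show thesis
    using that v by auto
qed

text \<open>An orthonormal set of eigenvectors of greatest cardinality spans everything: its
  orthogonal complement is invariant under \<open>T\<close>, so a nonzero complement would supply
  one more eigenvector.\<close>

theorem self_adjoint_eigenbasis:
  fixes T :: "'a::euclidean_space \<Rightarrow> 'a"
  assumes T: "linear T" "\<And>u v. T u \<bullet> v = u \<bullet> T v"
  obtains B l where "orthonormal B" "\<And>v. v = (\<Sum>b\<in>B. (v \<bullet> b) *\<^sub>R b)"
    "\<And>b. b \<in> B \<Longrightarrow> T b = l b *\<^sub>R b"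
proof -
  interpret T: linear T by fact
  define P where "P B \<longleftrightarrow> orthonormal B \<and> (\<forall>b\<in>B. \<exists>l. T b = l *\<^sub>R b)" for B
  have "P {}"
    by (simp add: P_def orthonormal_def)
  moreover have "\<forall>B. P B \<longrightarrow> card B < Suc DIM('a)"
    using orthonormal_finite(2) by (auto simp: P_def less_Suc_eq_le)
  ultimately obtain B where B: "P B" and max: "\<And>C. P C \<Longrightarrow> card C \<le> card B"
    using ex_has_greatest_nat[of P "{}" card "Suc DIM('a)"] by auto
  define S where "S = {v. \<forall>b\<in>B. v \<bullet> b = 0}"
  have S: "subspace S"
    by (auto simp: S_def subspace_def inner_simps)
  have inv: "T v \<in> S" if v: "v \<in> S" for v
    unfolding S_def
  proof (intro CollectI ballI)
    fix b assume b: "b \<in> B"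
    then obtain l where "T b = l *\<^sub>R b"
      using B by (auto simp: P_def)
    then show "T v \<bullet> b = 0"
      using T(2)[of v b] v b by (simp add: S_def)
  qed
  have trivial: "S = {0}"
  proof (rule ccontr)
    assume "S \<noteq> {0}"
    then obtain v l where v: "v \<in> S" "norm v = 1" "T v = l *\<^sub>R v"
      using self_adjoint_ex_eigenvector[OF T S inv] by blast
    have "v \<notin> B"
      using v by (auto simp: S_def norm_eq_1)
    moreover have "P (insert v B)"
      using B v by (auto simp: P_def orthonormal_def S_def norm_eq_1 inner_commute)
    ultimately show False
      using max[of "insert v B"] orthonormal_finite(1)[of B] B by (simp add: P_def)
  qed
  have on: "orthonormal B"
    using B by (simp add: P_def)
  have "v = (\<Sum>b\<in>B. (v \<bullet> b) *\<^sub>R b)" for v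
  proof -
    have "v - (\<Sum>b\<in>B. (v \<bullet> b) *\<^sub>R b) \<in> S"
      unfolding S_def by (auto simp: inner_diff_left orthonormal_sum_inner[OF on order_refl])
    then show ?thesis
      using trivial by simp
  qed
  moreover obtain l where "\<And>b. b \<in> B \<Longrightarrow> T b = l b *\<^sub>R b"
    using B unfolding P_def by metis
  ultimately show thesis
    using that on by blast
qed

text \<open>\<open>B\<close> is the square root of \<open>Q\<close>, built in an eigenbasis. It
  serves the existence claim of the final result, where no factor of \<open>Q\<close> is
  given.\<close>

lemma positive_semidefinite_factorization:
  fixes Q :: "'a::euclidean_space \<Rightarrow> 'a"
  assumes Q: "linear Q" "adjoint Q = Q" "\<And>x. 0 \<le> x \<bullet> Q x"
  obtains B :: "'a \<Rightarrow> 'a" where "linear B" "Q = adjoint B \<circ> B"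
proof -
  have sa: "Q u \<bullet> v = u \<bullet> Q v" for u v
    using adjoint_works[OF Q(1), of u v] Q(2) by simp
  obtain D l where D: "orthonormal D" "\<And>v. v = (\<Sum>b\<in>D. (v \<bullet> b) *\<^sub>R b)"
    "\<And>b. b \<in> D \<Longrightarrow> Q b = l b *\<^sub>R b"
    using self_adjoint_eigenbasis[OF Q(1) sa] by blast
  have l: "0 \<le> l b" if "b \<in> D" for b
    using Q(3)[of b] D(1,3) that by (auto simp: orthonormal_def)
  define B where "B v = (\<Sum>b\<in>D. (sqrt (l b) * (v \<bullet> b)) *\<^sub>R b)" for v
  have lin: "linear B"
    unfolding B_def
    by (rule linearI) (simp_all add: inner_add_left scaleR_add_left distrib_left sum.distrib
        scaleR_sum_right mult_ac)
  have sab: "adjoint B = B"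
    by (rule adjoint_unique) (auto simp: B_def inner_sum_left inner_sum_right inner_commute
        intro!: sum.cong)
  have "Q v = B (B v)" for v
  proof -
    have "Q v = Q (\<Sum>b\<in>D. (v \<bullet> b) *\<^sub>R b)"
      using D(2)[of v] by simp
    also have "\<dots> = (\<Sum>b\<in>D. (v \<bullet> b) *\<^sub>R (l b *\<^sub>R b))"
      by (simp add: linear_sum[OF Q(1)] linear_scale[OF Q(1)] D(3))
    also have "\<dots> = (\<Sum>b\<in>D. (sqrt (l b) * (B v \<bullet> b)) *\<^sub>R b)"
      using l by (intro sum.cong refl)
        (simp add: B_def orthonormal_sum_inner[OF D(1) order_refl] real_sqrt_mult_self
          flip: mult.assoc)
    finally show ?thesis
      by (simp add: B_def)
  qed
  then show thesis
    using that[OF lin] sab by (auto simp: fun_eq_iff)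
qed

section \<open>Linear error bounds and the pseudoinverse\<close>

lemma linear_ex_right_inverse:
  fixes T :: "'a::euclidean_space \<Rightarrow> 'b::euclidean_space"
  assumes "linear T"
  obtains g where "linear g" "\<And>v. T (g (T v)) = T v"
  using real_vector.linear_exists_right_inverse_on[OF assms subspace_UNIV] that by blast


text \<open>With \<open>g\<close> inverting \<open>T\<close> on its range,
  \<open>v - g (T v)\<close> lies in the kernel, so a bound for \<open>g\<close> serves as the
  constant. The error bound for affine sections of faces rests on this.\<close>

lemma linear_kernel_error_bound:
  fixes T :: "'a::euclidean_space \<Rightarrow> 'b::euclidean_space"
  assumes "linear T"
  obtains C where "C > 0" "\<And>v. \<exists>z. T z = 0 \<and> norm (v - z) \<le> C * norm (T v)"
proof -
  obtain g :: "'b \<Rightarrow> 'a" where g: "linear g" "\<And>v. T (g (T v)) = T v"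
    using linear_ex_right_inverse[OF assms] by blast
  obtain C where C: "C > 0" "\<And>w. norm (g w) \<le> norm w * C"
    using bounded_linear.pos_bounded[of g] g(1) by (auto simp: linear_conv_bounded_linear)
  have "T (v - g (T v)) = 0 \<and> norm (v - (v - g (T v))) \<le> C * norm (T v)" for v
    using C(2)[of "T v"] g(2)[of v] by (simp add: linear_diff[OF assms] mult.commute)
  then show thesis
    using that[OF C(1)] by blast
qed

lemma adjoint_compose:
  fixes T :: "'a::euclidean_space \<Rightarrow> 'b::euclidean_space" and S :: "'b \<Rightarrow> 'c::euclidean_space"
  assumes "linear T" "linear S"
  shows "adjoint (S \<circ> T) = adjoint T \<circ> adjoint S"
  by (rule adjoint_unique) (simp add: adjoint_clauses assms)

text \<open>Taking adjoints in \<open>T \<circ> S = (T \<circ> R) \<circ> (T \<circ> S)\<close>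
  swaps the two self-adjoint factors and yields \<open>T \<circ> S = T \<circ> R\<close>; the other
  side is symmetric. Uniqueness gives the definite description in \<open>pseudoinverse\<close> its
  meaning.\<close>

lemma penrose_unique:
  fixes T :: "'a::euclidean_space \<Rightarrow> 'b::euclidean_space"
  assumes T: "linear T"
    and S: "linear S" "T \<circ> S \<circ> T = T" "S \<circ> T \<circ> S = S"
      "adjoint (T \<circ> S) = T \<circ> S" "adjoint (S \<circ> T) = S \<circ> T"
    and R: "linear R" "T \<circ> R \<circ> T = T" "R \<circ> T \<circ> R = R"
      "adjoint (T \<circ> R) = T \<circ> R" "adjoint (R \<circ> T) = R \<circ> T"
  shows "S = R"
proof -
  have lin: "linear (T \<circ> S)" "linear (T \<circ> R)" "linear (S \<circ> T)" "linear (R \<circ> T)"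
    using T S(1) R(1) by (auto intro: linear_compose)
  have "T \<circ> S = adjoint ((T \<circ> R) \<circ> (T \<circ> S))"
    using S(4) R(2) by (simp add: o_assoc)
  also have "\<dots> = (T \<circ> S) \<circ> (T \<circ> R)"
    using S(4) R(4) by (simp only: adjoint_compose lin)
  also have "\<dots> = T \<circ> R"
    using S(2) by (simp add: o_assoc)
  finally have 1: "T \<circ> S = T \<circ> R" .
  have "S \<circ> T = adjoint ((S \<circ> T) \<circ> (R \<circ> T))"
    using S(5) R(2) by (simp add: o_assoc[symmetric])
  also have "\<dots> = (R \<circ> T) \<circ> (S \<circ> T)"
    using S(5) R(5) by (simp only: adjoint_compose lin)
  also have "\<dots> = R \<circ> T"
    using S(2) by (simp add: o_assoc[symmetric])
  finally have 2: "S \<circ> T = R \<circ> T" .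
  have "S = S \<circ> (T \<circ> S)"
    using S(3) by (simp add: o_assoc)
  also have "\<dots> = S \<circ> T \<circ> R"
    unfolding 1 by (simp add: o_assoc)
  also have "\<dots> = R"
    unfolding 2 by (rule R(3))
  finally show ?thesis .
qed

lemma penrose_exists:
  fixes T :: "'a::euclidean_space \<Rightarrow> 'b::euclidean_space"
  assumes T: "linear T"
  obtains S where "linear S" "T \<circ> S \<circ> T = T" "S \<circ> T \<circ> S = S"
    "adjoint (T \<circ> S) = T \<circ> S" "adjoint (S \<circ> T) = S \<circ> T"
proof -
  interpret T: linear T by fact
  obtain g :: "'b \<Rightarrow> 'a" where g: "linear g" "\<And>v. T (g (T v)) = T v"
    using linear_ex_right_inverse[OF T] by blast
  interpret g: linear g by fact
  have "subspace (range T)"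
    by (rule linear_subspace_image[OF T subspace_UNIV])
  then obtain P where P: "linear P" "adjoint P = P" "range P \<subseteq> range T" "\<And>v. v \<in> range T \<Longrightarrow> P v = v"
    using ex_orthogonal_projection by blast
  have "subspace {v. T v = 0}"
    by (rule linear_subspace_kernel[OF T])
  then obtain N where N: "linear N" "adjoint N = N" "range N \<subseteq> {v. T v = 0}"
    "\<And>v. v \<in> {v. T v = 0} \<Longrightarrow> N v = v"
    using ex_orthogonal_projection by blast
  interpret N: linear N by fact
  \<comment> \<open>\<open>P\<close> makes the equation solvable, and removing the kernel part
    selects the solution orthogonal to the kernel: the least-squares solution of least norm.\<close>
  define S where "S v = g (P v) - N (g (P v))" for v
  have lin: "linear S"
    using linear_compose_sub[OF linear_compose[OF P(1) g(1)]
        linear_compose[OF linear_compose[OF P(1) g(1)] N(1)]]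
    by (simp add: S_def[abs_def] o_def)
  have TN: "T (N v) = 0" and NN: "N (N v) = N v" for v
    using N(3,4) by auto
  have TS: "T (S v) = P v" for v
  proof -
    obtain u where "P v = T u"
      using P(3) by blast
    then show ?thesis
      by (simp add: S_def T.diff TN g(2))
  qed
  have ST: "S (T v) = v - N v" for v
  proof -
    have "N (g (T v) - v) = g (T v) - v"
      by (rule N(4)) (simp add: T.diff g(2))
    then show ?thesis
      by (simp add: S_def P(4) N.diff algebra_simps)
  qed
  show thesis
  proof (rule that[OF lin])
    show "T \<circ> S \<circ> T = T"
      by (simp add: fun_eq_iff ST T.diff TN)
    show "S \<circ> T \<circ> S = S"
      by (simp add: fun_eq_iff ST) (simp add: S_def N.diff NN)
    have "T \<circ> S = P"
      by (simp add: fun_eq_iff TS)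
    then show "adjoint (T \<circ> S) = T \<circ> S"
      using P(2) by simp
    show "adjoint (S \<circ> T) = S \<circ> T"
      using adjoint_works[OF N(1)] N(2) by (intro adjoint_unique) (simp add: ST inner_simps)
  qed
qed

lemma pseudoinverse_properties:
  fixes T :: "'a::euclidean_space \<Rightarrow> 'b::euclidean_space"
  assumes T: "linear T"
  shows "linear (pseudoinverse T)" "T (pseudoinverse T (T v)) = T v"
proof -
  let ?P = "\<lambda>S. linear S \<and> T \<circ> S \<circ> T = T \<and> S \<circ> T \<circ> S = S \<and>
    adjoint (T \<circ> S) = T \<circ> S \<and> adjoint (S \<circ> T) = S \<circ> T"
  have "\<exists>!S. ?P S"
    using penrose_exists[OF T] penrose_unique[OF T] by metis
  then have "?P (pseudoinverse T)"
    unfolding pseudoinverse_def by (rule theI')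
  then show "linear (pseudoinverse T)" "T (pseudoinverse T (T v)) = T v"
    by (auto simp: fun_eq_iff)
qed

lemma norm_le_onorm_on:
  fixes f :: "'a::euclidean_space \<Rightarrow> 'b::euclidean_space"
  assumes f: "linear f" and "x \<in> S"
  shows "norm (f x) \<le> onorm_on S f * norm x"
proof -
  have bl: "bounded_linear f"
    using f by (simp add: linear_conv_bounded_linear)
  \<comment> \<open>A real supremum is informative only for a bounded set; here the operator norm on
    the whole space is a bound, and \<open>x = 0\<close> contributes the quotient 0/0 = 0.\<close>
  have "bdd_above ((\<lambda>x. norm (f x) / norm x) ` S)"
    by (rule bdd_aboveI[of _ "onorm f"]) (use le_onorm[OF bl] in auto)
  then have "norm (f x) / norm x \<le> onorm_on S f"
    unfolding onorm_on_def by (rule cSUP_upper[OF assms(2)])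
  then show ?thesis
    using linear_0[OF f] by (cases "x = 0") (auto simp: divide_simps mult.commute)
qed

section \<open>Faces of self-dual cones\<close>

text \<open>The common core of the orthant, Lorentz and semidefinite cases: \<open>p\<close> is the
  Peirce projection onto the span of the face of \<open>K\<close> orthogonal to \<open>x\<close>.
  The subspace \<open>V\<close> is a parameter because each factor of a product occupies only a part
  of the ambient space. Symmetry on the whole space already yields linearity.\<close>

definition face_projector ::
    "'a::real_inner set \<Rightarrow> 'a set \<Rightarrow> 'a \<Rightarrow> ('a \<Rightarrow> 'a) \<Rightarrow> real \<Rightarrow> bool" where
  "face_projector V K x p C \<longleftrightarrow>
     (\<forall>t\<in>V. p t \<in> V) \<and> (\<forall>t\<in>V. \<forall>r\<in>V. p t \<bullet> r = t \<bullet> p r) \<and>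
     (\<forall>t\<in>K. p t \<in> K \<and> x \<bullet> p t = 0 \<and> (norm (t - p t))\<^sup>2 \<le> C * (x \<bullet> t) * norm t)"

text \<open>Self-duality is relative to \<open>V\<close>, so it can be checked factor by factor
  before the factors are assembled.\<close>

definition peirce_cone :: "'a::real_inner set \<Rightarrow> 'a set \<Rightarrow> bool" where
  "peirce_cone V K \<longleftrightarrow>
     K \<subseteq> V \<and> (\<forall>s\<in>V. s \<in> K \<longleftrightarrow> (\<forall>x\<in>K. 0 \<le> s \<bullet> x)) \<and> (\<forall>x\<in>K. \<exists>p C. face_projector V K x p C)"

definition face_proj :: "'a::real_inner set \<Rightarrow> 'a \<Rightarrow> 'a \<Rightarrow> 'a" where
  "face_proj K x = (SOME p. \<exists>C. face_projector UNIV K x p C)"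

lemma onorm_pos_bound:
  fixes f :: "'a::euclidean_space \<Rightarrow> 'b::euclidean_space"
  assumes "linear f"
  obtains C where "C > 0" "\<And>v. norm (f v) \<le> C * norm v"
proof -
  have "bounded_linear f"
    using assms by (simp add: linear_conv_bounded_linear)
  then obtain C where "C > 0" "\<forall>v. norm (f v) \<le> norm v * C"
    using bounded_linear.pos_bounded by blast
  then show thesis
    by (intro that[of C]) (simp_all add: mult.commute)
qed

locale full_peirce_cone =
  fixes K :: "'a::euclidean_space set"
  assumes peirce: "peirce_cone UNIV K"
begin

lemma mem_iff: "s \<in> K \<longleftrightarrow> (\<forall>x\<in>K. 0 \<le> s \<bullet> x)"
  using peirce unfolding peirce_cone_def by blast

lemma dual_cone_eq: "dual_cone K = K"
  unfolding dual_cone_def using mem_iff by blast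

lemma inner_nonneg: "s \<in> K \<Longrightarrow> x \<in> K \<Longrightarrow> 0 \<le> s \<bullet> x"
  using mem_iff by blast

lemma add_mem: "s \<in> K \<Longrightarrow> t \<in> K \<Longrightarrow> s + t \<in> K"
  by (simp add: mem_iff[of "s + t"] inner_add_left inner_nonneg)

lemma zero_mem: "0 \<in> K"
  by (simp add: mem_iff[of 0])

lemma ex_face_projector: "x \<in> K \<Longrightarrow> \<exists>C. face_projector UNIV K x (face_proj K x) C"
  using peirce someI_ex[of "\<lambda>p. \<exists>C. face_projector UNIV K x p C"]
  unfolding peirce_cone_def face_proj_def by blast

lemma face_proj_sym:
  assumes "x \<in> K"
  shows "face_proj K x t \<bullet> r = t \<bullet> face_proj K x r"
  using ex_face_projector[OF assms] by (auto simp: face_projector_def)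

text \<open>A map that is its own adjoint is linear: both sides of each identity have the same inner
  product with every vector.\<close>

lemma face_proj_linear:
  assumes x: "x \<in> K"
  shows "linear (face_proj K x)"
proof (rule linearI)
  have *: "u = v" if "\<And>r. u \<bullet> r = v \<bullet> r" for u v :: 'a
    using that vector_eq_rdot by blast
  show "face_proj K x (s + t) = face_proj K x s + face_proj K x t" for s t
    by (rule *) (simp add: face_proj_sym[OF x] inner_add_left)
  show "face_proj K x (a *\<^sub>R t) = a *\<^sub>R face_proj K x t" for a t
    by (rule *) (simp add: face_proj_sym[OF x])
qed

lemma face_proj_mem:
  assumes "x \<in> K" "t \<in> K"
  shows "face_proj K x t \<in> K"
  using ex_face_projector[OF assms(1)] assms(2) by (auto simp: face_projector_def)

lemma face_proj_orth:
  assumes "x \<in> K" "t \<in> K"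
  shows "x \<bullet> face_proj K x t = 0"
  using ex_face_projector[OF assms(1)] assms(2) by (auto simp: face_projector_def)

lemma face_proj_error:
  assumes "x \<in> K"
  obtains C where "C > 0"
    "\<And>t. t \<in> K \<Longrightarrow> (norm (t - face_proj K x t))\<^sup>2 \<le> C * (x \<bullet> t) * norm t"
proof -
  obtain C where C: "face_projector UNIV K x (face_proj K x) C"
    using ex_face_projector[OF assms] by blast
  have "(norm (t - face_proj K x t))\<^sup>2 \<le> (\<bar>C\<bar> + 1) * (x \<bullet> t) * norm t" if "t \<in> K" for t
  proof -
    have "(norm (t - face_proj K x t))\<^sup>2 \<le> C * (x \<bullet> t) * norm t"
      using C that by (simp add: face_projector_def)
    also have "\<dots> \<le> (\<bar>C\<bar> + 1) * (x \<bullet> t) * norm t"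
      using inner_nonneg[OF assms that] by (intro mult_right_mono) auto
    finally show ?thesis .
  qed
  then show thesis
    using that[of "\<bar>C\<bar> + 1"] by simp
qed

lemma face_proj_fix:
  assumes "x \<in> K" "t \<in> K" "x \<bullet> t = 0"
  shows "face_proj K x t = t"
proof -
  obtain C where "\<And>t. t \<in> K \<Longrightarrow> (norm (t - face_proj K x t))\<^sup>2 \<le> C * (x \<bullet> t) * norm t"
    using face_proj_error[OF assms(1)] by blast
  from this[OF assms(2)] show ?thesis
    using assms(3) by simp
qed

lemma face_proj_self:
  assumes "x \<in> K"
  shows "face_proj K x x = 0"
proof -
  \<comment> \<open>\<open>p x\<close> lies in the face orthogonal to \<open>x\<close>, hence is
    fixed by \<open>p\<close>; symmetry then turns its squared norm into
    \<open>x \<bullet> p x = 0\<close>.\<close>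
  have "face_proj K x (face_proj K x x) = face_proj K x x"
    using assms by (intro face_proj_fix face_proj_mem face_proj_orth)
  then have "face_proj K x x \<bullet> face_proj K x x = 0"
    using face_proj_sym[OF assms, of x "face_proj K x x"] face_proj_orth[OF assms assms] by simp
  then show ?thesis by simp
qed

section \<open>Relative interiors of faces under strict complementarity\<close>

lemma ex_face_ball:
  assumes x: "x \<in> K" and s: "s \<in> K" and sc: "x + s \<in> interior K"
  obtains e where "e > 0"
    "\<And>t. face_proj K x t = t \<Longrightarrow> dist t s < e \<Longrightarrow> t \<in> K \<and> x \<bullet> t = 0"
proof -
  obtain e where e: "e > 0" "ball (x + s) e \<subseteq> K"
    using sc by (auto simp: mem_interior)
  have "t \<in> K \<and> x \<bullet> t = 0" if t: "face_proj K x t = t" "dist t s < e" for t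
  proof -
    have "x + t \<in> K"
      using e(2) t(2) by (auto simp: dist_norm subset_iff norm_minus_commute)
    \<comment> \<open>\<open>p\<close> annihilates \<open>x\<close> and fixes \<open>t\<close>, so
      it maps \<open>x + t\<close> to \<open>t\<close>.\<close>
    from face_proj_mem[OF x this] face_proj_orth[OF x this] show ?thesis
      using face_proj_self[OF x] t(1) by (simp add: linear_add[OF face_proj_linear[OF x]])
  qed
  then show thesis
    using that e(1) by blast
qed

text \<open>Since \<open>s\<close> is a relative interior point of the face orthogonal to
  \<open>x\<close>, a small step from \<open>s\<close> in direction \<open>- t\<close> stays in
  \<open>K\<close>; pairing it with \<open>f\<close>, which annihilates \<open>s\<close>, gives
  \<open>f \<bullet> t \<le> 0\<close>.\<close>

lemma face_orthogonal:
  assumes x: "x \<in> K" and s: "s \<in> K" and xs: "x \<bullet> s = 0" and sc: "x + s \<in> interior K"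
    and f: "f \<in> K" "f \<bullet> s = 0" and t: "t \<in> K" "x \<bullet> t = 0"
  shows "f \<bullet> t = 0"
proof -
  note lin = face_proj_linear[OF x]
  obtain e where e: "e > 0"
    "\<And>t. face_proj K x t = t \<Longrightarrow> dist t s < e \<Longrightarrow> t \<in> K \<and> x \<bullet> t = 0"
    using ex_face_ball[OF x s sc] by blast
  define a where "a = e / (norm t + 1)"
  have a: "a > 0"
    using e(1) by (simp add: a_def add_nonneg_pos)
  have "a * norm t < e"
    using e(1) by (simp add: a_def divide_simps add_nonneg_pos)
  then have "s - a *\<^sub>R t \<in> K"
    using e(2)[of "s - a *\<^sub>R t"] face_proj_fix[OF x s xs] face_proj_fix[OF x t] a
    by (simp add: dist_norm linear_diff[OF lin] linear_scale[OF lin])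
  from inner_nonneg[OF f(1) this] have "a * (f \<bullet> t) \<le> 0"
    using f(2) by (simp add: inner_diff_right)
  then have "f \<bullet> t \<le> 0"
    using a by (simp add: mult_le_0_iff)
  then show ?thesis
    using inner_nonneg[OF f(1) t(1)] by simp
qed

text \<open>For \<open>t\<close> near \<open>s\<close> the reflection \<open>2 t - s\<close> of
  \<open>s\<close> about \<open>t\<close> still lies in the face, and pairing it with
  \<open>u\<close> is the claim. It controls the pairing with one fixed element by pairings with all
  nearby elements of its face, uniformly in \<open>u\<close>.\<close>

lemma ex_face_order:
  assumes x: "x \<in> K" and s: "s \<in> K" and xs: "x \<bullet> s = 0" and sc: "x + s \<in> interior K"
  obtains e where "e > 0"
    "\<And>t u. t \<in> K \<Longrightarrow> x \<bullet> t = 0 \<Longrightarrow> dist t s < e \<Longrightarrow> u \<in> K \<Longrightarrow> s \<bullet> u \<le> 2 * (t \<bullet> u)"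
proof -
  note lin = face_proj_linear[OF x]
  obtain e where e: "e > 0"
    "\<And>t. face_proj K x t = t \<Longrightarrow> dist t s < e \<Longrightarrow> t \<in> K \<and> x \<bullet> t = 0"
    using ex_face_ball[OF x s sc] by blast
  have "s \<bullet> u \<le> 2 * (t \<bullet> u)" if t: "t \<in> K" "x \<bullet> t = 0" "dist t s < e / 2" and u: "u \<in> K" for t u
  proof -
    have "2 *\<^sub>R t - s - s = 2 *\<^sub>R (t - s)"
      by (simp add: algebra_simps scaleR_2)
    then have "dist (2 *\<^sub>R t - s) s < e"
      using t(3) by (simp add: dist_norm)
    moreover have "face_proj K x (2 *\<^sub>R t - s) = 2 *\<^sub>R t - s"
      using face_proj_fix[OF x s xs] face_proj_fix[OF x t(1,2)]
      by (simp add: linear_diff[OF lin] linear_scale[OF lin])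
    ultimately have "2 *\<^sub>R t - s \<in> K"
      using e(2) by blast
    from inner_nonneg[OF this u] show ?thesis
      by (simp add: inner_diff_left)
  qed
  then show thesis
    using that[of "e / 2"] e(1) by simp
qed

text \<open>Near the relative interior point \<open>s\<close>, the cone imposes nothing within the
  span of the face, so what remains is the linear system \<open>M z = M s\<close>,
  \<open>p z = z\<close>. The kernel error bound for \<open>T\<close> solves it.\<close>

lemma face_affine_error_bound:
  fixes M :: "'a \<Rightarrow> 'b::euclidean_space"
  assumes x: "x \<in> K" and s: "s \<in> K" and xs: "x \<bullet> s = 0" and sc: "x + s \<in> interior K"
    and M: "linear M"
  obtains C e where "C > 0" "e > 0"
    "\<And>v. dist v s < e \<Longrightarrow> \<exists>z\<in>K. x \<bullet> z = 0 \<and> M z = M s \<and>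
        norm (v - z) \<le> C * (norm (M (v - s)) + norm (v - face_proj K x v))"
proof -
  note lin = face_proj_linear[OF x]
  have ps: "face_proj K x s = s"
    by (rule face_proj_fix[OF x s xs])
  obtain e where e: "e > 0"
    "\<And>t. face_proj K x t = t \<Longrightarrow> dist t s < e \<Longrightarrow> t \<in> K \<and> x \<bullet> t = 0"
    using ex_face_ball[OF x s sc] by blast
  define T where "T v = (M v, v - face_proj K x v)" for v
  have T: "linear T"
    unfolding T_def
    by (rule linearI) (simp_all add: linear_add[OF lin] linear_scale[OF lin] linear_add[OF M]
        linear_scale[OF M] algebra_simps)
  obtain C where C: "C > 0" "\<And>v. \<exists>z. T z = 0 \<and> norm (v - z) \<le> C * norm (T v)"
    using linear_kernel_error_bound[OF T] by blast
  obtain D where D: "D > 0" "\<And>v. norm (T v) \<le> D * norm v"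
    using onorm_pos_bound[OF T] by blast
  \<comment> \<open>The correction \<open>z\<close> has norm at most
    \<open>(1 + C * D) * norm (v - s)\<close>; this radius keeps \<open>s + z\<close> in the ball
    where membership in the face is automatic.\<close>
  define r where "r = e / (1 + C * D)"
  have CD: "1 + C * D > 0"
    using C(1) D(1) by (simp add: add_pos_pos)
  have "\<exists>z\<in>K. x \<bullet> z = 0 \<and> M z = M s \<and>
      norm (v - z) \<le> C * (norm (M (v - s)) + norm (v - face_proj K x v))" if v: "dist v s < r" for v
  proof -
    obtain z where z: "T z = 0" "norm (v - s - z) \<le> C * norm (T (v - s))"
      using C(2) by blast
    have "norm z \<le> norm (v - s) + norm (v - s - z)"
      by (metis norm_minus_commute norm_triangle_sub add_diff_cancel_left' diff_add_cancel)
    also have "\<dots> \<le> norm (v - s) + C * (D * norm (v - s))"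
      using z(2) C(1) D(2)[of "v - s"] by (smt (verit) mult_left_mono)
    also have "\<dots> = (1 + C * D) * norm (v - s)"
      by (simp add: algebra_simps)
    also have "\<dots> < e"
      using v CD by (simp add: r_def dist_norm pos_less_divide_eq mult.commute)
    finally have "dist (s + z) s < e"
      by (simp add: dist_norm)
    moreover have "face_proj K x (s + z) = s + z"
      using z(1) ps by (simp add: T_def linear_add[OF lin] prod_eq_iff)
    ultimately have "s + z \<in> K \<and> x \<bullet> (s + z) = 0"
      using e(2) by blast
    moreover have "M (s + z) = M s"
      using z(1) by (simp add: T_def linear_add[OF M] prod_eq_iff)
    moreover have "T (v - s) = (M (v - s), v - face_proj K x v)"
      by (simp add: T_def linear_diff[OF lin] ps)
    then have "norm (v - (s + z)) \<le> C * (norm (M (v - s)) + norm (v - face_proj K x v))"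
      using z(2) C(1) norm_Pair_le[of "M (v - s)" "v - face_proj K x v"]
      by (smt (verit) diff_diff_eq mult_left_mono)
    ultimately show ?thesis by blast
  qed
  moreover have "r > 0"
    using e(1) CD by (simp add: r_def)
  ultimately show thesis
    using that C(1) by blast
qed

text \<open>
  Split \<open>u = u\<^sub>0 + e\<close> along the face \<open>K \<inter> s\<^sup>\<bottom>\<close> and \<open>t = t\<^sub>0 + d\<close> along \<open>K \<inter> x\<^sup>\<bottom>\<close>.
  These faces are orthogonal and \<open>u \<bullet> t\<^sub>0 \<ge> 0\<close>, so \<open>u \<bullet> t = 0\<close> gives \<open>u\<^sub>0 \<bullet> t \<le> \<bar>e\<bar> \<bar>d\<bar>\<close>,
  whereas \<open>u\<^sub>0 \<bullet> t\<close> dominates a multiple of \<open>\<bar>d\<bar>\<^sup>2\<close>.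
\<close>

lemma complementary_face_calmness:
  assumes x: "x \<in> K" and s: "s \<in> K" and xs: "x \<bullet> s = 0" and sc: "x + s \<in> interior K"
  obtains C r where "C > 0" "r > 0"
    "\<And>f u t. f \<in> K \<Longrightarrow> f \<bullet> s = 0 \<Longrightarrow> u \<in> K \<Longrightarrow> t \<in> K \<Longrightarrow> u \<bullet> t = 0 \<Longrightarrow>
       dist u x < r \<Longrightarrow> dist t s < r \<Longrightarrow>
       \<exists>t0\<in>K. x \<bullet> t0 = 0 \<and> norm (t - t0) \<le> C * norm (u - f)"
proof -
  let ?p = "face_proj K x" and ?q = "face_proj K s"
  note linq = face_proj_linear[OF s]
  have sx: "s \<bullet> x = 0" and sc': "s + x \<in> interior K"
    using xs sc by (simp_all add: inner_commute add.commute)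
  obtain e where e: "e > 0"
    "\<And>t u. t \<in> K \<Longrightarrow> s \<bullet> t = 0 \<Longrightarrow> dist t x < e \<Longrightarrow> u \<in> K \<Longrightarrow> x \<bullet> u \<le> 2 * (t \<bullet> u)"
    using ex_face_order[OF s x sx sc'] by blast
  obtain C where C: "C > 0"
    "\<And>t. t \<in> K \<Longrightarrow> (norm (t - ?p t))\<^sup>2 \<le> C * (x \<bullet> t) * norm t"
    using face_proj_error[OF x] by blast
  obtain D where D: "D > 0" "\<And>v. norm (?q v) \<le> D * norm v"
    using onorm_pos_bound[OF linq] by blast
  define r where "r = min 1 (e / D)"
  define C' where "C' = 2 * C * (norm s + 1) * (1 + D)"
  have pos: "C' > 0"
    using C(1) D(1) by (simp add: C'_def add_nonneg_pos)
  have "\<exists>t0\<in>K. x \<bullet> t0 = 0 \<and> norm (t - t0) \<le> C' * norm (u - f)"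
    if f: "f \<in> K" "f \<bullet> s = 0" and u: "u \<in> K" and t: "t \<in> K" and ut: "u \<bullet> t = 0"
      and near: "dist u x < r" "dist t s < r" for f u t
  proof -
    define u0 where "u0 = ?q u"
    define t0 where "t0 = ?p t"
    have u0: "u0 \<in> K" "s \<bullet> u0 = 0"
      using face_proj_mem[OF s u] face_proj_orth[OF s u] by (simp_all add: u0_def)
    have t0: "t0 \<in> K" "x \<bullet> t0 = 0"
      using face_proj_mem[OF x t] face_proj_orth[OF x t] by (simp_all add: t0_def)
    have u0t0: "u0 \<bullet> t0 = 0"
      using face_orthogonal[OF x s xs sc u0(1) _ t0] u0(2) by (simp add: inner_commute)
    have "u0 - x = ?q (u - x)"
      by (simp add: u0_def linear_diff[OF linq] face_proj_fix[OF s x sx])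
    then have "dist u0 x \<le> D * dist u x"
      using D(2)[of "u - x"] by (simp add: dist_norm)
    also have "\<dots> < e"
      using near(1) D(1) by (simp add: r_def pos_less_divide_eq mult.commute)
    \<comment> \<open>\<open>u0\<close> lies near \<open>x\<close> in the face orthogonal to
      \<open>s\<close>, so the reference \<open>x\<close> in the projector estimate may be traded
      for \<open>u0\<close> at a factor 2.\<close>
    finally have xt: "x \<bullet> t \<le> 2 * (u0 \<bullet> t)"
      using e(2)[OF u0] t by blast
    \<comment> \<open>\<open>f\<close> is fixed by the projector; the part of \<open>u\<close> off
      the face is therefore measured from the varying \<open>f\<close> and not only from
      \<open>x\<close>.\<close>
    have "u - u0 = (u - f) - ?q (u - f)"
      using face_proj_fix[OF s f(1)] f(2)
      by (simp add: u0_def linear_diff[OF linq] inner_commute)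
    then have eb: "norm (u - u0) \<le> (1 + D) * norm (u - f)"
      using D(2)[of "u - f"] norm_triangle_ineq4[of "u - f" "?q (u - f)"]
      by (simp add: algebra_simps)
    have "u0 \<bullet> t = u0 \<bullet> (t - t0)"
      using u0t0 by (simp add: inner_diff_right)
    also have "\<dots> = u \<bullet> t - u \<bullet> t0 - (u - u0) \<bullet> (t - t0)"
      by (simp add: inner_simps)
    also have "\<dots> \<le> norm (u - u0) * norm (t - t0)"
      using ut inner_nonneg[OF u t0(1)] Cauchy_Schwarz_ineq2[of "u - u0" "t - t0"]
      by linarith
    finally have u0t: "u0 \<bullet> t \<le> norm (u - u0) * norm (t - t0)" .
    have nt: "norm t \<le> norm s + 1"
      using near(2) norm_triangle_sub[of t s] by (simp add: r_def dist_norm)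
    have "(norm (t - t0))\<^sup>2 \<le> C * (x \<bullet> t) * norm t"
      using C(2)[OF t] by (simp add: t0_def)
    also have "\<dots> \<le> C * (2 * (norm (u - u0) * norm (t - t0))) * (norm s + 1)"
      using xt u0t nt C(1) inner_nonneg[OF x t]
      by (intro mult_mono mult_left_mono) auto
    finally have "norm (t - t0) * norm (t - t0)
        \<le> (2 * C * (norm s + 1) * norm (u - u0)) * norm (t - t0)"
      by (simp only: power2_eq_square mult_ac)
    moreover have "0 \<le> 2 * C * (norm s + 1) * norm (u - u0)"
      using C(1) by simp
    \<comment> \<open>One factor \<open>norm (t - t0)\<close> cancels: here a square-root estimate
      improves to a linear one.\<close>
    ultimately have "norm (t - t0) \<le> 2 * C * (norm s + 1) * norm (u - u0)"
      by (cases "t - t0 = 0") (auto simp: mult_le_cancel_right)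
    also have "\<dots> \<le> 2 * C * (norm s + 1) * ((1 + D) * norm (u - f))"
      using C(1) eb by (intro mult_left_mono) auto
    finally have "norm (t - t0) \<le> C' * norm (u - f)"
      by (simp add: C'_def mult_ac)
    then show ?thesis
      using t0 by blast
  qed
  moreover have "r > 0"
    using e(1) D(1) by (simp add: r_def)
  ultimately show thesis
    using that pos by blast
qed

end

section \<open>Lorentz cones, orthants and semidefinite cones\<close>

lemma peirce_coneI:
  assumes "K \<subseteq> V"
    and "\<And>s x. s \<in> K \<Longrightarrow> x \<in> K \<Longrightarrow> 0 \<le> s \<bullet> x"
    and "\<And>s. s \<in> V \<Longrightarrow> (\<And>x. x \<in> K \<Longrightarrow> 0 \<le> s \<bullet> x) \<Longrightarrow> s \<in> K"
    and "\<And>x. x \<in> K \<Longrightarrow> \<exists>p C. face_projector V K x p C"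
  shows "peirce_cone V K"
  using assms unfolding peirce_cone_def by (metis (no_types))

text \<open>With \<open>h x\<close> the part of \<open>x\<close> orthogonal to the axis
  \<open>e\<close>, the inequalities say \<open>norm (h x) \<le> x \<bullet> e\<close>. The form
  through an axis also covers rotated cones. For \<open>a\<close> the apex, an interior point or
  another boundary point, the complementary face is the whole cone, the origin, or the ray of the
  reflected vector \<open>q\<close>.\<close>

lemma peirce_cone_Lorentz:
  fixes V :: "'a::euclidean_space set"
  assumes V: "subspace V" and e: "e \<in> V" "norm e = 1"
  shows "peirce_cone V {x \<in> V. 0 \<le> x \<bullet> e \<and> x \<bullet> x \<le> 2 * (x \<bullet> e)\<^sup>2}" (is "peirce_cone V ?K")
proof -
  have ee: "e \<bullet> e = 1"
    using e(2) by (simp add: norm_eq_1)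
  define h where "h x = x - (x \<bullet> e) *\<^sub>R e" for x
  have h_inner: "h x \<bullet> h y = x \<bullet> y - (x \<bullet> e) * (y \<bullet> e)" for x y
    by (simp add: h_def inner_simps ee inner_commute algebra_simps)
  have inner_split: "x \<bullet> y = (x \<bullet> e) * (y \<bullet> e) + h x \<bullet> h y" for x y
    by (simp add: h_inner)
  have he: "h x \<bullet> e = 0" for x
    by (simp add: h_def inner_simps ee)
  have hV: "h x \<in> V" if "x \<in> V" for x
    using that V e by (simp add: h_def subspace_diff subspace_scale)
  have mem: "x \<in> ?K \<longleftrightarrow> norm (h x) \<le> x \<bullet> e" if "x \<in> V" for x
  proof -
    have "(norm (h x))\<^sup>2 \<le> (x \<bullet> e)\<^sup>2 \<longleftrightarrow> x \<bullet> x \<le> 2 * (x \<bullet> e)\<^sup>2"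
      unfolding power2_norm_eq_inner h_inner by (simp add: power2_eq_square)
    moreover have "norm (h x) \<le> x \<bullet> e \<longleftrightarrow> 0 \<le> x \<bullet> e \<and> (norm (h x))\<^sup>2 \<le> (x \<bullet> e)\<^sup>2"
      by (metis norm_ge_zero order_trans power2_le_imp_le power_mono)
    ultimately show ?thesis
      using that by simp
  qed
  have hK: "norm (h x) \<le> x \<bullet> e" if "x \<in> ?K" for x
    using mem that by blast
  have h_bound: "\<bar>h x \<bullet> h y\<bar> \<le> norm (h x) * (y \<bullet> e)" if "y \<in> ?K" for x y
    using Cauchy_Schwarz_ineq2[of "h x" "h y"] mult_left_mono[OF hK[OF that] norm_ge_zero, of "h x"]
    by linarith
  have nonneg: "0 \<le> x \<bullet> y" if "x \<in> ?K" "y \<in> ?K" for x y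
  proof -
    have "norm (h x) * (y \<bullet> e) \<le> (x \<bullet> e) * (y \<bullet> e)"
      using hK[OF that(1)] that(2) by (intro mult_right_mono) auto
    then show ?thesis
      using h_bound[OF that(2), of x] inner_split[of x y] by linarith
  qed
  \<comment> \<open>The reflected vector serves twice: as the test vector for self-duality and, for
    \<open>a\<close> on the boundary, as the generator of the complementary ray.\<close>
  have reflect: "norm (h s) *\<^sub>R e - h s \<in> ?K" if "s \<in> V" for s
  proof (subst mem)
    show "norm (h s) *\<^sub>R e - h s \<in> V"
      using that V e hV by (simp add: subspace_diff subspace_scale)
    have "h (norm (h s) *\<^sub>R e - h s) = - h s"
      unfolding h_def[of "norm (h s) *\<^sub>R e - h s"] by (simp add: inner_diff_left ee he)
    then show "norm (h (norm (h s) *\<^sub>R e - h s)) \<le> (norm (h s) *\<^sub>R e - h s) \<bullet> e"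
      by (simp add: inner_diff_left ee he)
  qed
  show ?thesis
  proof (rule peirce_coneI)
    fix s assume s: "s \<in> V" and dual: "\<And>x. x \<in> ?K \<Longrightarrow> 0 \<le> s \<bullet> x"
    have "h e = 0"
      by (simp add: h_def ee)
    then have "0 \<le> s \<bullet> e"
      using dual[of e] mem[OF e(1)] ee by simp
    moreover have "0 \<le> norm (h s) * (s \<bullet> e) - s \<bullet> h s"
      using dual[OF reflect[OF s]] by (simp add: inner_diff_right)
    moreover have "s \<bullet> h s = norm (h s) * norm (h s)"
    proof -
      have "h s \<bullet> h s = s \<bullet> h s"
        using he[of s] by (metis diff_zero h_def inner_commute inner_diff_left inner_scaleR_left mult_zero_right)
      then show ?thesis
        by (simp flip: power2_norm_eq_inner power2_eq_square)
    qed
    ultimately have "norm (h s) \<le> s \<bullet> e"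
      by (cases "h s = 0") (auto simp: mult_le_cancel_left)
    then show "s \<in> ?K"
      using mem[OF s] by blast
  next
    fix a assume a: "a \<in> ?K"
    have aV: "a \<in> V"
      using a by simp
    consider "a = 0" | "norm (h a) < a \<bullet> e" | "0 < a \<bullet> e" "norm (h a) = a \<bullet> e"
    proof (cases "a \<bullet> e = 0")
      case True
      then have "a \<bullet> a = 0"
        using a inner_ge_zero[of a] by simp
      then show ?thesis
        using that(1) by simp
    next
      case False
      then show ?thesis
        using that(2,3) hK[OF a] a by fastforce
    qed
    then show "\<exists>p C. face_projector V ?K a p C"
    proof cases
      case 1
      then have "face_projector V ?K a (\<lambda>t. t) 0"
        by (simp add: face_projector_def)
      then show ?thesis by blast
    next
      case 2
      \<comment> \<open>The margin of \<open>a\<close> inside the cone. It gives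
        \<open>m * (t \<bullet> e) \<le> a \<bullet> t\<close>, and \<open>t \<bullet> t\<close> is
        at most \<open>2 * (t \<bullet> e)\<^sup>2\<close>; hence the constant \<open>2 / m\<close>
        for the zero projector.\<close>
      define m where "m = a \<bullet> e - norm (h a)"
      have m: "m > 0"
        using 2 by (simp add: m_def)
      have "t \<bullet> t \<le> 2 / m * (a \<bullet> t) * norm t" if t: "t \<in> ?K" for t
      proof -
        have te: "0 \<le> t \<bullet> e" "t \<bullet> e \<le> norm t"
          using t norm_cauchy_schwarz[of t e] e(2) by auto
        have "m * (t \<bullet> e) \<le> a \<bullet> t"
          using h_bound[OF t, of a] inner_split[of a t] by (simp add: m_def algebra_simps abs_le_iff)
        then have "t \<bullet> e \<le> a \<bullet> t / m"
          using m by (simp add: field_simps)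
        moreover have "t \<bullet> t \<le> 2 * (t \<bullet> e) * (t \<bullet> e)"
          using t by (simp add: power2_eq_square)
        moreover have "2 * (t \<bullet> e) * (t \<bullet> e) \<le> 2 * (a \<bullet> t / m) * norm t"
          using te calculation(1) by (intro mult_mono) auto
        ultimately show ?thesis
          by simp
      qed
      then have "face_projector V ?K a (\<lambda>t. 0) (2 / m)"
        using V by (simp add: face_projector_def subspace_0 power2_norm_eq_inner)
      then show ?thesis by blast
    next
      case 3
      define q where "q = norm (h a) *\<^sub>R e - h a"
      define r where "r = a \<bullet> e"
      have r: "r > 0" "norm (h a) = r"
        using 3 by (simp_all add: r_def)
      have q: "q \<in> ?K"
        using reflect[OF aV] by (simp add: q_def)
      have qt: "t \<bullet> q = r * (t \<bullet> e) - h t \<bullet> h a" for t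
        using he[of a] by (simp add: q_def r inner_diff_right h_def[of t] inner_diff_left inner_commute)
      have ha: "h a \<bullet> h a = r * r"
        using r(2) by (metis power2_eq_square power2_norm_eq_inner)
      have aq: "a \<bullet> q = 0"
        using qt[of a] ha by (simp add: r_def)
      have "q \<bullet> e = r" "h q = - h a"
        unfolding h_def[of q] by (simp_all add: q_def inner_diff_left ee he r)
      then have qq: "q \<bullet> q = 2 * r\<^sup>2"
        using qt[of q] ha by (simp add: power2_eq_square)
      \<comment> \<open>The orthogonal projection onto the line of \<open>q\<close>, since
        \<open>q \<bullet> q = 2 * r\<^sup>2\<close>.\<close>
      define p where "p t = ((t \<bullet> q) / (2 * r\<^sup>2)) *\<^sub>R q" for t
      have "p t \<in> V" if "t \<in> V" for t
        using q V by (simp add: p_def subspace_scale)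
      moreover have "p t \<bullet> s = t \<bullet> p s" for t s
        by (simp add: p_def inner_commute)
      moreover have "p t \<in> ?K" if "t \<in> ?K" for t
      proof -
        define w where "w = (t \<bullet> q) / (2 * r\<^sup>2)"
        have "0 \<le> w"
          using nonneg[OF that q] by (simp add: w_def)
        then have "w *\<^sub>R q \<in> ?K"
          using q V mult_left_mono[of "q \<bullet> q" "2 * (q \<bullet> e)\<^sup>2" "w * w"]
          by (simp add: subspace_scale power2_eq_square mult_ac)
        then show ?thesis
          by (simp add: p_def w_def)
      qed
      moreover have "a \<bullet> p t = 0" for t
        by (simp add: p_def aq)
      moreover have "(norm (t - p t))\<^sup>2 \<le> 2 / r * (a \<bullet> t) * norm t" if t: "t \<in> ?K" for t
      proof -
        define u where "u = t \<bullet> e"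
        define d where "d = h t \<bullet> h a"
        have u: "0 \<le> u" "u \<le> norm t" "t \<bullet> t \<le> 2 * u\<^sup>2"
          using t norm_cauchy_schwarz[of t e] e(2) by (auto simp: u_def)
        have d: "\<bar>d\<bar> \<le> r * u"
          using h_bound[OF t, of a] r(2) by (simp add: d_def u_def inner_commute)
        have at: "a \<bullet> t = r * u + d"
          using inner_split[of a t] by (simp add: r_def u_def d_def inner_commute)
        have "(norm (t - p t))\<^sup>2 = t \<bullet> t - 2 * (t \<bullet> p t) + p t \<bullet> p t"
          by (simp add: power2_norm_eq_inner inner_simps inner_commute)
        also have "\<dots> = t \<bullet> t - (t \<bullet> q)\<^sup>2 / (2 * r\<^sup>2)"
          using r(1) by (simp add: p_def qq field_simps power2_eq_square)
        also have "\<dots> \<le> 2 * u\<^sup>2 - (r * u - d)\<^sup>2 / (2 * r\<^sup>2)"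
          using u(3) qt[of t] by (simp add: u_def d_def)
        \<comment> \<open>A difference of squares whose first factor is exactly
          \<open>a \<bullet> t\<close>; the second is at most \<open>4 * (r * u)\<close> because
          \<open>\<bar>d\<bar> \<le> r * u\<close>.\<close>
        also have "\<dots> = (r * u + d) * (3 * (r * u) - d) / (2 * r\<^sup>2)"
          using r(1) by (simp add: field_simps power2_eq_square)
        also have "\<dots> \<le> (r * u + d) * (4 * (r * u)) / (2 * r\<^sup>2)"
          using d by (intro divide_right_mono mult_left_mono) auto
        also have "\<dots> = 2 / r * (a \<bullet> t) * u"
          using r(1) by (simp add: at field_simps power2_eq_square)
        also have "\<dots> \<le> 2 / r * (a \<bullet> t) * norm t"
          using u(2) r(1) d at by (intro mult_left_mono) auto
        finally show ?thesis .
      qed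
      ultimately have "face_projector V ?K a p (2 / r)"
        unfolding face_projector_def by blast
      then show ?thesis by blast
    qed
  next
    show "0 \<le> s \<bullet> x" if "s \<in> ?K" "x \<in> ?K" for s x
      using that by (rule nonneg)
  qed auto
qed

lemma peirce_cone_orthant:
  fixes V :: "'a::euclidean_space set" and d :: "nat \<Rightarrow> 'a"
  assumes V: "subspace V" and dV: "\<And>i. i < n \<Longrightarrow> d i \<in> V"
    and orth: "\<And>i j. i < n \<Longrightarrow> j < n \<Longrightarrow> d i \<bullet> d j = (if i = j then 1 else 0)"
    and expand: "\<And>v. v \<in> V \<Longrightarrow> v = (\<Sum>i<n. (v \<bullet> d i) *\<^sub>R d i)"
  shows "peirce_cone V {x \<in> V. \<forall>i<n. 0 \<le> x \<bullet> d i}" (is "peirce_cone V ?K")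
proof (rule peirce_coneI)
  have inner: "v \<bullet> w = (\<Sum>i<n. (v \<bullet> d i) * (w \<bullet> d i))" if "v \<in> V" for v w
  proof -
    have "v \<bullet> w = (\<Sum>i<n. (v \<bullet> d i) *\<^sub>R d i) \<bullet> w"
      by (rule arg_cong[OF expand[OF that]])
    then show ?thesis
      by (simp add: inner_sum_left inner_commute[of w])
  qed
  show "0 \<le> s \<bullet> x" if "s \<in> ?K" "x \<in> ?K" for s x
    using that by (subst inner) (auto intro!: sum_nonneg)
  show "s \<in> ?K" if "s \<in> V" and dual: "\<And>x. x \<in> ?K \<Longrightarrow> 0 \<le> s \<bullet> x" for s
    using that(1) dual[of "d _"] dV orth by auto
  fix a assume a: "a \<in> ?K"
  define Z where "Z = {i. i < n \<and> a \<bullet> d i = 0}"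
  define N where "N = {i. i < n \<and> a \<bullet> d i \<noteq> 0}"
  have ZN: "finite Z" "finite N" "{..<n} = N \<union> Z" "N \<inter> Z = {}"
    by (auto simp: Z_def N_def)
  have apos: "a \<bullet> d i > 0" if "i \<in> N" for i
    using that a by (auto simp: N_def less_le)
  \<comment> \<open>The face orthogonal to \<open>a\<close> is spanned by the \<open>d i\<close> at
    which \<open>a\<close> vanishes. A sum of reciprocals is taken for \<open>C\<close> so that it
    dominates each of them.\<close>
  define p where "p t = (\<Sum>i\<in>Z. (t \<bullet> d i) *\<^sub>R d i)" for t
  define C where "C = (\<Sum>i\<in>N. 1 / (a \<bullet> d i))"
  have pd: "p t \<bullet> d j = (if j \<in> Z then t \<bullet> d j else 0)" if "j < n" for t j
  proof -
    have "p t \<bullet> d j = (\<Sum>i\<in>Z. if i = j then t \<bullet> d i else 0)"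
      unfolding p_def inner_sum_left using that orth
      by (intro sum.cong) (auto simp: Z_def)
    then show ?thesis
      using ZN(1) by simp
  qed
  have "p t \<in> V" for t
    unfolding p_def using V dV by (intro subspace_sum subspace_scale) (auto simp: Z_def)
  moreover have "p t \<bullet> r = t \<bullet> p r" for t r
    by (simp add: p_def inner_sum_left inner_sum_right inner_commute mult.commute)
  moreover have "p t \<in> ?K" if "t \<in> ?K" for t
    using that calculation(1) pd by auto
  moreover have "a \<bullet> p t = 0" for t
    by (auto simp: p_def inner_sum_right Z_def intro!: sum.neutral)
  moreover have "(norm (t - p t))\<^sup>2 \<le> C * (a \<bullet> t) * norm t" if t: "t \<in> ?K" for t
  proof -
    have "(norm (t - p t))\<^sup>2 = (\<Sum>i<n. ((t - p t) \<bullet> d i) * ((t - p t) \<bullet> d i))"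
      using t calculation(1)[of t] V by (simp add: power2_norm_eq_inner inner subspace_diff)
    also have "\<dots> = (\<Sum>i\<in>N. (t \<bullet> d i) * (t \<bullet> d i))"
      unfolding ZN(3) using ZN(1,2,4) 
      by (subst sum.union_disjoint) (auto simp: inner_diff_left pd N_def Z_def intro!: sum.cong sum.neutral)
    also have "\<dots> \<le> (\<Sum>i\<in>N. C * ((a \<bullet> d i) * (t \<bullet> d i)) * norm t)"
    proof (rule sum_mono)
      fix i assume i: "i \<in> N"
      have td: "0 \<le> t \<bullet> d i"
        using t i by (auto simp: N_def)
      have "1 / (a \<bullet> d i) \<le> C"
        unfolding C_def using i apos ZN(2) by (intro member_le_sum) (auto intro: less_imp_le)
      then have "1 \<le> C * (a \<bullet> d i)"
        using apos[OF i] by (simp add: field_simps)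
      then have "t \<bullet> d i \<le> C * (a \<bullet> d i) * (t \<bullet> d i)"
        using td mult_right_mono by fastforce
      moreover have "t \<bullet> d i \<le> norm t"
        using norm_cauchy_schwarz[of t "d i"] orth[of i i] i by (simp add: N_def norm_eq_sqrt_inner)
      ultimately show "(t \<bullet> d i) * (t \<bullet> d i) \<le> C * ((a \<bullet> d i) * (t \<bullet> d i)) * norm t"
        using td by (simp only: mult.assoc[symmetric]) (rule mult_mono, auto)
    qed
    also have "\<dots> = C * (\<Sum>i\<in>N. (a \<bullet> d i) * (t \<bullet> d i)) * norm t"
      by (simp add: sum_distrib_left sum_distrib_right mult_ac)
    also have "(\<Sum>i\<in>N. (a \<bullet> d i) * (t \<bullet> d i)) = a \<bullet> t"
      using a ZN(1,2,4) inner[of a t] unfolding ZN(3)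
      by (simp add: sum.union_disjoint Z_def)
    finally show ?thesis .
  qed
  ultimately have "face_projector V ?K a p C"
    unfolding face_projector_def by blast
  then show "\<exists>p C. face_projector V ?K a p C" by blast
qed auto

section \<open>Semidefinite cones through self-adjoint operators\<close>

lemma self_adjoint_trace_inner:
  fixes S T :: "'a::euclidean_space \<Rightarrow> 'a"
  assumes S: "\<And>u v. S u \<bullet> v = u \<bullet> S v" and T: "\<And>u v. T u \<bullet> v = u \<bullet> T v"
    and B: "\<And>v. v = (\<Sum>b\<in>B. (v \<bullet> b) *\<^sub>R b)"
  shows "(\<Sum>e\<in>Basis. S e \<bullet> T e) = (\<Sum>b\<in>B. S b \<bullet> T b)"
proof -
  have "(\<Sum>e\<in>Basis. S e \<bullet> T e) = (\<Sum>e\<in>Basis. \<Sum>b\<in>B. (S e \<bullet> b) * (T e \<bullet> b))"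
    by (intro sum.cong refl orthonormal_inner_sum B)
  \<comment> \<open>Self-adjointness moves both operators onto \<open>b\<close>, and Parseval in the
    standard basis recombines the terms. The trace form can thus be evaluated in an
    eigenbasis.\<close>
  also have "\<dots> = (\<Sum>b\<in>B. \<Sum>e\<in>Basis. (S b \<bullet> e) * (T b \<bullet> e))"
  proof (subst sum.swap, intro sum.cong refl)
    fix b e
    show "(S e \<bullet> b) * (T e \<bullet> b) = (S b \<bullet> e) * (T b \<bullet> e)"
      using S[of e b] T[of e b] by (simp add: inner_commute)
  qed
  also have "\<dots> = (\<Sum>b\<in>B. S b \<bullet> T b)"
    by (simp flip: euclidean_inner)
  finally show ?thesis .
qed

text \<open>Obtained by evaluating the quadratic form of \<open>T\<close> at \<open>v - T v / H\<close>.\<close>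

lemma positive_semidefinite_norm_bound:
  fixes T :: "'a::euclidean_space \<Rightarrow> 'a"
  assumes T: "linear T" "\<And>u v. T u \<bullet> v = u \<bullet> T v" "\<And>v. 0 \<le> v \<bullet> T v"
    and H: "\<And>v. norm (T v) \<le> H * norm v"
  shows "(norm (T v))\<^sup>2 \<le> H * (v \<bullet> T v)"
proof (cases "H > 0")
  case True
  define w where "w = T v"
  have ww: "v \<bullet> T w = w \<bullet> w"
    using T(2)[of v w] by (simp add: w_def)
  have "w \<bullet> T w \<le> norm w * (H * norm w)"
    using norm_cauchy_schwarz[of w "T w"] mult_left_mono[OF H norm_ge_zero, of w w] by linarith
  then have wTw: "w \<bullet> T w \<le> H * (w \<bullet> w)"
    by (simp add: mult_ac flip: power2_norm_eq_inner power2_eq_square)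
  have "0 \<le> (v - (1 / H) *\<^sub>R w) \<bullet> T (v - (1 / H) *\<^sub>R w)"
    by (rule T(3))
  also have "\<dots> = v \<bullet> w - 2 / H * (w \<bullet> w) + (w \<bullet> T w) / (H * H)"
    by (simp add: linear_diff[OF T(1)] linear_scale[OF T(1)] inner_simps ww flip: w_def)
      (use True in \<open>simp add: field_simps\<close>)
  also have "\<dots> \<le> v \<bullet> w - (w \<bullet> w) / H"
  proof -
    have "(w \<bullet> T w) / (H * H) \<le> (H * (w \<bullet> w)) / (H * H)"
      using wTw True by (intro divide_right_mono) auto
    also have "\<dots> = (w \<bullet> w) / H"
      using True by simp
    finally show ?thesis
      by simp
  qed
  finally have "w \<bullet> w \<le> H * (v \<bullet> w)"
    using True by (simp add: field_simps)
  then show ?thesis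
    by (simp add: power2_norm_eq_inner w_def)
next
  case False
  then have "H * norm v \<le> 0"
    by (simp add: mult_nonpos_nonneg)
  then have "T v = 0"
    using H[of v] by (metis norm_le_zero_iff order_trans)
  then show ?thesis by simp
qed

lemma self_adjoint_range_orthogonal:
  fixes T :: "'a::euclidean_space \<Rightarrow> 'a"
  assumes "\<And>u v. T u \<bullet> v = u \<bullet> T v" "T w = 0"
  shows "T u \<bullet> w = 0"
  using assms by simp

text \<open>
  An element of \<open>V\<close> represents, through \<open>T\<close>, a self-adjoint operator vanishing on \<open>U\<close>. The face
  projector at \<open>a\<close> is the compression to the kernel of \<open>T a\<close>.
\<close>

lemma peirce_cone_semidefinite:
  fixes T :: "'a::euclidean_space \<Rightarrow> 'a \<Rightarrow> 'a"
  assumes V: "subspace V"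
    and lin: "\<And>x. x \<in> V \<Longrightarrow> linear (T x)"
    and sa: "\<And>x u v. x \<in> V \<Longrightarrow> T x u \<bullet> v = u \<bullet> T x v"
    and vanish: "\<And>x w. x \<in> V \<Longrightarrow> w \<in> U \<Longrightarrow> T x w = 0"
    and isometry: "\<And>x y. x \<in> V \<Longrightarrow> y \<in> V \<Longrightarrow> x \<bullet> y = (\<Sum>e\<in>Basis. T x e \<bullet> T y e)"
    and surj: "\<And>S. linear S \<Longrightarrow> (\<And>u v. S u \<bullet> v = u \<bullet> S v) \<Longrightarrow> (\<And>w. w \<in> U \<Longrightarrow> S w = 0) \<Longrightarrow>
       \<exists>x\<in>V. T x = S"
  shows "peirce_cone V {x \<in> V. \<forall>v. 0 \<le> v \<bullet> T x v}" (is "peirce_cone V ?K")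
proof (rule peirce_coneI)
  have inner_basis: "x \<bullet> y = (\<Sum>b\<in>B. T x b \<bullet> T y b)"
    if "x \<in> V" "y \<in> V" "\<And>v. v = (\<Sum>b\<in>B. (v \<bullet> b) *\<^sub>R b)" for x y B
    unfolding isometry[OF that(1,2)] by (intro self_adjoint_trace_inner sa that)
  have eigen: "\<exists>B l. orthonormal B \<and> (\<forall>v. v = (\<Sum>b\<in>B. (v \<bullet> b) *\<^sub>R b)) \<and>
      (\<forall>b\<in>B. T x b = l b *\<^sub>R b)" if "x \<in> V" for x
    using self_adjoint_eigenbasis[OF lin[OF that] sa[OF that]] by metis
  show "0 \<le> s \<bullet> x" if "s \<in> ?K" and "x \<in> ?K" for s x
  proof -
    from that have s: "s \<in> V" "\<forall>v. 0 \<le> v \<bullet> T s v" and x: "x \<in> V" "\<forall>v. 0 \<le> v \<bullet> T x v"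
      by blast+
    obtain B l where B: "orthonormal B" "\<And>v. v = (\<Sum>b\<in>B. (v \<bullet> b) *\<^sub>R b)"
      and l: "\<And>b. b \<in> B \<Longrightarrow> T s b = l b *\<^sub>R b"
      using eigen[OF s(1)] by metis
    have "0 \<le> T s b \<bullet> T x b" if "b \<in> B" for b
    proof -
      have "0 \<le> l b"
        using s(2)[rule_format, of b] l[OF that] B(1) that by (simp add: orthonormal_def)
      then show ?thesis
        using x(2) by (simp add: l[OF that])
    qed
    then show ?thesis
      unfolding inner_basis[OF s(1) x(1) B(2)] by (rule sum_nonneg)
  qed
  show "s \<in> ?K" if s: "s \<in> V" and dual: "\<And>x. x \<in> ?K \<Longrightarrow> 0 \<le> s \<bullet> x" for s
  proof -
    obtain B l where B: "orthonormal B" "\<And>v. v = (\<Sum>b\<in>B. (v \<bullet> b) *\<^sub>R b)"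
      and l: "\<And>b. b \<in> B \<Longrightarrow> T s b = l b *\<^sub>R b"
      using eigen[OF s] by metis
    have fin: "finite B"
      using orthonormal_finite(1)[OF B(1)] .
    have l0: "0 \<le> l b" if b: "b \<in> B" for b
    proof (cases "l b = 0")
      case False
      \<comment> \<open>The test element is the rank-one operator of \<open>b\<close>. It is
        represented in \<open>V\<close> because it vanishes on \<open>U\<close>: an eigenvector with
        nonzero eigenvalue lies in the range of \<open>T s\<close>, hence is orthogonal to
        \<open>U\<close>.\<close>
      define S where "S v = (v \<bullet> b) *\<^sub>R b" for v
      have "linear S"
        unfolding S_def by (rule linearI) (simp_all add: inner_add_left scaleR_add_left)
      moreover have "S u \<bullet> v = u \<bullet> S v" for u v
        by (simp add: S_def inner_commute)
      moreover have "S w = 0" if "w \<in> U" for w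
      proof -
        have "T s b \<bullet> w = 0"
          using sa[OF s] vanish[OF s that] by (rule self_adjoint_range_orthogonal)
        then show ?thesis
          using False by (simp add: l[OF b] S_def inner_commute)
      qed
      ultimately obtain x where x: "x \<in> V" "T x = S"
        using surj by blast
      have "0 \<le> v \<bullet> T x v" for v
        by (simp add: x(2) S_def inner_commute)
      then have "0 \<le> s \<bullet> x"
        using dual x(1) by blast
      also have "s \<bullet> x = (\<Sum>c\<in>B. if c = b then l b else 0)"
        unfolding inner_basis[OF s x(1) B(2)] x(2) S_def using B(1) b
        by (intro sum.cong) (auto simp: orthonormal_def l)
      finally show ?thesis
        using fin b by simp
    qed simp
    have "0 \<le> v \<bullet> T s v" for v
    proof -
      have "v \<bullet> T s v = (\<Sum>b\<in>B. (v \<bullet> b) * (T s v \<bullet> b))"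
        by (rule orthonormal_inner_sum[OF B(2)])
      also have "\<dots> = (\<Sum>b\<in>B. l b * ((v \<bullet> b) * (v \<bullet> b)))"
        by (intro sum.cong refl) (simp add: sa[OF s] l)
      also have "\<dots> \<ge> 0"
        using l0 by (intro sum_nonneg) simp
      finally show ?thesis .
    qed
    then show ?thesis
      using s by blast
  qed
  fix a assume "a \<in> ?K"
  then have a: "a \<in> V" "\<And>v. 0 \<le> v \<bullet> T a v"
    by blast+
  obtain B l where B: "orthonormal B" "\<And>v. v = (\<Sum>b\<in>B. (v \<bullet> b) *\<^sub>R b)"
    and l: "\<And>b. b \<in> B \<Longrightarrow> T a b = l b *\<^sub>R b"
    using eigen[OF a(1)] by metis
  have fin: "finite B"
    using orthonormal_finite(1)[OF B(1)] .
  have l0: "0 \<le> l b" if "b \<in> B" for b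
    using a(2)[of b] l[OF that] B(1) that by (simp add: orthonormal_def)
  define N where "N = {b \<in> B. l b = 0}"
  have N: "N \<subseteq> B" "finite N" "finite (B - N)"
    using fin by (auto simp: N_def)
  define P where "P v = (\<Sum>b\<in>N. (v \<bullet> b) *\<^sub>R b)" for v
  have Plin: "linear P"
    unfolding P_def
    by (rule linearI) (simp_all add: inner_add_left scaleR_add_left sum.distrib scaleR_sum_right)
  have Psa: "P u \<bullet> v = u \<bullet> P v" for u v
    by (simp add: P_def inner_sum_left inner_sum_right inner_commute mult.commute)
  have Pb: "P b = (if b \<in> N then b else 0)" if "b \<in> B" for b
  proof -
    have "P b = (\<Sum>c\<in>N. if c = b then b else 0)"
      unfolding P_def using B(1) N(1) that by (intro sum.cong) (auto simp: orthonormal_def)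
    then show ?thesis
      using N(2) by simp
  qed
  \<comment> \<open>\<open>U\<close> lies in the kernel of \<open>T a\<close>, so \<open>P\<close>
    fixes it and the compression by \<open>P\<close> again vanishes on \<open>U\<close>; this makes
    the compression representable by an element of \<open>V\<close>.\<close>
  have PU: "P w = w" if w: "w \<in> U" for w
  proof -
    have "w \<bullet> b = 0" if "b \<in> B - N" for b
    proof -
      have "T a b \<bullet> w = 0"
        using sa[OF a(1)] vanish[OF a(1) w] by (rule self_adjoint_range_orthogonal)
      then show ?thesis
        using that by (simp add: l N_def inner_commute)
    qed
    then have "(\<Sum>b\<in>B. (w \<bullet> b) *\<^sub>R b) = P w"
      unfolding P_def using fin N(1) by (intro sum.mono_neutral_right) auto
    then show ?thesis
      using B(2)[of w] by simp
  qed
  have "\<exists>x\<in>V. T x = P \<circ> T t \<circ> P" if t: "t \<in> V" for t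
  proof (rule surj)
    show "linear (P \<circ> T t \<circ> P)"
      using Plin lin[OF t] by (intro linear_compose)
  qed (simp_all add: Psa sa[OF t] PU vanish[OF t] linear_0[OF Plin])
  then obtain p where p: "\<And>t. t \<in> V \<Longrightarrow> p t \<in> V" "\<And>t. t \<in> V \<Longrightarrow> T (p t) = P \<circ> T t \<circ> P"
    by metis
  have inner2: "x \<bullet> y = (\<Sum>b\<in>B. \<Sum>c\<in>B. (T x b \<bullet> c) * (T y b \<bullet> c))" if "x \<in> V" "y \<in> V" for x y
    unfolding inner_basis[OF that B(2)] by (intro sum.cong refl orthonormal_inner_sum[OF B(2)])
  have Tp: "T (p t) b \<bullet> c = (if b \<in> N \<and> c \<in> N then T t b \<bullet> c else 0)"
    if "t \<in> V" "b \<in> B" "c \<in> B" for t b c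
    using that by (simp add: p(2) Psa Pb linear_0[OF lin])
  have pinner: "p t \<bullet> r = (\<Sum>b\<in>N. \<Sum>c\<in>N. (T t b \<bullet> c) * (T r b \<bullet> c))"
    if "t \<in> V" "r \<in> V" for t r
  proof -
    have "p t \<bullet> r = (\<Sum>b\<in>B. \<Sum>c\<in>B. if b \<in> N \<and> c \<in> N then (T t b \<bullet> c) * (T r b \<bullet> c) else 0)"
      unfolding inner2[OF p(1)[OF that(1)] that(2)] using that
      by (intro sum.cong refl) (simp add: Tp)
    also have "\<dots> = (\<Sum>b\<in>N. \<Sum>c\<in>B. if b \<in> N \<and> c \<in> N then (T t b \<bullet> c) * (T r b \<bullet> c) else 0)"
      using fin N(1) by (intro sum.mono_neutral_right) auto
    also have "\<dots> = (\<Sum>b\<in>N. \<Sum>c\<in>N. (T t b \<bullet> c) * (T r b \<bullet> c))"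
      using fin N(1) by (intro sum.cong refl sum.mono_neutral_cong_right) auto
    finally show ?thesis .
  qed
  have psym: "p t \<bullet> r = t \<bullet> p r" if "t \<in> V" "r \<in> V" for t r
    using pinner[OF that] pinner[OF that(2,1)] by (simp add: inner_commute[of t] mult.commute)
  have pmem: "p t \<in> ?K" if "t \<in> ?K" for t
  proof -
    have "0 \<le> v \<bullet> T (p t) v" for v
      using that by (simp add: p(2) flip: Psa)
    then show ?thesis
      using that p(1) by blast
  qed
  have porth: "a \<bullet> p t = 0" if "t \<in> V" for t
  proof -
    have "a \<bullet> p t = p a \<bullet> t"
      using psym[OF a(1) that] by simp
    also have "\<dots> = 0"
      unfolding pinner[OF a(1) that]
      by (intro sum.neutral ballI) (use N(1) in \<open>auto simp: l N_def\<close>)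
    finally show ?thesis .
  qed
  \<comment> \<open>\<open>D\<close> dominates the reciprocal of each positive eigenvalue of
    \<open>T a\<close>; the factor 2 in \<open>C\<close> pays for the off-diagonal entries.\<close>
  define D where "D = (\<Sum>b\<in>B - N. 1 / l b)"
  define C where "C = 2 * D"
  have bound: "(norm (t - p t))\<^sup>2 \<le> C * (a \<bullet> t) * norm t" if "t \<in> ?K" for t
  proof -
    from that have t: "t \<in> V" "\<And>v. 0 \<le> v \<bullet> T t v"
      by blast+
    define g where "g b c = (T t b \<bullet> c)\<^sup>2" for b c
    have gsym: "g b c = g c b" for b c
      unfolding g_def by (metis sa[OF t(1)] inner_commute)
    have g0: "0 \<le> g b c" for b c
      by (simp add: g_def)
    have rows: "(\<Sum>c\<in>B. g b c) = (norm (T t b))\<^sup>2" for b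
      using orthonormal_inner_sum[OF B(2), of "T t b" "T t b"]
      by (simp add: power2_norm_eq_inner) (simp add: g_def power2_eq_square)
    have tt: "t \<bullet> t = (\<Sum>b\<in>B. \<Sum>c\<in>B. g b c)"
      unfolding inner2[OF t(1) t(1)] g_def by (simp add: power2_eq_square)
    have pt: "p t \<bullet> t = (\<Sum>b\<in>N. \<Sum>c\<in>N. g b c)"
      unfolding pinner[OF t(1) t(1)] g_def by (simp add: power2_eq_square)
    have pp: "p t \<bullet> p t = (\<Sum>b\<in>N. \<Sum>c\<in>N. g b c)"
      unfolding pinner[OF t(1) p(1)[OF t(1)]] g_def using N(1)
      by (intro sum.cong refl) (simp add: Tp[OF t(1)] subset_iff power2_eq_square)
    have H: "norm (T t v) \<le> norm t * norm v" for v
    proof -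
      have "(norm (T t v))\<^sup>2 = (\<Sum>b\<in>B. (T t v \<bullet> b) * (T t v \<bullet> b))"
        unfolding power2_norm_eq_inner by (rule orthonormal_inner_sum[OF B(2)])
      also have "\<dots> \<le> (\<Sum>b\<in>B. (norm v)\<^sup>2 * (norm (T t b))\<^sup>2)"
      proof (rule sum_mono)
        fix b
        have "\<bar>v \<bullet> T t b\<bar>\<^sup>2 \<le> (norm v * norm (T t b))\<^sup>2"
          by (intro power_mono Cauchy_Schwarz_ineq2) simp
        then show "(T t v \<bullet> b) * (T t v \<bullet> b) \<le> (norm v)\<^sup>2 * (norm (T t b))\<^sup>2"
          by (simp add: sa[OF t(1)] power_mult_distrib flip: power2_eq_square)
      qed
      also have "\<dots> = (norm t * norm v)\<^sup>2"
        unfolding power_mult_distrib power2_norm_eq_inner[of t] tt rows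
        by (simp add: sum_distrib_left mult.commute)
      finally show ?thesis
        by (rule power2_le_imp_le) simp
    qed
    \<comment> \<open>\<open>t - p t\<close> consists of the entries outside the block
      \<open>N\<close> times \<open>N\<close>. By symmetry those in the rows of \<open>N\<close> are
      bounded by the complete rows outside \<open>N\<close>.\<close>
    have split: "(\<Sum>b\<in>B. \<Sum>c\<in>B. g b c) =
        (\<Sum>b\<in>B - N. \<Sum>c\<in>B. g b c) + (\<Sum>b\<in>N. \<Sum>c\<in>B - N. g b c) + (\<Sum>b\<in>N. \<Sum>c\<in>N. g b c)"
      by (simp add: sum.subset_diff[OF N(1) fin] sum.distrib)
    have "(\<Sum>b\<in>N. \<Sum>c\<in>B - N. g b c) = (\<Sum>c\<in>B - N. \<Sum>b\<in>N. g c b)"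
      by (subst sum.swap) (simp add: gsym)
    also have "\<dots> \<le> (\<Sum>c\<in>B - N. \<Sum>b\<in>B. g c b)"
      using N(1) fin g0 by (intro sum_mono sum_mono2) auto
    finally have off: "(\<Sum>b\<in>N. \<Sum>c\<in>B - N. g b c) \<le> (\<Sum>b\<in>B - N. \<Sum>c\<in>B. g b c)" .
    have "(norm (t - p t))\<^sup>2 = t \<bullet> t - 2 * (p t \<bullet> t) + p t \<bullet> p t"
      by (simp add: power2_norm_eq_inner inner_simps inner_commute)
    also have "\<dots> \<le> 2 * (\<Sum>b\<in>B - N. \<Sum>c\<in>B. g b c)"
      unfolding tt pt pp using split off by linarith
    also have "\<dots> \<le> 2 * (\<Sum>b\<in>B - N. norm t * (D * (l b * (b \<bullet> T t b))))"
    proof (intro mult_left_mono sum_mono)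
      fix b assume b: "b \<in> B - N"
      have lb: "l b > 0"
        using b l0[of b] by (auto simp: N_def less_le)
      \<comment> \<open>A row sum is a squared norm, hence at most \<open>norm t\<close> times the
        diagonal entry. This replaces squares by quantities linear in \<open>t\<close>, which the
        pairing with \<open>a\<close> can control.\<close>
      have "(\<Sum>c\<in>B. g b c) \<le> norm t * (b \<bullet> T t b)"
        unfolding rows by (rule positive_semidefinite_norm_bound[OF lin[OF t(1)] sa[OF t(1)] t(2) H])
      moreover have "1 / l b \<le> D"
        unfolding D_def using b N(3) l0 by (intro member_le_sum) auto
      then have "1 \<le> D * l b"
        using lb by (simp add: field_simps)
      then have "1 * (b \<bullet> T t b) \<le> (D * l b) * (b \<bullet> T t b)"
        using t(2) by (rule mult_right_mono)
      then have "norm t * (b \<bullet> T t b) \<le> norm t * (D * (l b * (b \<bullet> T t b)))"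
        by (intro mult_left_mono) (simp_all add: mult.assoc)
      ultimately show "(\<Sum>c\<in>B. g b c) \<le> norm t * (D * (l b * (b \<bullet> T t b)))"
        by linarith
    qed simp
    also have "\<dots> = C * (\<Sum>b\<in>B - N. l b * (b \<bullet> T t b)) * norm t"
      by (simp add: C_def sum_distrib_left sum_distrib_right mult_ac)
    also have "(\<Sum>b\<in>B - N. l b * (b \<bullet> T t b)) = (\<Sum>b\<in>B. l b * (b \<bullet> T t b))"
      using fin by (intro sum.mono_neutral_left) (auto simp: N_def)
    also have "\<dots> = a \<bullet> t"
      unfolding inner_basis[OF a(1) t(1) B(2)] by (intro sum.cong refl) (simp add: l)
    finally show ?thesis .
  qed
  have "face_projector V ?K a p C"
    unfolding face_projector_def
  proof (intro conjI ballI)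
    show "p t \<in> ?K" "(norm (t - p t))\<^sup>2 \<le> C * (a \<bullet> t) * norm t" if "t \<in> ?K" for t
      using that by (rule pmem, rule bound)
    show "a \<bullet> p t = 0" if "t \<in> ?K" for t
      using that porth by simp
  qed (use p(1) psym in auto)
  then show "\<exists>p C. face_projector V ?K a p C" by blast
qed auto

section \<open>Orthogonal sums and products of cones\<close>

lemma peirce_cone_orthogonal_sum:
  fixes \<pi> :: "nat \<Rightarrow> 'a::euclidean_space \<Rightarrow> 'a"
  assumes lin: "\<And>k. k < n \<Longrightarrow> linear (\<pi> k)"
    and inner: "\<And>x y. x \<bullet> y = (\<Sum>k<n. \<pi> k x \<bullet> \<pi> k y)"
    and range: "\<And>k x. k < n \<Longrightarrow> \<pi> k x \<in> V k"
    and embed: "\<And>z j. (\<And>k. k < n \<Longrightarrow> z k \<in> V k) \<Longrightarrow> j < n \<Longrightarrow> \<pi> j (\<Sum>k<n. z k) = z j"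
    and cone: "\<And>k. k < n \<Longrightarrow> peirce_cone (V k) (C k)"
  shows "peirce_cone UNIV {x. \<forall>k<n. \<pi> k x \<in> C k}" (is "peirce_cone UNIV ?K")
proof (rule peirce_coneI)
  have dual: "s \<in> C k \<longleftrightarrow> (\<forall>x\<in>C k. 0 \<le> s \<bullet> x)" if "k < n" "s \<in> V k" for k s
    using cone[OF that(1)] that(2) by (simp add: peirce_cone_def)
  have sub: "C k \<subseteq> V k" if "k < n" for k
    using cone[OF that] by (simp add: peirce_cone_def)
  have zeroV: "0 \<in> V k" if "k < n" for k
    using range[OF that, of 0] linear_0[OF lin[OF that]] by simp
  have zero: "0 \<in> C k" if "k < n" for k
    using dual[OF that zeroV[OF that]] by simp
  have nonneg: "0 \<le> \<pi> k s \<bullet> \<pi> k x" if "s \<in> ?K" "x \<in> ?K" "k < n" for s x k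
    using that dual[OF that(3) range[OF that(3)], of s] by auto
  show "0 \<le> s \<bullet> x" if "s \<in> ?K" "x \<in> ?K" for s x
    unfolding inner[of s x] using nonneg[OF that] by (intro sum_nonneg) auto
  show "s \<in> ?K" if s: "\<And>x. x \<in> ?K \<Longrightarrow> 0 \<le> s \<bullet> x" for s
  proof (intro CollectI allI impI)
    fix k assume k: "k < n"
    have "0 \<le> \<pi> k s \<bullet> y" if y: "y \<in> C k" for y
    proof -
      \<comment> \<open>Self-duality of one factor is tested on vectors supported in that factor
        alone.\<close>
      define z where "z j = (if j = k then y else 0)" for j
      have "z j \<in> V j" if "j < n" for j
        using that y sub[OF k] zeroV by (auto simp: z_def)
      then have zj: "\<pi> j (\<Sum>i<n. z i) = z j" if "j < n" for j
        using embed that by blast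
      then have "(\<Sum>i<n. z i) \<in> ?K"
        using y zero by (simp add: z_def)
      then have "0 \<le> s \<bullet> (\<Sum>i<n. z i)"
        by (rule s)
      also have "\<dots> = (\<Sum>j<n. if j = k then \<pi> k s \<bullet> y else 0)"
        unfolding inner[of s] by (intro sum.cong refl) (simp add: zj, simp add: z_def)
      finally show ?thesis
        using k by simp
    qed
    then show "\<pi> k s \<in> C k"
      using dual[OF k range[OF k]] by blast
  qed
  fix x assume x: "x \<in> ?K"
  have "\<forall>k. \<exists>p D. k < n \<longrightarrow> face_projector (V k) (C k) (\<pi> k x) p D"
    using cone x unfolding peirce_cone_def by blast
  then obtain p D where p: "\<And>k. k < n \<Longrightarrow> face_projector (V k) (C k) (\<pi> k x) (p k) (D k)"
    by metis
  define q where "q t = (\<Sum>k<n. p k (\<pi> k t))" for t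
  have q: "\<pi> k (q t) = p k (\<pi> k t)" if "k < n" for k t
    unfolding q_def using embed[OF _ that, of "\<lambda>k. p k (\<pi> k t)"] p range
    by (simp add: face_projector_def)
  define M where "M = (\<Sum>k<n. \<bar>D k\<bar>)"
  have "q t \<bullet> r = t \<bullet> q r" for t r
    unfolding inner[of "q t"] inner[of t] using p range
    by (intro sum.cong refl) (auto simp: q face_projector_def)
  moreover have "q t \<in> ?K" if "t \<in> ?K" for t
    using that p by (simp add: q face_projector_def)
  moreover have "x \<bullet> q t = 0" if "t \<in> ?K" for t
    unfolding inner[of x] using that p
    by (intro sum.neutral) (auto simp: q face_projector_def)
  moreover have "(norm (t - q t))\<^sup>2 \<le> M * (x \<bullet> t) * norm t" if t: "t \<in> ?K" for t
  proof -
    have "(norm (t - q t))\<^sup>2 = (\<Sum>k<n. (norm (\<pi> k t - p k (\<pi> k t)))\<^sup>2)"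
      unfolding power2_norm_eq_inner inner[of "t - q t"]
      by (intro sum.cong refl) (simp add: linear_diff[OF lin] q)
    also have "\<dots> \<le> (\<Sum>k<n. M * (\<pi> k x \<bullet> \<pi> k t) * norm t)"
    proof (rule sum_mono)
      fix k assume "k \<in> {..<n}"
      then have k: "k < n" by simp
      have "(norm (\<pi> k t - p k (\<pi> k t)))\<^sup>2 \<le> D k * (\<pi> k x \<bullet> \<pi> k t) * norm (\<pi> k t)"
        using p[OF k] t k by (simp add: face_projector_def)
      also have "\<dots> \<le> M * (\<pi> k x \<bullet> \<pi> k t) * norm t"
      proof (rule mult_mono)
        have "D k \<le> \<bar>D k\<bar>" by simp
        also have "\<dots> \<le> M"
          unfolding M_def using k by (intro member_le_sum) auto
        finally show "D k * (\<pi> k x \<bullet> \<pi> k t) \<le> M * (\<pi> k x \<bullet> \<pi> k t)"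
          using nonneg[OF x t k] by (rule mult_right_mono)
        have "\<pi> k t \<bullet> \<pi> k t \<le> (\<Sum>k<n. \<pi> k t \<bullet> \<pi> k t)"
          using k by (intro member_le_sum[of k]) auto
        then show "norm (\<pi> k t) \<le> norm t"
          by (simp add: norm_le inner[of t t])
        show "0 \<le> M * (\<pi> k x \<bullet> \<pi> k t)"
          using nonneg[OF x t k] by (simp add: M_def sum_nonneg)
      qed simp
      finally show "(norm (\<pi> k t - p k (\<pi> k t)))\<^sup>2 \<le> M * (\<pi> k x \<bullet> \<pi> k t) * norm t" .
    qed
    also have "\<dots> = M * (x \<bullet> t) * norm t"
      by (simp add: inner[of x] sum_distrib_left sum_distrib_right)
    finally show ?thesis .
  qed
  ultimately have "face_projector UNIV ?K x q M"
    unfolding face_projector_def by blast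
  then show "\<exists>p C. face_projector UNIV ?K x p C" by blast
qed auto

text \<open>Projectors act componentwise, with \<open>\<bar>C\<bar> + \<bar>D\<bar>\<close> as
  constant. This supplies the cone of the lifted problem.\<close>

lemma peirce_cone_Times:
  fixes K :: "'a::euclidean_space set" and L :: "'b::euclidean_space set"
  assumes K: "peirce_cone UNIV K" and L: "peirce_cone UNIV L"
  shows "peirce_cone UNIV (K \<times> L)"
proof (rule peirce_coneI)
  have dK: "s \<in> K \<longleftrightarrow> (\<forall>x\<in>K. 0 \<le> s \<bullet> x)" for s
    using K unfolding peirce_cone_def by blast
  have dL: "s \<in> L \<longleftrightarrow> (\<forall>x\<in>L. 0 \<le> s \<bullet> x)" for s
    using L unfolding peirce_cone_def by blast
  have zero: "0 \<in> K" "0 \<in> L"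
    using dK[of 0] dL[of 0] by simp_all
  have nn: "0 \<le> s \<bullet> x" if "s \<in> K" "x \<in> K" for s x
    using dK that by blast
  have nnL: "0 \<le> s \<bullet> x" if "s \<in> L" "x \<in> L" for s x
    using dL that by blast
  show "0 \<le> s \<bullet> x" if "s \<in> K \<times> L" "x \<in> K \<times> L" for s x
    using that nn nnL by (auto simp: inner_prod_def)
  show "s \<in> K \<times> L" if s: "\<And>x. x \<in> K \<times> L \<Longrightarrow> 0 \<le> s \<bullet> x" for s
  proof -
    have "0 \<le> fst s \<bullet> x" if "x \<in> K" for x
      using s[of "(x, 0)"] that zero by (simp add: inner_prod_def)
    moreover have "0 \<le> snd s \<bullet> y" if "y \<in> L" for y
      using s[of "(0, y)"] that zero by (simp add: inner_prod_def)
    ultimately show ?thesis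
      using dK[of "fst s"] dL[of "snd s"] by (simp add: mem_Times_iff)
  qed
  fix z assume "z \<in> K \<times> L"
  then obtain x y where z: "z = (x, y)" and x: "x \<in> K" and y: "y \<in> L"
    by blast
  obtain p C where p: "face_projector UNIV K x p C"
    using K x unfolding peirce_cone_def by blast
  obtain q D where q: "face_projector UNIV L y q D"
    using L y unfolding peirce_cone_def by blast
  define r where "r t = (p (fst t), q (snd t))" for t
  define M where "M = \<bar>C\<bar> + \<bar>D\<bar>"
  have "r s \<bullet> t = s \<bullet> r t" for s t
    using p q by (simp add: r_def inner_prod_def face_projector_def)
  moreover have "r t \<in> K \<times> L" "z \<bullet> r t = 0" if "t \<in> K \<times> L" for t
    using that p q by (auto simp: r_def z inner_prod_def face_projector_def)
  moreover have "(norm (t - r t))\<^sup>2 \<le> M * (z \<bullet> t) * norm t" if t: "t \<in> K \<times> L" for t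
  proof -
    obtain u v where uv: "t = (u, v)" "u \<in> K" "v \<in> L"
      using t by blast
    have n: "norm u \<le> norm t" "norm v \<le> norm t"
      using norm_fst_le[of u v] norm_snd_le[of v u] uv(1) by simp_all
    have 1: "(norm (u - p u))\<^sup>2 \<le> M * (x \<bullet> u) * norm t"
    proof -
      have "(norm (u - p u))\<^sup>2 \<le> C * (x \<bullet> u) * norm u"
        using p uv(2) by (simp add: face_projector_def)
      also have "\<dots> \<le> M * (x \<bullet> u) * norm t"
        using nn[OF x uv(2)] n by (intro mult_mono mult_right_mono) (auto simp: M_def)
      finally show ?thesis .
    qed
    have 2: "(norm (v - q v))\<^sup>2 \<le> M * (y \<bullet> v) * norm t"
    proof -
      have "(norm (v - q v))\<^sup>2 \<le> D * (y \<bullet> v) * norm v"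
        using q uv(3) by (simp add: face_projector_def)
      also have "\<dots> \<le> M * (y \<bullet> v) * norm t"
        using nnL[OF y uv(3)] n by (intro mult_mono mult_right_mono) (auto simp: M_def)
      finally show ?thesis .
    qed
    have "(norm (t - r t))\<^sup>2 = (norm (u - p u))\<^sup>2 + (norm (v - q v))\<^sup>2"
      by (simp add: uv(1) r_def norm_Pair)
    then show ?thesis
      using 1 2 by (simp add: uv(1) z inner_prod_def distrib_left distrib_right)
  qed
  ultimately have "face_projector UNIV (K \<times> L) z r M"
    unfolding face_projector_def by blast
  then show "\<exists>p C. face_projector UNIV (K \<times> L) z p C" by blast
qed auto

lemma peirce_cone_rotated_lorentz:
  "peirce_cone UNIV (rotated_lorentz_cone :: (real \<times> real \<times> 'w::euclidean_space) set)"
proof -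
  \<comment> \<open>The bisector of the first two axes. For it,
    \<open>z \<bullet> z \<le> 2 * (z \<bullet> e)\<^sup>2\<close> reads \<open>u\<^sup>2 +
    v\<^sup>2 + (norm w)\<^sup>2 \<le> (u + v)\<^sup>2\<close>, the inequality of the rotated
    cone.\<close>
  define e :: "real \<times> real \<times> 'w" where "e = (1 / sqrt 2, 1 / sqrt 2, 0)"
  have e: "norm e = 1"
    by (simp add: e_def norm_Pair power_divide)
  have ze: "(u, v, w) \<bullet> e = (u + v) / sqrt 2" for u v w
    by (simp add: e_def inner_prod_def add_divide_distrib)
  have "(u, v, w) \<in> rotated_lorentz_cone \<longleftrightarrow>
      0 \<le> (u, v, w) \<bullet> e \<and> (u, v, w) \<bullet> (u, v, w) \<le> 2 * ((u, v, w) \<bullet> e)\<^sup>2" for u v and w :: 'w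
  proof -
    have 1: "(u, v, w) \<bullet> (u, v, w) = u * u + v * v + (norm w)\<^sup>2"
      by (simp add: inner_prod_def power2_norm_eq_inner)
    have 2: "2 * ((u, v, w) \<bullet> e)\<^sup>2 = (u + v) * (u + v)"
      by (simp add: ze power_divide power2_eq_square)
    have 3: "0 \<le> u \<and> 0 \<le> v" if "0 \<le> u + v" "0 \<le> u * v"
      using that by (auto simp: zero_le_mult_iff)
    show ?thesis
    proof
      assume "(u, v, w) \<in> rotated_lorentz_cone"
      then show "0 \<le> (u, v, w) \<bullet> e \<and> (u, v, w) \<bullet> (u, v, w) \<le> 2 * ((u, v, w) \<bullet> e)\<^sup>2"
        unfolding 1 2 unfolding ze rotated_lorentz_cone_def by (auto simp: algebra_simps)
    next
      assume "0 \<le> (u, v, w) \<bullet> e \<and> (u, v, w) \<bullet> (u, v, w) \<le> 2 * ((u, v, w) \<bullet> e)\<^sup>2"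
      then have "0 \<le> u + v" and le: "(norm w)\<^sup>2 \<le> 2 * (u * v)"
        unfolding 1 2 unfolding ze by (auto simp: zero_le_divide_iff algebra_simps)
      moreover have "0 \<le> u * v"
        using le zero_le_power2[of "norm w"] by linarith
      ultimately show "(u, v, w) \<in> rotated_lorentz_cone"
        using 3 by (simp add: rotated_lorentz_cone_def mult.assoc)
    qed
  qed
  then have "rotated_lorentz_cone = {z \<in> UNIV. 0 \<le> z \<bullet> e \<and> z \<bullet> z \<le> 2 * (z \<bullet> e)\<^sup>2}"
    by (auto simp del: inner_Pair)
  then show ?thesis
    using peirce_cone_Lorentz[OF subspace_UNIV UNIV_I e] by simp
qed

section \<open>The factors in coordinates\<close>

lemma orthonormal_family_inner:
  fixes d :: "nat \<Rightarrow> 'a::real_inner"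
  assumes "\<And>i j. i < n \<Longrightarrow> j < n \<Longrightarrow> d i \<bullet> d j = (if i = j then 1 else 0)" "j < n"
  shows "(\<Sum>i<n. g i *\<^sub>R d i) \<bullet> d j = g j"
proof -
  have "(\<Sum>i<n. g i *\<^sub>R d i) \<bullet> d j = (\<Sum>i<n. if i = j then g i else 0)"
    unfolding inner_sum_left using assms by (intro sum.cong) auto
  then show ?thesis
    using assms(2) by simp
qed

locale block_coordinates =
  fixes V :: "'e::euclidean_space set" and f :: "'e \<Rightarrow> nat \<Rightarrow> nat \<Rightarrow> real" and blk :: cone_block
  assumes V: "subspace V"
    and linear_coord: "\<And>i j. linear (\<lambda>x. f x i j)"
    and inner: "\<And>x y. x \<in> V \<Longrightarrow> y \<in> V \<Longrightarrow> x \<bullet> y = block_inner blk (f x) (f y)"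
    and range: "f ` V = block_space blk"
begin

lemma ex_vector: "a \<in> block_space blk \<Longrightarrow> \<exists>x\<in>V. f x = a"
  using range by (metis imageE)

lemma column_inner:
  assumes "block_index blk = {..<m} \<times> {0}" "x \<in> V" "y \<in> V"
  shows "x \<bullet> y = (\<Sum>i<m. f x i 0 * f y i 0)"
  unfolding inner[OF assms(2,3)] block_inner_def assms(1)
  by (simp flip: sum.cartesian_product)

lemma peirce_cone_Nonneg_Block:
  assumes blk: "blk = Nonneg_Block n"
  shows "peirce_cone V {x \<in> V. f x \<in> block_cone blk}"
proof -
  have inn: "x \<bullet> y = (\<Sum>i<n. f x i 0 * f y i 0)" if "x \<in> V" "y \<in> V" for x y
    by (rule column_inner[OF _ that]) (simp add: blk)
  have "\<exists>x\<in>V. f x = (\<lambda>i' j. if i' = i \<and> j = 0 then 1 else 0)" if "i < n" for i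
    by (rule ex_vector) (use that in \<open>auto simp: blk supported_on_def\<close>)
  then obtain d where d: "\<And>i. i < n \<Longrightarrow> d i \<in> V"
    "\<And>i. i < n \<Longrightarrow> f (d i) = (\<lambda>i' j. if i' = i \<and> j = 0 then 1 else 0)"
    by metis
  have coord: "x \<bullet> d i = f x i 0" if "x \<in> V" "i < n" for x i
    using that by (simp add: inn[OF that(1) d(1)] d(2) if_distrib cong: if_cong)
  have orth: "d i \<bullet> d j = (if i = j then 1 else 0)" if "i < n" "j < n" for i j
    using that by (auto simp: coord d)
  have "v = (\<Sum>i<n. (v \<bullet> d i) *\<^sub>R d i)" if v: "v \<in> V" for v
  proof -
    let ?u = "v - (\<Sum>i<n. (v \<bullet> d i) *\<^sub>R d i)"
    have u: "?u \<in> V"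
      using V v d(1) by (intro subspace_diff subspace_sum subspace_scale) auto
    have "?u \<bullet> d i = 0" if "i < n" for i
      using orthonormal_family_inner[OF orth that] by (simp add: inner_diff_left)
    then have "?u \<bullet> ?u = 0"
      unfolding inn[OF u u] using coord[OF u] by simp
    then show ?thesis by simp
  qed
  then have "peirce_cone V {x \<in> V. \<forall>i<n. 0 \<le> x \<bullet> d i}"
    by (intro peirce_cone_orthant V d(1) orth) auto
  moreover have "{x \<in> V. \<forall>i<n. 0 \<le> x \<bullet> d i} = {x \<in> V. f x \<in> block_cone blk}"
    using range by (auto simp: coord blk)
  ultimately show ?thesis by simp
qed

lemma peirce_cone_Lorentz_Block:
  assumes blk: "blk = Lorentz_Block n"
  shows "peirce_cone V {x \<in> V. f x \<in> block_cone blk}"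
proof -
  have inn: "x \<bullet> y = (\<Sum>i<n. f x i 0 * f y i 0) + f x n 0 * f y n 0" if "x \<in> V" "y \<in> V" for x y
    using column_inner[of "n + 1", OF _ that] by (simp add: blk)
  have "\<exists>x\<in>V. f x = (\<lambda>i j. if i = n \<and> j = 0 then 1 else 0)"
    by (rule ex_vector) (auto simp: blk supported_on_def)
  then obtain e where e: "e \<in> V" "f e = (\<lambda>i j. if i = n \<and> j = 0 then 1 else 0)"
    by blast
  have xe: "x \<bullet> e = f x n 0" if "x \<in> V" for x
    by (simp add: inn[OF that e(1)] e(2))
  have "norm e = 1"
    by (simp add: norm_eq_1 xe[OF e(1)] e(2))
  from peirce_cone_Lorentz[OF V e(1) this]
  have "peirce_cone V {x \<in> V. 0 \<le> x \<bullet> e \<and> x \<bullet> x \<le> 2 * (x \<bullet> e)\<^sup>2}" .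
  moreover have "0 \<le> x \<bullet> e \<and> x \<bullet> x \<le> 2 * (x \<bullet> e)\<^sup>2 \<longleftrightarrow> f x \<in> block_cone blk" if "x \<in> V" for x
  proof -
    have "f x \<in> block_space blk"
      using that range by blast
    moreover have "sqrt w \<le> a \<longleftrightarrow> 0 \<le> a \<and> w \<le> a\<^sup>2" if "0 \<le> w" for w a :: real
    proof
      assume le: "sqrt w \<le> a"
      have "0 \<le> sqrt w"
        using that by simp
      then show "0 \<le> a \<and> w \<le> a\<^sup>2"
        using sqrt_le_D[OF le] le by linarith
    qed (simp add: real_le_lsqrt)
    then have "sqrt (\<Sum>i<n. (f x i 0)\<^sup>2) \<le> f x n 0 \<longleftrightarrow>
        0 \<le> f x n 0 \<and> (\<Sum>i<n. (f x i 0)\<^sup>2) \<le> (f x n 0)\<^sup>2"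
      by (simp add: sum_nonneg)
    ultimately show ?thesis
      by (simp add: xe inn that blk power2_eq_square)
  qed
  then have "{x \<in> V. 0 \<le> x \<bullet> e \<and> x \<bullet> x \<le> 2 * (x \<bullet> e)\<^sup>2} = {x \<in> V. f x \<in> block_cone blk}"
    by blast
  ultimately show ?thesis by simp
qed

lemma peirce_cone_Rotated_Block:
  assumes blk: "blk = Rotated_Block n"
  shows "peirce_cone V {x \<in> V. f x \<in> block_cone blk}"
proof -
  have inn: "x \<bullet> y = f x 0 0 * f y 0 0 + f x 1 0 * f y 1 0 + (\<Sum>i<n. f x (i + 2) 0 * f y (i + 2) 0)"
    if "x \<in> V" "y \<in> V" for x y
    using column_inner[of "n + 2", OF _ that]
    by (simp add: blk sum.lessThan_Suc_shift del: sum.lessThan_Suc)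
  have "\<exists>x\<in>V. f x = (\<lambda>i j. if i < 2 \<and> j = 0 then 1 / sqrt 2 else 0)"
    by (rule ex_vector) (auto simp: blk supported_on_def)
  then obtain e where e: "e \<in> V" "f e = (\<lambda>i j. if i < 2 \<and> j = 0 then 1 / sqrt 2 else 0)"
    by blast
  have xe: "x \<bullet> e = (f x 0 0 + f x 1 0) / sqrt 2" if "x \<in> V" for x
    by (simp add: inn[OF that e(1)] e(2) add_divide_distrib)
  have "norm e = 1"
    by (simp add: norm_eq_1 xe[OF e(1)] e(2))
  from peirce_cone_Lorentz[OF V e(1) this]
  have "peirce_cone V {x \<in> V. 0 \<le> x \<bullet> e \<and> x \<bullet> x \<le> 2 * (x \<bullet> e)\<^sup>2}" .
  moreover have "0 \<le> x \<bullet> e \<and> x \<bullet> x \<le> 2 * (x \<bullet> e)\<^sup>2 \<longleftrightarrow> f x \<in> block_cone blk" if x: "x \<in> V" for x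
  proof -
    let ?u = "f x 0 0" and ?v = "f x 1 0" and ?w = "\<Sum>i<n. (f x (i + 2) 0)\<^sup>2"
    have "f x \<in> block_space blk"
      using that range by blast
    then have mem: "f x \<in> block_cone blk \<longleftrightarrow> 0 \<le> ?u \<and> 0 \<le> ?v \<and> ?w \<le> 2 * ?u * ?v"
      by (simp add: blk)
    have 1: "x \<bullet> x = ?u * ?u + ?v * ?v + ?w"
      by (simp add: inn[OF x x] power2_eq_square)
    have 2: "2 * (x \<bullet> e)\<^sup>2 = (?u + ?v) * (?u + ?v)"
      by (simp add: xe[OF x] power_divide power2_eq_square)
    have 3: "0 \<le> x \<bullet> e \<longleftrightarrow> 0 \<le> ?u + ?v"
      by (simp add: xe[OF x] zero_le_divide_iff)
    have w: "0 \<le> ?w"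
      by (simp add: sum_nonneg)
    have 4: "0 \<le> ?u \<and> 0 \<le> ?v" if "0 \<le> ?u + ?v" "?w \<le> 2 * ?u * ?v"
    proof -
      have "0 \<le> ?u * ?v"
        using that(2) w by simp
      then show ?thesis
        using that(1) by (auto simp: zero_le_mult_iff)
    qed
    have 5: "x \<bullet> x \<le> 2 * (x \<bullet> e)\<^sup>2 \<longleftrightarrow> ?w \<le> 2 * ?u * ?v"
      unfolding 1 2 by (simp add: algebra_simps)
    show ?thesis
      unfolding 3 5 mem using 4 by (meson add_nonneg_nonneg)
  qed
  then have "{x \<in> V. 0 \<le> x \<bullet> e \<and> x \<bullet> x \<le> 2 * (x \<bullet> e)\<^sup>2} = {x \<in> V. f x \<in> block_cone blk}"
    by blast
  ultimately show ?thesis by simp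
qed

text \<open>The diagonal matrix units \<open>d i\<close> are \<open>n\<close> orthonormal vectors of
  the block itself, so their span is a copy of the \<open>n\<close>-dimensional coordinate space
  inside the ambient space. A symmetric matrix acts on it as the operator \<open>T x\<close>, and
  \<open>U\<close> is the orthogonal complement on which that operator vanishes.\<close>

lemma peirce_cone_PSD_Block:
  assumes blk: "blk = PSD_Block n"
  shows "peirce_cone V {x \<in> V. f x \<in> block_cone blk}"
proof -
  have inn: "x \<bullet> y = (\<Sum>i<n. \<Sum>j<n. f x i j * f y i j)" if "x \<in> V" "y \<in> V" for x y
    unfolding inner[OF that] block_inner_def by (simp add: blk flip: sum.cartesian_product)
  have sym: "f x i j = f x j i" if "x \<in> V" for x i j
    using that range by (auto simp: blk)
  have "\<exists>x\<in>V. f x = (\<lambda>i' j. if i' = i \<and> j = i then 1 else 0)" if "i < n" for i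
    by (rule ex_vector) (use that in \<open>auto simp: blk supported_on_def\<close>)
  then obtain d where d: "\<And>i. i < n \<Longrightarrow> d i \<in> V"
    "\<And>i. i < n \<Longrightarrow> f (d i) = (\<lambda>i' j. if i' = i \<and> j = i then 1 else 0)"
    by metis
  have orth: "d i \<bullet> d j = (if i = j then 1 else 0)" if "i < n" "j < n" for i j
  proof -
    have "d i \<bullet> d j = (\<Sum>k<n. \<Sum>l<n. if k = i then if l = i then if i = j then 1 else 0 else 0 else 0)"
      unfolding inn[OF d(1)[OF that(1)] d(1)[OF that(2)]]
      by (intro sum.cong refl) (auto simp: d(2) that)
    also have "\<dots> = (\<Sum>k<n. if k = i then \<Sum>l<n. if l = i then if i = j then 1 else 0 else 0 else 0)"
      by (intro sum.cong refl) auto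
    finally show ?thesis
      using that by simp
  qed
  define row where "row x i = (\<Sum>j<n. f x i j *\<^sub>R d j)" for x i
  define T where "T x v = (\<Sum>i<n. (row x i \<bullet> v) *\<^sub>R d i)" for x v
  have rowv: "row x i \<bullet> v = (\<Sum>j<n. f x i j * (d j \<bullet> v))" for x i v
    by (simp add: row_def inner_sum_left)
  have form: "u \<bullet> T x v = (\<Sum>i<n. \<Sum>j<n. (d i \<bullet> u) * f x i j * (d j \<bullet> v))" for x u v
    by (simp add: T_def inner_sum_right rowv sum_distrib_right sum_distrib_left inner_commute[of u] mult_ac)
  define U where "U = {w. \<forall>i<n. d i \<bullet> w = 0}"
  have "peirce_cone V {x \<in> V. \<forall>v. 0 \<le> v \<bullet> T x v}"
  proof (rule peirce_cone_semidefinite[OF V])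
    show "linear (T x)" for x
      unfolding T_def
      by (rule linearI) (simp_all add: inner_add_right scaleR_add_left sum.distrib scaleR_sum_right)
    show "T x u \<bullet> v = u \<bullet> T x v" if "x \<in> V" for x u v
      unfolding inner_commute[of "T x u"] form
      by (subst sum.swap) (intro sum.cong refl, simp add: sym[OF that] mult_ac)
    show "T x w = 0" if "w \<in> U" for x w
      using that by (simp add: T_def rowv U_def)
    show "x \<bullet> y = (\<Sum>e\<in>Basis. T x e \<bullet> T y e)" if xy: "x \<in> V" "y \<in> V" for x y
    proof -
      have Td: "T x e \<bullet> d i = row x i \<bullet> e" if "i < n" for x e i
        unfolding T_def by (rule orthonormal_family_inner[OF orth that])
      have "(\<Sum>e\<in>Basis. T x e \<bullet> T y e) = (\<Sum>e\<in>Basis. \<Sum>i<n. (row x i \<bullet> e) * (row y i \<bullet> e))"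
        unfolding T_def[of y] inner_sum_right by (intro sum.cong refl) (simp add: Td)
      also have "\<dots> = (\<Sum>i<n. row x i \<bullet> row y i)"
        by (subst sum.swap) (simp flip: euclidean_inner)
      also have "\<dots> = (\<Sum>i<n. \<Sum>j<n. f x i j * f y i j)"
      proof (intro sum.cong refl)
        fix i
        have "d j \<bullet> row y i = f y i j" if "j < n" for j
          unfolding row_def using orthonormal_family_inner[OF orth that] by (simp add: inner_commute)
        then show "row x i \<bullet> row y i = (\<Sum>j<n. f x i j * f y i j)"
          by (simp add: rowv)
      qed
      finally show ?thesis
        using inn[OF xy] by simp
    qed
    fix S :: "'e \<Rightarrow> 'e"
    assume S: "linear S" "\<And>u v. S u \<bullet> v = u \<bullet> S v" "\<And>w. w \<in> U \<Longrightarrow> S w = 0"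
    have "\<exists>x\<in>V. f x = (\<lambda>i j. if i < n \<and> j < n then d i \<bullet> S (d j) else 0)"
    proof (rule ex_vector)
      have "d i \<bullet> S (d j) = d j \<bullet> S (d i)" for i j
        by (metis S(2) inner_commute)
      then show "(\<lambda>i j. if i < n \<and> j < n then d i \<bullet> S (d j) else 0) \<in> block_space blk"
        by (auto simp: blk supported_on_def)
    qed
    then obtain x where x: "x \<in> V" "f x = (\<lambda>i j. if i < n \<and> j < n then d i \<bullet> S (d j) else 0)"
      by blast
    \<comment> \<open>The part of \<open>v\<close> orthogonal to all \<open>d i\<close> is killed by
      \<open>S\<close>, so \<open>S\<close> is determined by the entries
      \<open>d i \<bullet> S (d j)\<close>.\<close>
    have proj: "S v = (\<Sum>i<n. (v \<bullet> d i) *\<^sub>R S (d i))" for v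
    proof -
      have "v - (\<Sum>i<n. (v \<bullet> d i) *\<^sub>R d i) \<in> U"
        unfolding U_def using orthonormal_family_inner[OF orth]
        by (auto simp: inner_commute[of "d _"] inner_diff_left)
      from S(3)[OF this] show ?thesis
        by (simp add: linear_diff[OF S(1)] linear_sum[OF S(1)] linear_scale[OF S(1)])
    qed
    have "u \<bullet> T x v = u \<bullet> S v" for u v
    proof -
      have "u \<bullet> S v = S u \<bullet> v"
        by (simp add: S(2))
      also have "\<dots> = (\<Sum>i<n. (u \<bullet> d i) * (d i \<bullet> S v))"
        by (subst proj) (simp add: inner_sum_left S(2))
      also have "\<dots> = (\<Sum>i<n. \<Sum>j<n. (u \<bullet> d i) * ((v \<bullet> d j) * (d i \<bullet> S (d j))))"
        by (subst proj) (simp add: inner_sum_right sum_distrib_left)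
      finally show ?thesis
        unfolding form by (simp add: x(2) inner_commute[of "d _" u] inner_commute[of "d _" v] mult_ac)
    qed
    then have "T x = S"
      by (metis ext vector_eq_ldot)
    then show "\<exists>x\<in>V. T x = S"
      using x(1) by blast
  qed
  moreover have "(\<forall>v. 0 \<le> v \<bullet> T x v) \<longleftrightarrow> f x \<in> block_cone blk" if x: "x \<in> V" for x
  proof -
    have "f x \<in> block_space blk"
      using x range by blast
    then have mem: "f x \<in> block_cone blk \<longleftrightarrow> (\<forall>h. 0 \<le> (\<Sum>i<n. \<Sum>j<n. h i * f x i j * h j))"
      by (simp add: blk)
    have "0 \<le> (\<Sum>i<n. \<Sum>j<n. h i * f x i j * h j)" if pos: "\<forall>v. 0 \<le> v \<bullet> T x v" for h
    proof -
      have "d i \<bullet> (\<Sum>i<n. h i *\<^sub>R d i) = h i" if "i < n" for i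
        using orthonormal_family_inner[OF orth that, of h] by (simp add: inner_commute)
      then show ?thesis
        using pos[rule_format, of "\<Sum>i<n. h i *\<^sub>R d i"] by (simp add: form)
    qed
    moreover have "0 \<le> v \<bullet> T x v"
      if "\<forall>h. 0 \<le> (\<Sum>i<n. \<Sum>j<n. h i * f x i j * h j)" for v
      using that[rule_format, of "\<lambda>i. d i \<bullet> v"] by (simp add: form)
    ultimately show ?thesis
      unfolding mem by blast
  qed
  then have "{x \<in> V. \<forall>v. 0 \<le> v \<bullet> T x v} = {x \<in> V. f x \<in> block_cone blk}"
    by blast
  ultimately show ?thesis by simp
qed

lemma peirce_cone_block: "peirce_cone V {x \<in> V. f x \<in> block_cone blk}"
  using peirce_cone_Nonneg_Block peirce_cone_Lorentz_Block peirce_cone_Rotated_Block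
    peirce_cone_PSD_Block by (cases blk) blast+

end

lemma zero_mem_block_space: "(\<lambda>i j. 0) \<in> block_space blk"
  by (cases blk) (auto simp: supported_on_def)

text \<open>As \<open>\<phi>\<close> is an isometry onto the product, each coordinate block pulls
  back to a subspace \<open>V k\<close> with a projection \<open>\<pi> k\<close>, and
  \<open>K\<close> becomes the orthogonal sum of its factors inside these subspaces.\<close>

lemma peirce_cone_product:
  fixes K :: "'e::euclidean_space set"
  assumes "is_cone_product K"
  shows "peirce_cone UNIV K"
proof -
  obtain blks and \<phi> :: "'e \<Rightarrow> nat \<Rightarrow> nat \<Rightarrow> nat \<Rightarrow> real" where
    lin': "\<forall>k i j. linear (\<lambda>x. \<phi> x k i j)" and
    inner': "\<forall>x y. x \<bullet> y = (\<Sum>k<length blks. block_inner (blks ! k) (\<phi> x k) (\<phi> y k))" and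
    range: "range \<phi> = {a. (\<forall>k<length blks. a k \<in> block_space (blks ! k)) \<and>
                     (\<forall>k\<ge>length blks. \<forall>i j. a k i j = 0)}" and
    K: "K = {x. \<forall>k<length blks. \<phi> x k \<in> block_cone (blks ! k)}"
    using assms unfolding is_cone_product_def by (elim exE conjE) (rule that)
  note lin = lin'[rule_format] and inner = inner'[rule_format]
  define n where "n = length blks"
  \<comment> \<open>Definiteness of the inner product makes \<open>\<phi>\<close> injective;
    identities between vectors can then be checked in coordinates.\<close>
  have inj: "x = y" if "\<phi> x = \<phi> y" for x y
  proof -
    have "\<phi> (x - y) k i j = 0" for k i j
      using that linear_diff[OF lin, of x y k i j] by simp
    then have "(x - y) \<bullet> (x - y) = 0"
      unfolding inner by (simp add: block_inner_def split_beta)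
    then show ?thesis by simp
  qed
  define V where "V k = {x. \<forall>j. j \<noteq> k \<longrightarrow> \<phi> x j = (\<lambda>i j. 0)}" for k
  have ex: "\<exists>x. \<phi> x = (\<lambda>j. if j = k then a else (\<lambda>i j. 0))"
    if "k < n" "a \<in> block_space (blks ! k)" for k a
  proof -
    have "(\<lambda>j. if j = k then a else (\<lambda>i j. 0)) \<in> range \<phi>"
      unfolding range using that zero_mem_block_space by (auto simp: n_def)
    then show ?thesis
      by (metis imageE)
  qed
  have mem: "\<phi> x k \<in> block_space (blks ! k)" if "k < n" for x k
    using that range by (auto simp: n_def)
  have "\<exists>y. k < n \<longrightarrow> \<phi> y = (\<lambda>j. if j = k then \<phi> x k else (\<lambda>i j. 0))" for k x
    using ex mem by blast
  then obtain \<pi> where \<pi>: "\<And>k x. k < n \<Longrightarrow> \<phi> (\<pi> k x) = (\<lambda>j. if j = k then \<phi> x k else (\<lambda>i j. 0))"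
    by metis
  have lin_add: "\<phi> (x + y) k i j = \<phi> x k i j + \<phi> y k i j" for x y k i j
    using linear_add[OF lin] .
  have lin_scale: "\<phi> (r *\<^sub>R x) k i j = r * \<phi> x k i j" for r x k i j
    using linear_scale[OF lin, of r x] by simp
  have lin_sum: "\<phi> (\<Sum>k<n. z k) l i j = (\<Sum>k<n. \<phi> (z k) l i j)" for z l i j
    using linear_sum[OF lin] .
  have "peirce_cone UNIV {x. \<forall>k<n. \<pi> k x \<in> {x \<in> V k. \<phi> x k \<in> block_cone (blks ! k)}}"
  proof (rule peirce_cone_orthogonal_sum)
    show "linear (\<pi> k)" if k: "k < n" for k
      by (rule linearI; rule inj) (simp_all add: fun_eq_iff \<pi>[OF k] lin_add lin_scale)
    show "x \<bullet> y = (\<Sum>k<n. \<pi> k x \<bullet> \<pi> k y)" for x y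
      unfolding inner[of x y]
    proof (intro sum.cong)
      fix k assume "k \<in> {..<n}"
      then have k: "k < n" by simp
      have "\<pi> k x \<bullet> \<pi> k y = (\<Sum>j<n. if j = k then block_inner (blks ! k) (\<phi> x k) (\<phi> y k) else 0)"
        unfolding inner[of "\<pi> k x"] n_def[symmetric]
        by (intro sum.cong refl) (simp add: \<pi>[OF k] block_inner_def split_beta)
      then show "block_inner (blks ! k) (\<phi> x k) (\<phi> y k) = \<pi> k x \<bullet> \<pi> k y"
        using k by simp
    qed (simp add: n_def)
    show "\<pi> k x \<in> V k" if "k < n" for k x
      using that by (simp add: V_def \<pi>)
    show "\<pi> j (\<Sum>k<n. z k) = z j" if z: "\<And>k. k < n \<Longrightarrow> z k \<in> V k" and j: "j < n" for z j
    proof (rule inj, intro ext)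
      fix l i m
      have "(\<Sum>k<n. \<phi> (z k) j i m) = (\<Sum>k<n. if k = j then \<phi> (z j) j i m else 0)"
        using z by (intro sum.cong refl) (auto simp: V_def)
      then have "\<phi> (\<Sum>k<n. z k) j i m = \<phi> (z j) j i m"
        using j by (simp add: lin_sum)
      moreover have "\<phi> (z j) l i m = 0" if "l \<noteq> j"
        using z[OF j] that by (simp add: V_def)
      ultimately show "\<phi> (\<pi> j (\<Sum>k<n. z k)) l i m = \<phi> (z j) l i m"
        by (simp add: \<pi>[OF j])
    qed
    fix k assume k: "k < n"
    have "block_coordinates (V k) (\<lambda>x. \<phi> x k) (blks ! k)"
    proof (rule block_coordinates.intro)
      show "subspace (V k)"
      proof (rule subspaceI)
        have "\<phi> 0 l i j = 0" for l i j
          using lin_scale[of 0 0] by simp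
        then show "0 \<in> V k"
          by (simp add: V_def fun_eq_iff)
      qed (auto simp: V_def fun_eq_iff lin_add lin_scale)
      show "x \<bullet> y = block_inner (blks ! k) (\<phi> x k) (\<phi> y k)" if "x \<in> V k" "y \<in> V k" for x y
      proof -
        have "x \<bullet> y = (\<Sum>j<n. if j = k then block_inner (blks ! k) (\<phi> x k) (\<phi> y k) else 0)"
          unfolding inner[of x] n_def[symmetric] using that
          by (intro sum.cong refl) (auto simp: V_def block_inner_def split_beta)
        then show ?thesis
          using k by simp
      qed
      have "a \<in> (\<lambda>x. \<phi> x k) ` V k" if a: "a \<in> block_space (blks ! k)" for a
      proof -
        obtain x where "\<phi> x = (\<lambda>j. if j = k then a else (\<lambda>i j. 0))"
          using ex[OF k a] by blast
        then have "x \<in> V k" "a = \<phi> x k"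
          by (simp_all add: V_def)
        then show ?thesis
          by blast
      qed
      then show "(\<lambda>x. \<phi> x k) ` V k = block_space (blks ! k)"
        using mem[OF k] by blast
    qed (rule lin)
    then show "peirce_cone (V k) {x \<in> V k. \<phi> x k \<in> block_cone (blks ! k)}"
      by (rule block_coordinates.peirce_cone_block)
  qed
  moreover have "{x. \<forall>k<n. \<pi> k x \<in> {x \<in> V k. \<phi> x k \<in> block_cone (blks ! k)}} = K"
    unfolding K n_def[symmetric] by (auto simp: V_def \<pi>)
  ultimately show ?thesis by simp
qed

section \<open>Regularity under strict complementarity\<close>

lemma le_infdistI: "S \<noteq> {} \<Longrightarrow> (\<And>a. a \<in> S \<Longrightarrow> d \<le> dist x a) \<Longrightarrow> d \<le> infdist x S"
  unfolding infdist_notempty by (rule cINF_greatest)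

lemma le_mult_infdistI:
  assumes "S \<noteq> {}" "m > 0" "\<And>a. a \<in> S \<Longrightarrow> d \<le> m * dist x a"
  shows "d \<le> m * infdist x S"
proof -
  have "d / m \<le> infdist x S"
    using assms by (intro le_infdistI) (auto simp: pos_divide_le_eq mult.commute)
  then show ?thesis
    using assms(2) by (simp add: pos_divide_le_eq mult.commute)
qed

lemma interior_rotated_lorentz_cone:
  fixes w :: "'w::euclidean_space"
  assumes "0 < u" "0 < v" "(norm w)\<^sup>2 < 2 * u * v"
  shows "(u, v, w) \<in> interior rotated_lorentz_cone"
proof (rule interiorI)
  let ?S = "{z :: real \<times> real \<times> 'w. 0 < fst z} \<inter> {z. 0 < fst (snd z)} \<inter>
    {z. (norm (snd (snd z)))\<^sup>2 < 2 * fst z * fst (snd z)}"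
  show "open ?S"
    by (intro open_Int open_Collect_less continuous_intros)
  show "?S \<subseteq> rotated_lorentz_cone"
    by (auto simp: rotated_lorentz_cone_def)
qed (use assms in auto)

section \<open>The product structure of the KKT set\<close>

locale conic_qp = full_peirce_cone K for K :: "'e::euclidean_space set" +
  fixes Q :: "'e \<Rightarrow> 'e" and c :: 'e and A :: "'e \<Rightarrow> 'y::euclidean_space" and b :: 'y
  assumes A: "linear A" and Q: "linear Q" "adjoint Q = Q" "\<And>x. 0 \<le> x \<bullet> Q x"
begin

abbreviation "kkt \<equiv> kkt_set Q c A b K"
abbreviation "sl \<equiv> slack Q c A"

lemma Q_sym: "Q u \<bullet> v = u \<bullet> Q v"
  using adjoint_works[OF Q(1), of u v] Q(2) by simp

lemma adj: "adjoint A y \<bullet> x = y \<bullet> A x" "x \<bullet> adjoint A y = y \<bullet> A x"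
  by (simp_all add: adjoint_clauses[OF A] inner_commute)

lemma adj_linear: "linear (adjoint A)"
  by (rule adjoint_linear[OF A])

text \<open>The norm bound for positive semidefinite maps gives
  \<open>(norm (Q d))\<^sup>2 \<le> H * (d \<bullet> Q d)\<close>.\<close>

lemma Q_null:
  assumes "d \<bullet> Q d = 0"
  shows "Q d = 0"
proof -
  obtain H where "\<And>v. norm (Q v) \<le> H * norm v"
    using onorm_pos_bound[OF Q(1)] by metis
  from positive_semidefinite_norm_bound[OF Q(1) Q_sym Q(3) this, of d] assms
  show ?thesis by simp
qed

lemma kkt_iff: "(x, y) \<in> kkt \<longleftrightarrow> A x = b \<and> x \<in> K \<and> sl (x, y) \<in> K \<and> x \<bullet> sl (x, y) = 0"
  by (simp add: kkt_set_def dual_cone_eq)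

text \<open>Monotonicity: with slacks \<open>s\<close>, \<open>s'\<close>, the number
  \<open>(s - s') \<bullet> (x - x')\<close> equals \<open>(x - x') \<bullet> Q (x - x')\<close>,
  which is nonnegative, because both points satisfy the equality constraint. By complementarity it
  is also minus a sum of two nonnegative pairings, so all these terms vanish.\<close>

lemma kkt_Q_eq:
  assumes "(x, y) \<in> kkt" "(x', y') \<in> kkt"
  shows "Q x = Q x'" "x \<bullet> sl (x', y') = 0"
proof -
  note z = assms[unfolded kkt_iff]
  have "(sl (x, y) - sl (x', y')) \<bullet> (x - x') = (x - x') \<bullet> Q (x - x') - (y - y') \<bullet> (A x - A x')"
    by (simp add: slack_def inner_simps linear_diff[OF Q(1)] adj Q_sym algebra_simps)
  then have 1: "(sl (x, y) - sl (x', y')) \<bullet> (x - x') = (x - x') \<bullet> Q (x - x')"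
    using z by simp
  have 2: "(sl (x, y) - sl (x', y')) \<bullet> (x - x') = - (sl (x, y) \<bullet> x') - (x \<bullet> sl (x', y'))"
    using z by (simp add: inner_simps inner_commute)
  have 3: "0 \<le> sl (x, y) \<bullet> x'" "0 \<le> x \<bullet> sl (x', y')"
    using z inner_nonneg by auto
  from 1 2 3 Q(3)[of "x - x'"] have "(x - x') \<bullet> Q (x - x') = 0" "x \<bullet> sl (x', y') = 0"
    by linarith+
  then show "Q x = Q x'" "x \<bullet> sl (x', y') = 0"
    using Q_null[of "x - x'"] by (simp_all add: linear_diff[OF Q(1)])
qed

text \<open>The slack depends on the primal part only through \<open>Q x\<close>, which all KKT
  points share, and complementarity holds across pairs; primal and dual parts therefore recombine
  freely.\<close>

lemma kkt_swap:
  assumes "(x, y) \<in> kkt" "(x', y') \<in> kkt"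
  shows "(x, y') \<in> kkt" "sl (x, y') = sl (x', y')"
proof -
  show eq: "sl (x, y') = sl (x', y')"
    using kkt_Q_eq(1)[OF assms] by (simp add: slack_def)
  show "(x, y') \<in> kkt"
    using assms kkt_Q_eq(2)[OF assms] by (auto simp: kkt_iff eq)
qed

lemma kkt_Times: "kkt = fst ` kkt \<times> snd ` kkt"
  using kkt_swap(1) by force

lemma kkt_slackI:
  assumes "(x, y) \<in> kkt" "sl (x, y') \<in> K" "x \<bullet> sl (x, y') = 0"
  shows "(x, y') \<in> kkt"
  using assms by (simp add: kkt_iff)

lemma normal_cone_iff:
  assumes x: "x \<in> K"
  shows "v \<in> normal_cone K x \<longleftrightarrow> - v \<in> K \<and> x \<bullet> v = 0"
proof
  assume v: "v \<in> normal_cone K x"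
  \<comment> \<open>Testing the normal cone inequality at \<open>2 x\<close> and at 0 forces
    \<open>x \<bullet> v = 0\<close>.\<close>
  have "x + x \<in> K"
    using x by (intro add_mem)
  then have "v \<bullet> (x + x - x) \<le> 0" "v \<bullet> (0 - x) \<le> 0"
    using v zero_mem unfolding normal_cone_def by blast+
  then have vx: "x \<bullet> v = 0"
    by (simp add: inner_commute)
  have "0 \<le> - v \<bullet> u" if "u \<in> K" for u
    using v that vx by (auto simp: normal_cone_def inner_simps inner_commute)
  then show "- v \<in> K \<and> x \<bullet> v = 0"
    using mem_iff[of "- v"] vx by blast
next
  assume v: "- v \<in> K \<and> x \<bullet> v = 0"
  have "v \<bullet> (u - x) \<le> 0" if "u \<in> K" for u
    using inner_nonneg[OF conjunct1[OF v] that] v by (simp add: inner_diff_right inner_commute)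
  then show "v \<in> normal_cone K x"
    by (simp add: normal_cone_def)
qed

end

section \<open>Local constancy of faces, slack regularity and calmness\<close>

locale strictly_complementary_qp = conic_qp K Q c A b
  for K :: "'e::euclidean_space set" and Q c and A :: "'e \<Rightarrow> 'y::euclidean_space" and b +
  fixes xb :: 'e and yb :: 'y and \<delta> :: real
  assumes zbar: "(xb, yb) \<in> kkt_set Q c A b K" and \<delta>: "\<delta> > 0"
    and sc: "\<And>x y. (x, y) \<in> kkt_set Q c A b K \<Longrightarrow> dist (x, y) (xb, yb) < \<delta> \<Longrightarrow>
      x + slack Q c A (x, y) \<in> interior K"
begin

abbreviation "sb \<equiv> sl (xb, yb)"

lemma zbar_mem: "xb \<in> K" "sb \<in> K" "xb \<bullet> sb = 0" "xb + sb \<in> interior K"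
  using zbar sc[OF zbar] \<delta> by (auto simp: kkt_iff)

text \<open>Recombination with the reference point gives KKT pairs \<open>(x, yb)\<close> and
  \<open>(xb, y)\<close> no farther from it, so strict complementarity holds for these mixed pairs
  as well.\<close>

lemma near:
  assumes "(x, y) \<in> kkt" "dist (x, y) (xb, yb) < \<delta>"
  shows "x \<in> K" "x \<bullet> sb = 0" "x + sb \<in> interior K"
    "sl (x, y) \<in> K" "xb \<bullet> sl (x, y) = 0" "xb + sl (x, y) \<in> interior K"
proof -
  have d: "dist x xb < \<delta>" "dist y yb < \<delta>"
    using assms(2) dist_fst_le[of "(x, y)" "(xb, yb)"] dist_snd_le[of "(x, y)" "(xb, yb)"]
    by auto
  note 1 = kkt_swap[OF assms(1) zbar] and 2 = kkt_swap[OF zbar assms(1)]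
  show "x \<in> K" "x \<bullet> sb = 0" "sl (x, y) \<in> K" "xb \<bullet> sl (x, y) = 0"
    using assms(1) 1 2 by (auto simp: kkt_iff)
  show "x + sb \<in> interior K"
    using sc[OF 1(1)] d 1(2) by (simp add: dist_Pair_Pair)
  show "xb + sl (x, y) \<in> interior K"
    using sc[OF 2(1)] d 2(2) by (simp add: dist_Pair_Pair)
qed

text \<open>Orthogonality of complementary faces is applied twice, with \<open>x\<close> and
  \<open>xb\<close> exchanged and the slack \<open>sb\<close> kept. Hence a single projector, formed
  at \<open>xb\<close>, serves all nearby KKT points.\<close>

lemma near_face:
  assumes "(x, y) \<in> kkt" "dist (x, y) (xb, yb) < \<delta>" "t \<in> K"
  shows "x \<bullet> t = 0 \<longleftrightarrow> xb \<bullet> t = 0"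
  using face_orthogonal[OF zbar_mem near(1,2)[OF assms(1,2)] assms(3)]
    face_orthogonal[OF near(1)[OF assms(1,2)] zbar_mem(2) near(2,3)[OF assms(1,2)] zbar_mem(1,3) assms(3)]
  by blast

lemma ex_slack_regularity: "\<exists>\<kappa>>0. slack_regularity Q c A b K (xb, yb) \<kappa>"
proof -
  let ?p = "face_proj K xb"
  note linp = face_proj_linear[OF zbar_mem(1)]
  obtain g :: "'e \<Rightarrow> 'y" where g: "linear g" "\<And>y. adjoint A (g (adjoint A y)) = adjoint A y"
    using linear_ex_right_inverse[OF adj_linear] by blast
  \<comment> \<open>\<open>M\<close> vanishes exactly on the range of the adjoint, so the distance
    to the affine set in (S) becomes the residual of a linear map.\<close>
  define M where "M v = v - adjoint A (g v)" for v
  have M: "linear M"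
    using linear_compose_sub[OF linear_id linear_compose[OF g(1) adj_linear]]
    by (simp add: M_def[abs_def] o_def id_def)
  have M_adj: "M (adjoint A y) = 0" for y
    by (simp add: M_def g(2))
  obtain C e where C: "C > 0" and e: "e > 0" and
    err: "\<And>v. dist v sb < e \<Longrightarrow> \<exists>z\<in>K. xb \<bullet> z = 0 \<and> M z = M sb \<and>
        norm (v - z) \<le> C * (norm (M (v - sb)) + norm (v - ?p v))"
    using face_affine_error_bound[OF zbar_mem M] by blast
  obtain m where m: "m > 0" "\<And>v. norm (M v) \<le> m * norm v"
    using onorm_pos_bound[OF M] by blast
  obtain q where q: "q > 0" "\<And>v. norm (?p v) \<le> q * norm v"
    using onorm_pos_bound[OF linp] by blast
  \<comment> \<open>\<open>m\<close> bounds the affine residual and \<open>1 + q\<close> the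
    deviation from the face, \<open>q\<close> being a bound for the projector; their sum dominates
    both.\<close>
  have key: "infdist s (sl ` kkt) \<le> C * (m + 1 + q) *
      (infdist s {Q x + c - r | r. r \<in> range (adjoint A)} + infdist s {t \<in> dual_cone K. t \<bullet> x = 0})"
    if xy: "(x, y) \<in> kkt" "dist (x, y) (xb, yb) < \<delta>" and s: "dist s sb < e" for x y s
  proof -
    let ?D = "{Q x + c - r | r. r \<in> range (adjoint A)}" and ?F = "{t \<in> dual_cone K. t \<bullet> x = 0}"
    obtain z where z: "z \<in> K" "xb \<bullet> z = 0" "M z = M sb"
      "norm (s - z) \<le> C * (norm (M (s - sb)) + norm (s - ?p s))"
      using err[OF s] by blast
    have "M (z - sb) = 0"
      using z(3) by (simp add: linear_diff[OF M])
    \<comment> \<open>\<open>z\<close> differs from \<open>sb\<close> by an image of the adjoint, so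
      it is the slack of a shifted multiplier; its position in the face makes that multiplier dual
      optimal.\<close>
    then obtain w where "z = sb + adjoint A w"
      by (metis M_def add.commute diff_add_cancel right_minus_eq)
    then have z_sl: "z = sl (xb, yb - w)"
      by (simp add: slack_def linear_diff[OF adj_linear])
    have "(xb, yb - w) \<in> kkt"
      by (rule kkt_slackI[OF zbar]) (use z(1,2) z_sl in simp_all)
    then have "z \<in> sl ` kkt"
      using z_sl by blast
    then have "infdist s (sl ` kkt) \<le> norm (s - z)"
      by (metis infdist_le dist_norm)
    moreover have "norm (M (s - sb)) \<le> m * infdist s ?D"
    proof (rule le_mult_infdistI[OF _ m(1)])
      fix d assume "d \<in> ?D"
      then obtain y' where "d = Q x + c - adjoint A y'"
        by blast
      then have "d - sb = adjoint A (yb - y')"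
        using kkt_Q_eq(1)[OF xy(1) zbar] by (simp add: slack_def linear_diff[OF adj_linear])
      then have "M (d - sb) = 0"
        using M_adj by simp
      then have "M (s - sb) = M (s - d)"
        using linear_add[OF M, of "s - d" "d - sb"] by simp
      then show "norm (M (s - sb)) \<le> m * dist s d"
        using m(2) by (simp add: dist_norm)
    qed auto
    moreover have "norm (s - ?p s) \<le> (1 + q) * infdist s ?F"
    proof (rule le_mult_infdistI)
      fix t assume "t \<in> ?F"
      then have t: "t \<in> K" "xb \<bullet> t = 0"
        using near_face[OF xy] by (auto simp: dual_cone_eq inner_commute)
      have "s - ?p s = (s - t) - ?p (s - t)"
        using face_proj_fix[OF zbar_mem(1) t] by (simp add: linear_diff[OF linp])
      then have "norm (s - ?p s) \<le> norm (s - t) + norm (?p (s - t))"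
        by (metis norm_triangle_ineq4)
      then show "norm (s - ?p s) \<le> (1 + q) * dist s t"
        using q(2)[of "s - t"] by (simp add: dist_norm distrib_right)
    next
      have "0 \<in> ?F"
        using zero_mem by (simp add: dual_cone_eq)
      then show "?F \<noteq> {}" by blast
    qed (use q(1) in simp)
    ultimately have "infdist s (sl ` kkt) \<le> C * (m * infdist s ?D + (1 + q) * infdist s ?F)"
      using z(4) C by (smt (verit) mult_left_mono)
    also have "\<dots> \<le> C * ((m + 1 + q) * infdist s ?D + (m + 1 + q) * infdist s ?F)"
      using C m(1) q(1) by (intro mult_left_mono add_mono mult_right_mono infdist_nonneg) auto
    also have "\<dots> = C * (m + 1 + q) * (infdist s ?D + infdist s ?F)"
      by (simp only: mult.assoc distrib_left[symmetric])
    finally show ?thesis .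
  qed
  have "slack_regularity Q c A b K (xb, yb) (C * (m + 1 + q))"
    unfolding slack_regularity_def
  proof (intro exI conjI)
    show "(xb, yb) \<in> interior (ball (xb, yb) \<delta>)" "sb \<in> interior (ball sb e)"
      using \<delta> e by simp_all
  qed (use key in \<open>auto simp: dist_commute\<close>)
  moreover have "C * (m + 1 + q) > 0"
    using C m(1) q(1) by simp
  ultimately show ?thesis by blast
qed

lemma ex_normal_cone_calmness: "\<exists>\<kappa>>0. normal_cone_calmness Q c A b K (xb, yb) \<kappa>"
proof -
  obtain C r where C: "C > 0" and r: "r > 0" and
    calm: "\<And>f u t. f \<in> K \<Longrightarrow> f \<bullet> sb = 0 \<Longrightarrow> u \<in> K \<Longrightarrow> t \<in> K \<Longrightarrow> u \<bullet> t = 0 \<Longrightarrow>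
       dist u xb < r \<Longrightarrow> dist t sb < r \<Longrightarrow>
       \<exists>t0\<in>K. xb \<bullet> t0 = 0 \<and> norm (t - t0) \<le> C * norm (u - f)"
    using complementary_face_calmness[OF zbar_mem] by blast
  have key: "infdist v (normal_cone K x) \<le> C * norm (u - x)"
    if xy: "(x, y) \<in> kkt" "dist (x, y) (xb, yb) < \<delta>" and uv: "(u, v) \<in> normal_cone_graph K"
      and d: "dist u xb < r" "dist v (- sb) < r" for x y u v
  proof -
    have u: "u \<in> K" "- v \<in> K" "u \<bullet> (- v) = 0"
      using uv normal_cone_iff by (auto simp: normal_cone_graph_def)
    have "dist (- v) sb = dist v (- sb)"
      by (metis dist_minus minus_minus)
    \<comment> \<open>Here \<open>t = - v\<close> and \<open>f = x\<close>: the bound is measured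
      from the varying \<open>x\<close>, although the face is the one at \<open>xb\<close>.\<close>
    then obtain t0 where t0: "t0 \<in> K" "xb \<bullet> t0 = 0" "norm (- v - t0) \<le> C * norm (u - x)"
      using calm[OF near(1,2)[OF xy] u d(1)] d(2) by auto
    have "- t0 \<in> normal_cone K x"
      using t0 near_face[OF xy t0(1)] by (simp add: normal_cone_iff[OF near(1)[OF xy]])
    then have "infdist v (normal_cone K x) \<le> norm (v + t0)"
      by (metis infdist_le dist_norm diff_minus_eq_add)
    also have "norm (v + t0) = norm (- v - t0)"
      by (metis norm_minus_cancel minus_add_distrib diff_conv_add_uminus)
    finally show ?thesis
      using t0(3) by simp
  qed
  have "normal_cone_calmness Q c A b K (xb, yb) C"
    unfolding normal_cone_calmness_def
  proof (intro exI conjI)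
    show "(xb, yb) \<in> interior (ball (xb, yb) \<delta>)"
      using \<delta> by simp
    show "(fst (xb, yb), - sb) \<in> interior (ball xb r \<times> ball (- sb) r)"
      using r by (simp add: interior_Times)
  qed (use key in \<open>auto simp: dist_commute\<close>)
  then show ?thesis
    using C by blast
qed

end

section \<open>The lifted problem\<close>

locale factored_qp = conic_qp K Q c A b
  for K :: "'e::euclidean_space set" and Q c and A :: "'e \<Rightarrow> 'y::euclidean_space" and b +
  fixes B :: "'e \<Rightarrow> 'w::euclidean_space"
  assumes B: "linear B" "Q = adjoint B \<circ> B"
begin

abbreviation "KL \<equiv> K \<times> (rotated_lorentz_cone :: (real \<times> real \<times> 'w) set)"
abbreviation "lsl \<equiv> lifted_slack Q c A B"

lemma Q_B: "x \<bullet> Q y = B x \<bullet> B y"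
  by (simp add: B(2) adjoint_works[OF B(1)])

lemma B_eq:
  assumes "Q x = Q x'"
  shows "B x = B x'"
proof -
  have "B (x - x') \<bullet> B (x - x') = 0"
    using assms by (simp add: linear_diff[OF Q(1)] flip: Q_B)
  then show ?thesis
    by (simp add: linear_diff[OF B(1)])
qed

lemma KL_peirce: "full_peirce_cone KL"
  by standard (rule peirce_cone_Times[OF peirce peirce_cone_rotated_lorentz])

lemma lift_mem: "x \<in> K \<Longrightarrow> lift B x \<in> KL"
  by (simp add: lift_def rotated_lorentz_cone_def)

lemma lifted_slack_mem: "z \<in> kkt \<Longrightarrow> lsl z \<in> KL"
  by (cases z) (simp add: lifted_slack_def rotated_lorentz_cone_def kkt_iff)

lemma lifted_slack_inner:
  "lsl z \<bullet> (x, u, v, w) = sl z \<bullet> x + u + 1/2 * (norm (B (fst z)))\<^sup>2 * v - B (fst z) \<bullet> w"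
  by (simp add: lifted_slack_def inner_prod_def)

text \<open>Completing the square: the contributions of \<open>u\<close>, \<open>v\<close> and
  \<open>w\<close> combine to half a squared distance between images under \<open>B\<close>. A
  linear pairing thus carries the curvature of the objective.\<close>

lemma lifted_slack_lift: "lsl z \<bullet> lift B x = sl z \<bullet> x + 1/2 * (norm (B (x - fst z)))\<^sup>2"
  unfolding lift_def lifted_slack_inner linear_diff[OF B(1)] power2_norm_eq_inner
  by (simp add: inner_diff_left inner_diff_right inner_commute field_simps)

lemma lifted_slack_complementary:
  assumes "(x, y) \<in> kkt" "z \<in> kkt"
  shows "lsl z \<bullet> lift B x = 0"
proof -
  obtain x' y' where z: "z = (x', y')" by (cases z)
  have "B x = B x'"
    using kkt_Q_eq(1)[OF assms(1)] assms(2) by (intro B_eq) (simp add: z)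
  moreover have "sl z \<bullet> x = 0"
    using kkt_Q_eq(2)[OF assms(1)] assms(2) by (simp add: z inner_commute)
  ultimately show ?thesis
    by (simp add: lifted_slack_lift z linear_diff[OF B(1)])
qed

lemma lifted_feasible_mem:
  assumes "chi \<in> lifted_feasible A b K B"
  obtains x u where "chi = (x, u, 1, B x)" "A x = b" "x \<in> K" "(norm (B x))\<^sup>2 \<le> 2 * u"
    "chi \<in> KL"
  using assms by (auto simp: lifted_feasible_def rotated_lorentz_cone_def)

lemma lift_feasible:
  assumes "(x, y) \<in> kkt"
  shows "lift B x \<in> lifted_feasible A b K B"
  using assms lift_mem[of x] by (simp add: lifted_feasible_def lift_def kkt_iff)

text \<open>On the feasible set, pairing with a lifted slack is the objective up to a constant.
  Nonnegativity of the pairing is then weak duality, and a zero pairing certifies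
  optimality.\<close>

lemma lifted_slack_objective:
  assumes "chi \<in> lifted_feasible A b K B"
  shows "lsl z \<bullet> chi = lifted_objective c chi + (1/2 * (norm (B (fst z)))\<^sup>2 - snd z \<bullet> b)"
proof -
  obtain x u where chi: "chi = (x, u, 1, B x)" "A x = b"
    using lifted_feasible_mem[OF assms] by metis
  have "sl z \<bullet> x = B (fst z) \<bullet> B x + c \<bullet> x - snd z \<bullet> b"
    by (simp add: slack_def inner_simps adj chi(2) Q_sym Q_B)
  then show ?thesis
    unfolding chi(1) lifted_slack_inner lifted_objective_def by simp
qed

lemma lifted_solutionsI:
  assumes "z \<in> kkt" "chi \<in> lifted_feasible A b K B" "lsl z \<bullet> chi = 0"
  shows "chi \<in> lifted_solutions c A b K B"
proof -
  interpret KL: full_peirce_cone KL by (rule KL_peirce)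
  have "lifted_objective c chi \<le> lifted_objective c chi'"
    if "chi' \<in> lifted_feasible A b K B" for chi'
  proof -
    have "chi' \<in> KL"
      using lifted_feasible_mem[OF that] by metis
    then have "0 \<le> lsl z \<bullet> chi'"
      by (intro KL.inner_nonneg lifted_slack_mem assms(1))
    then show ?thesis
      using assms(3) lifted_slack_objective[OF assms(2), of z] lifted_slack_objective[OF that, of z]
      by linarith
  qed
  then show ?thesis
    using assms(2) by (simp add: lifted_solutions_def)
qed

lemma lift_solution: "(x, y) \<in> kkt \<Longrightarrow> lift B x \<in> lifted_solutions c A b K B"
  by (rule lifted_solutionsI[OF _ lift_feasible lifted_slack_complementary])

text \<open>An optimal point has pairing at most 0 with the lifted slack, and lowering
  \<open>u\<close> to its least value only decreases the pairing. At the lift it is a sum of two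
  nonnegative terms; both vanish, which gives complementarity and \<open>Q x = Q x0\<close>.\<close>

lemma lifted_solutions_fst:
  assumes z: "(x0, y) \<in> kkt" and chi: "chi \<in> lifted_solutions c A b K B"
  shows "(fst chi, y) \<in> kkt"
proof -
  have feas: "chi \<in> lifted_feasible A b K B"
    using chi by (simp add: lifted_solutions_def)
  obtain x u where x: "chi = (x, u, 1, B x)" "A x = b" "x \<in> K" "(norm (B x))\<^sup>2 \<le> 2 * u"
    using lifted_feasible_mem[OF feas] by metis
  have "lifted_objective c chi \<le> lifted_objective c (lift B x0)"
    using chi lift_feasible[OF z] by (auto simp: lifted_solutions_def)
  then have "lsl (x0, y) \<bullet> chi \<le> 0"
    using lifted_slack_objective[OF feas, of "(x0, y)"]
      lifted_slack_objective[OF lift_feasible[OF z], of "(x0, y)"]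
      lifted_slack_complementary[OF z z] by linarith
  moreover have "lsl (x0, y) \<bullet> lift B x \<le> lsl (x0, y) \<bullet> chi"
    unfolding x(1) lift_def lifted_slack_inner using x(4) by simp
  ultimately have "sl (x0, y) \<bullet> x + 1/2 * (norm (B (x - x0)))\<^sup>2 \<le> 0"
    using lifted_slack_lift[of "(x0, y)" x] by simp
  moreover have "0 \<le> sl (x0, y) \<bullet> x"
    using z x(3) by (auto simp: kkt_iff intro: inner_nonneg)
  moreover have "0 \<le> (norm (B (x - x0)))\<^sup>2"
    by simp
  ultimately have "sl (x0, y) \<bullet> x = 0" "(norm (B (x - x0)))\<^sup>2 = 0"
    by linarith+
  moreover have "Q x = Q x0"
    using \<open>(norm (B (x - x0)))\<^sup>2 = 0\<close> by (simp add: B(2) linear_diff[OF B(1)])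
  then have "sl (x, y) = sl (x0, y)"
    by (simp add: slack_def)
  ultimately show ?thesis
    using z x by (simp add: kkt_iff inner_commute)
qed

end

locale strictly_complementary_factored_qp =
  strictly_complementary_qp K Q c A b xb yb \<delta> + factored_qp K Q c A b B
  for K :: "'e::euclidean_space set" and Q c and A :: "'e \<Rightarrow> 'y::euclidean_space" and b xb yb \<delta>
    and B :: "'e \<Rightarrow> 'w::euclidean_space"
begin

text \<open>The face lemmas are used with primal and dual exchanged: the projector is formed at the
  lifted slack \<open>?zeta\<close>, and the lifted point \<open>?chi\<close> is the relative
  interior point of the face orthogonal to it.\<close>

lemma ex_lifted_error_bound:
  "\<exists>\<kappa>>0. \<exists>\<gamma>>0. lifted_error_bound Q c A b K B (xb, yb) \<kappa> \<gamma>"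
proof -
  interpret KL: full_peirce_cone KL by (rule KL_peirce)
  let ?chi = "lift B xb" and ?zeta = "lsl (xb, yb)"
  let ?p = "face_proj KL ?zeta"
  have mem: "?zeta \<in> KL" "?chi \<in> KL" "?zeta \<bullet> ?chi = 0"
    using lifted_slack_mem[OF zbar] lift_mem[OF zbar_mem(1)] lifted_slack_complementary[OF zbar zbar]
    by auto
  have sc: "?zeta + ?chi \<in> interior KL"
  proof -
    \<comment> \<open>The rotated components of slack and point add up to \<open>(a, a, 0)\<close>,
      which is interior because \<open>a > 0\<close>.\<close>
    define a where "a = 1 + 1/2 * (norm (B xb))\<^sup>2"
    have "a > 0"
      by (simp add: a_def add_pos_nonneg)
    have "?zeta + ?chi = (sb + xb, a, a, 0)"
      by (simp add: lifted_slack_def lift_def a_def)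
    moreover have "(a, a, 0 :: 'w) \<in> interior rotated_lorentz_cone"
      by (rule interior_rotated_lorentz_cone) (use \<open>a > 0\<close> in simp_all)
    ultimately show ?thesis
      using zbar_mem(4) by (simp add: interior_Times add.commute)
  qed
  have lin_map: "linear (lifted_map A B)"
    unfolding lifted_map_def
    by (rule linearI) (auto simp: linear_add[OF A] linear_scale[OF A] linear_add[OF B(1)]
        linear_scale[OF B(1)] algebra_simps)
  obtain C e where C: "C > 0" and e: "e > 0" and
    err: "\<And>v. dist v ?chi < e \<Longrightarrow> \<exists>z\<in>KL. ?zeta \<bullet> z = 0 \<and> lifted_map A B z = lifted_map A B ?chi \<and>
        norm (v - z) \<le> C * (norm (lifted_map A B (v - ?chi)) + norm (v - ?p v))"
    using KL.face_affine_error_bound[OF mem sc lin_map] by blast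
  have mem': "?chi \<bullet> ?zeta = 0" "?chi + ?zeta \<in> interior KL"
    using mem(3) sc by (simp_all add: inner_commute add.commute)
  obtain e' where e': "e' > 0" and
    order: "\<And>t u. t \<in> KL \<Longrightarrow> ?chi \<bullet> t = 0 \<Longrightarrow> dist t ?zeta < e' \<Longrightarrow> u \<in> KL \<Longrightarrow>
      ?zeta \<bullet> u \<le> 2 * (t \<bullet> u)"
    using KL.ex_face_order[OF mem(2,1) mem'] by blast
  obtain H where H: "H > 0" "\<And>t. t \<in> KL \<Longrightarrow> (norm (t - ?p t))\<^sup>2 \<le> H * (?zeta \<bullet> t) * norm t"
    using KL.face_proj_error[OF mem(1)] by blast
  define V where "V = {z. dist (lsl z) ?zeta < e'}"
  \<comment> \<open>The radius 1 bounds \<open>norm chi\<close> by \<open>R\<close>, which absorbs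
    the factor \<open>norm t\<close> of the projector estimate.\<close>
  define N where "N = ball ?chi (min e 1)"
  define R where "R = norm ?chi + 1"
  have R: "R > 0"
    by (simp add: R_def add_nonneg_pos)
  have key: "infdist chi (lifted_solutions c A b K B)
      \<le> C * sqrt (2 * H * R) * sqrt (lsl z \<bullet> chi) + C * norm (lifted_map A B chi - (b, 1, 0))"
    if z: "z \<in> kkt" "z \<in> V" and chi: "chi \<in> KL" "chi \<in> N" for z chi
  proof -
    have Lchi: "lifted_map A B ?chi = (b, 1, 0)"
      using zbar by (simp add: lifted_map_def lift_def kkt_iff)
    have d: "dist chi ?chi < e" "dist chi ?chi < 1"
      using chi(2) by (simp_all add: N_def dist_commute)
    obtain s where s: "s \<in> KL" "?zeta \<bullet> s = 0" "lifted_map A B s = (b, 1, 0)"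
      "norm (chi - s) \<le> C * (norm (lifted_map A B (chi - ?chi)) + norm (chi - ?p chi))"
      using err[OF d(1)] Lchi by auto
    have "s \<in> lifted_feasible A b K B"
      using s(1,3) by (auto simp: lifted_map_def lifted_feasible_def)
    then have "s \<in> lifted_solutions c A b K B"
      using lifted_solutionsI[OF zbar] s(2) by blast
    then have "infdist chi (lifted_solutions c A b K B) \<le> norm (chi - s)"
      by (metis infdist_le dist_norm)
    moreover have "lifted_map A B (chi - ?chi) = lifted_map A B chi - (b, 1, 0)"
      by (simp add: linear_diff[OF lin_map] Lchi)
    moreover have "norm (chi - ?p chi) \<le> sqrt (2 * H * R) * sqrt (lsl z \<bullet> chi)"
    proof -
      have "?chi \<bullet> lsl z = 0"
        using lifted_slack_complementary[OF zbar z(1)] by (simp add: inner_commute)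
      \<comment> \<open>The slack of the varying KKT point replaces the reference slack; the factor
        2 reappears in \<open>sqrt (2 * H * R)\<close>.\<close>
      then have le: "?zeta \<bullet> chi \<le> 2 * (lsl z \<bullet> chi)"
        using order[OF lifted_slack_mem[OF z(1)]] z(2) chi(1) by (simp add: V_def)
      have "norm chi \<le> R"
        using norm_triangle_sub[of chi ?chi] d(2) by (simp add: R_def dist_norm)
      have "(norm (chi - ?p chi))\<^sup>2 \<le> H * (?zeta \<bullet> chi) * norm chi"
        by (rule H(2)[OF chi(1)])
      also have "\<dots> \<le> H * (2 * (lsl z \<bullet> chi)) * R"
        using le \<open>norm chi \<le> R\<close> H(1) KL.inner_nonneg[OF mem(1) chi(1)]
        by (intro mult_mono mult_left_mono) auto
      finally have "norm (chi - ?p chi) \<le> sqrt (2 * H * R * (lsl z \<bullet> chi))"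
        by (intro real_le_rsqrt) (simp add: mult_ac)
      then show ?thesis
        by (simp add: real_sqrt_mult)
    qed
    then have "C * norm (chi - ?p chi) \<le> C * (sqrt (2 * H * R) * sqrt (lsl z \<bullet> chi))"
      using C by (intro mult_left_mono) auto
    ultimately show ?thesis
      using s(4) by (simp add: distrib_left mult.assoc)
  qed
  have "continuous_on UNIV lsl"
    unfolding lifted_slack_def[abs_def] slack_def[abs_def]
    by (intro continuous_intros linear_continuous_on_compose[OF _ Q(1)]
        linear_continuous_on_compose[OF _ adj_linear] linear_continuous_on_compose[OF _ B(1)])
  then have "open V"
    unfolding V_def by (intro open_Collect_less continuous_intros)
  moreover have "(xb, yb) \<in> V"
    using e' by (simp add: V_def)
  ultimately have "(xb, yb) \<in> interior V"
    by (simp add: interior_open)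
  then have "lifted_error_bound Q c A b K B (xb, yb) (C * sqrt (2 * H * R)) C"
    unfolding lifted_error_bound_def using key e
    by (intro exI[of _ V] exI[of _ N]) (auto simp: N_def)
  moreover have "C * sqrt (2 * H * R) > 0"
    using C H(1) R by simp
  ultimately show ?thesis
    using C by blast
qed

end

section \<open>Growth of the smoothed gap\<close>

text \<open>The first-order condition along a segment: if \<open>p\<close> were negative, the
  \<open>s\<close> chosen below would keep the quadratic term below half the size of the linear
  one.\<close>

lemma quadratic_nonneg_linear_part:
  fixes p q :: real
  assumes "\<And>s. 0 < s \<Longrightarrow> s \<le> 1 \<Longrightarrow> 0 \<le> s * p + s\<^sup>2 * q"
  shows "0 \<le> p"
proof (rule ccontr)
  assume "\<not> 0 \<le> p"
  define s where "s = min 1 (- p / (2 * (\<bar>q\<bar> + 1)))"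
  have s: "0 < s" "s \<le> 1" "s \<le> - p / (2 * (\<bar>q\<bar> + 1))"
    using \<open>\<not> 0 \<le> p\<close> by (simp_all add: s_def divide_neg_pos)
  have "0 \<le> s * (p + s * q)"
    using assms[OF s(1,2)] by (simp add: power2_eq_square algebra_simps)
  then have "0 \<le> p + s * q"
    using s(1) by (simp add: zero_le_mult_iff)
  moreover have "s * q \<le> s * (\<bar>q\<bar> + 1)"
    using s(1) by (intro mult_left_mono) auto
  moreover have "s * (2 * (\<bar>q\<bar> + 1)) \<le> - p"
    using s(3) by (subst (asm) pos_le_divide_eq) auto
  then have "2 * (s * (\<bar>q\<bar> + 1)) \<le> - p"
    by (simp only: mult.left_commute)
  ultimately show False
    using \<open>\<not> 0 \<le> p\<close> by linarith
qed

text \<open>Passing to closures leaves distances unchanged and makes them attained, so nearest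
  points in the two factors can be paired.\<close>

lemma infdist_Times_le:
  fixes x :: "'a::euclidean_space" and y :: "'b::euclidean_space"
  assumes "S \<noteq> {}" "T \<noteq> {}"
  shows "(infdist (x, y) (S \<times> T))\<^sup>2 \<le> (infdist x S)\<^sup>2 + (infdist y T)\<^sup>2"
proof -
  have cl: "infdist v U = infdist v (closure U)" for U and v :: "'c::euclidean_space"
    by (simp add: infdist_eq_setdist)
  obtain s where s: "s \<in> closure S" "infdist x S = dist x s"
    using infdist_attains_inf[OF closed_closure, of S x] assms(1) unfolding cl[of x S, symmetric]
    by (metis closure_eq_empty)
  obtain t where t: "t \<in> closure T" "infdist y T = dist y t"
    using infdist_attains_inf[OF closed_closure, of T y] assms(2) unfolding cl[of y T, symmetric]
    by (metis closure_eq_empty)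
  have "infdist (x, y) (S \<times> T) \<le> dist (x, y) (s, t)"
    by (subst cl, rule infdist_le) (use s t in \<open>simp add: closure_Times\<close>)
  then have "(infdist (x, y) (S \<times> T))\<^sup>2 \<le> (dist (x, y) (s, t))\<^sup>2"
    by (intro power_mono infdist_nonneg)
  then show ?thesis
    by (simp add: dist_Pair_Pair s t)
qed

section \<open>Proximal points and the distance to the dual solutions\<close>

context conic_qp
begin

lemma ex_proximal_point:
  assumes xi: "\<xi> > 0" and x0: "x0 \<in> K" and K: "closed K" "convex K"
  obtains p where "p \<in> K" "\<And>u. u \<in> K \<Longrightarrow> 0 \<le> (Q p + g + \<xi> *\<^sub>R (p - x0)) \<bullet> (u - p)"
proof -
  define h where "h u = 1/2 * (u \<bullet> Q u) + g \<bullet> u + \<xi>/2 * ((u - x0) \<bullet> (u - x0))" for u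
  have h_add: "h (p + d) = h p + (Q p + g + \<xi> *\<^sub>R (p - x0)) \<bullet> d + (1/2 * (d \<bullet> Q d) + \<xi>/2 * (d \<bullet> d))"
    for p d
  proof -
    have 1: "(p + d) \<bullet> Q (p + d) = p \<bullet> Q p + 2 * (Q p \<bullet> d) + d \<bullet> Q d"
      using Q_sym[of p d] by (simp add: linear_add[OF Q(1)] inner_add inner_commute[of d "Q p"])
    have "p + d - x0 = (p - x0) + d"
      by simp
    then have 2: "(p + d - x0) \<bullet> (p + d - x0) = (p - x0) \<bullet> (p - x0) + 2 * ((p - x0) \<bullet> d) + d \<bullet> d"
      by (simp only: inner_add_left inner_add_right inner_commute[of d "p - x0"])
    have 3: "(Q p + g + \<xi> *\<^sub>R (p - x0)) \<bullet> d = Q p \<bullet> d + g \<bullet> d + \<xi> * ((p - x0) \<bullet> d)"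
      by (simp only: inner_add_left inner_scaleR_left)
    show ?thesis
      unfolding h_def 1 2 3 inner_add_right by (simp add: distrib_left)
  qed
  define G where "G = Q x0 + g"
  \<comment> \<open>Beyond this radius the penalty outweighs the slope \<open>G\<close> of
    \<open>h\<close> at \<open>x0\<close>, so \<open>h\<close> is at least \<open>h x0\<close> there
    and a minimum over a compact part of \<open>K\<close> is global.\<close>
  define R where "R = 2 * norm G / \<xi>"
  have R: "R \<ge> 0"
    using xi by (simp add: R_def)
  have far: "h x0 \<le> h u" if "dist x0 u > R" for u
  proof -
    define d where "d = u - x0"
    have d: "norm d > R"
      using that by (simp add: d_def dist_norm norm_minus_commute)
    have "\<xi> / 2 * (d \<bullet> d) = \<xi> / 2 * norm d * norm d"
      by (simp add: power2_norm_eq_inner[symmetric] power2_eq_square)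
    also have "\<dots> \<ge> \<xi> / 2 * R * norm d"
      using d xi by (intro mult_right_mono mult_left_mono) auto
    also have "\<xi> / 2 * R * norm d = norm G * norm d"
      using xi by (simp add: R_def)
    also have "\<dots> \<ge> - (G \<bullet> d)"
      using Cauchy_Schwarz_ineq2[of G d] by linarith
    finally show ?thesis
      using h_add[of x0 d] Q(3)[of d] by (simp add: G_def d_def)
  qed
  have "compact (K \<inter> cball x0 R)"
    using K(1) by (simp add: closed_Int_compact)
  moreover have "x0 \<in> K \<inter> cball x0 R"
    using x0 R by simp
  moreover have "continuous_on (K \<inter> cball x0 R) h"
    unfolding h_def[abs_def]
    by (intro continuous_intros linear_continuous_on_compose[OF _ Q(1)])
  ultimately obtain p where p: "p \<in> K \<inter> cball x0 R" "\<And>u. u \<in> K \<inter> cball x0 R \<Longrightarrow> h p \<le> h u"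
    using continuous_attains_inf by (metis empty_iff)
  have min: "h p \<le> h u" if "u \<in> K" for u
    using p(2)[of u] p(2)[of x0] far[of u] that x0 R by (cases "dist x0 u \<le> R") auto
  have "0 \<le> (Q p + g + \<xi> *\<^sub>R (p - x0)) \<bullet> (u - p)" if u: "u \<in> K" for u
  proof (rule quadratic_nonneg_linear_part)
    fix s :: real assume s: "0 < s" "s \<le> 1"
    have "(1 - s) *\<^sub>R p + s *\<^sub>R u \<in> K"
      using K(2) p(1) u s by (intro convexD) auto
    then have "p + s *\<^sub>R (u - p) \<in> K"
      by (simp add: algebra_simps)
    from min[OF this] h_add[of p "s *\<^sub>R (u - p)"]
    have "0 \<le> (Q p + g + \<xi> *\<^sub>R (p - x0)) \<bullet> (s *\<^sub>R (u - p))
      + (1/2 * ((s *\<^sub>R (u - p)) \<bullet> Q (s *\<^sub>R (u - p))) + \<xi>/2 * ((s *\<^sub>R (u - p)) \<bullet> (s *\<^sub>R (u - p))))"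
      by linarith
    then show "0 \<le> s * ((Q p + g + \<xi> *\<^sub>R (p - x0)) \<bullet> (u - p)) +
        s\<^sup>2 * (1/2 * ((u - p) \<bullet> Q (u - p)) + \<xi>/2 * ((u - p) \<bullet> (u - p)))"
      by (simp only: inner_scaleR_right inner_scaleR_left linear_scale[OF Q(1)] power2_eq_square
          distrib_left mult_ac)
  qed
  then show thesis
    using that p(1) by blast
qed

text \<open>The difference \<open>r\<close> between the slack of \<open>y'\<close> and an optimal
  slack lies in the range of the adjoint. Adding the pseudoinverse of \<open>r\<close> to
  \<open>y'\<close> gives a multiplier with that optimal slack, hence a dual solution; this is why
  the norm restricted to the range enters.\<close>

lemma dist_dual_solutions:
  assumes z: "(x, y) \<in> kkt" and A0: "A \<noteq> (\<lambda>_. 0)"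
  defines "\<nu> \<equiv> onorm_on (range (adjoint A)) (pseudoinverse (adjoint A))"
  shows "\<nu> > 0" "infdist y' (snd ` kkt) \<le> \<nu> * infdist (sl (x, y')) (sl ` kkt)"
proof -
  let ?P = "pseudoinverse (adjoint A)"
  note P = pseudoinverse_properties[OF adj_linear]
  have bound: "norm (?P r) \<le> \<nu> * norm r" if "r \<in> range (adjoint A)" for r
    unfolding \<nu>_def by (rule norm_le_onorm_on[OF P(1) that])
  obtain u where "A u \<noteq> 0"
    using A0 by auto
  then have "adjoint A (A u) \<bullet> u \<noteq> 0"
    by (simp add: adj)
  then have u: "adjoint A (A u) \<noteq> 0"
    by auto
  then have "?P (adjoint A (A u)) \<noteq> 0"
    using P(2)[of "A u"] linear_0[OF adj_linear] by auto
  then have "0 < \<nu> * norm (adjoint A (A u))"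
    using bound[of "adjoint A (A u)"] by (smt (verit) rangeI zero_less_norm_iff)
  then show \<nu>: "\<nu> > 0"
    by (simp add: zero_less_mult_iff)
  show "infdist y' (snd ` kkt) \<le> \<nu> * infdist (sl (x, y')) (sl ` kkt)"
  proof (rule le_mult_infdistI[OF _ \<nu>])
    show "sl ` kkt \<noteq> {}"
      using z by blast
    fix s assume "s \<in> sl ` kkt"
    then obtain x1 y1 where 1: "(x1, y1) \<in> kkt" "s = sl (x1, y1)"
      by auto
    note 2 = kkt_swap[OF z 1(1)]
    define r where "r = sl (x, y') - s"
    have r: "r = adjoint A (y1 - y')"
      unfolding r_def 1(2) 2(2)[symmetric] by (simp add: slack_def linear_diff[OF adj_linear])
    have "adjoint A (y' + ?P r) = adjoint A y1"
      unfolding linear_add[OF adj_linear] r P(2) by (simp add: linear_diff[OF adj_linear])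
    then have "sl (x, y' + ?P r) = sl (x, y1)"
      by (simp add: slack_def)
    then have "(x, y' + ?P r) \<in> kkt"
      using 2(1) by (simp add: kkt_iff)
    then have "y' + ?P r \<in> snd ` kkt"
      by force
    then have "infdist y' (snd ` kkt) \<le> norm (?P r)"
      by (metis infdist_le dist_add_cancel dist_norm add.right_neutral diff_0 norm_minus_cancel)
    also have "\<dots> \<le> \<nu> * norm r"
      using r by (intro bound) simp
    finally show "infdist y' (snd ` kkt) \<le> \<nu> * dist (sl (x, y')) s"
      by (simp add: r_def dist_norm)
  qed
qed

end

section \<open>Lower bound for the gap and the growth constant\<close>

context factored_qp
begin

text \<open>The supremum separates: \<open>w\<close> maximises the dual part exactly, and
  \<open>p\<close> minimises the penalised Lagrangian over \<open>K\<close>. Optimality of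
  \<open>p\<close> produces the normal vector to which (N) is later applied, and the bound on
  \<open>norm (p - xs)\<close> keeps \<open>p\<close> close to the reference point.\<close>

lemma smoothed_gap_ge:
  assumes xi: "\<xi> > 0" and K: "closed K" "convex K" and z: "(xs, ys) \<in> kkt" and x: "x \<in> K"
  obtains p where "p \<in> K"
    "- (Q p + c - adjoint A y + \<xi> *\<^sub>R (p - xs)) \<in> normal_cone K p"
    "norm (p - xs) \<le> norm (adjoint A (y - ys)) / \<xi>"
    "ereal (lsl (xs, ys) \<bullet> lift B x + (norm (A x - b))\<^sup>2 / (2 * \<xi>) + \<xi>/2 * (norm (p - xs))\<^sup>2)
      \<le> smoothed_gap Q c A b K \<xi> (x, y) (xs, ys)"
proof -
  note zs = z[unfolded kkt_iff]
  obtain p where p: "p \<in> K"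
    and vi: "\<And>u. u \<in> K \<Longrightarrow> 0 \<le> (Q p + (c - adjoint A y) + \<xi> *\<^sub>R (p - xs)) \<bullet> (u - p)"
    using ex_proximal_point[OF xi _ K, of xs] zs by blast
  define F where "F = Q p + c - adjoint A y + \<xi> *\<^sub>R (p - xs)"
  have vi: "0 \<le> F \<bullet> (u - p)" if "u \<in> K" for u
    using vi[OF that] by (simp add: F_def add_diff_eq)
  define d where "d = p - xs"
  have Fd: "F \<bullet> d \<le> 0"
    using vi[of xs] zs by (simp add: d_def inner_diff_right)
  have "F = sl (xs, ys) + Q d + \<xi> *\<^sub>R d - adjoint A (y - ys)"
    by (simp add: F_def slack_def d_def linear_diff[OF Q(1)] linear_diff[OF adj_linear])
  then have "F \<bullet> d = sl (xs, ys) \<bullet> d + d \<bullet> Q d + \<xi> * (d \<bullet> d) - adjoint A (y - ys) \<bullet> d"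
    by (simp add: inner_simps inner_commute)
  moreover have "0 \<le> sl (xs, ys) \<bullet> d"
    using inner_nonneg[of "sl (xs, ys)" p] zs p by (simp add: d_def inner_simps inner_commute)
  ultimately have "\<xi> * (d \<bullet> d) \<le> adjoint A (y - ys) \<bullet> d"
    using Fd Q(3)[of d] by linarith
  also have "\<dots> \<le> norm (adjoint A (y - ys)) * norm d"
    by (rule norm_cauchy_schwarz)
  finally have "(\<xi> * norm d) * norm d \<le> norm (adjoint A (y - ys)) * norm d"
    by (simp add: power2_eq_square flip: power2_norm_eq_inner)
  then have "\<xi> * norm d \<le> norm (adjoint A (y - ys))"
    by (cases "d = 0") (auto simp: mult_le_cancel_right)
  then have d_le: "norm (p - xs) \<le> norm (adjoint A (y - ys)) / \<xi>"
    using xi by (simp add: d_def pos_le_divide_eq mult.commute)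
  define r where "r = b - A x"
  define w where "w = ys + (1 / \<xi>) *\<^sub>R r"
  have first: "lagrangian Q c A b x w - \<xi>/2 * (norm (w - ys))\<^sup>2
      = lsl (xs, ys) \<bullet> lift B x + (1/2 * (xs \<bullet> Q xs) + c \<bullet> xs) + (norm (A x - b))\<^sup>2 / (2 * \<xi>)"
  proof -
    have "lsl (xs, ys) \<bullet> lift B x = sl (xs, ys) \<bullet> x + 1/2 * ((x - xs) \<bullet> Q (x - xs))"
      by (simp add: lifted_slack_lift Q_B power2_norm_eq_inner)
    also have "\<dots> = sl (xs, ys) \<bullet> x - sl (xs, ys) \<bullet> xs + 1/2 * ((x - xs) \<bullet> Q (x - xs))"
      using zs by (simp add: inner_commute)
    also have "\<dots> = 1/2 * (x \<bullet> Q x) + c \<bullet> x + ys \<bullet> r - (1/2 * (xs \<bullet> Q xs) + c \<bullet> xs)"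
      using zs by (simp add: slack_def inner_simps linear_diff[OF Q(1)] adj Q_sym[of _ x] Q_sym[of _ xs]
          inner_commute[of xs "Q x"] r_def field_simps)
    finally have 1: "lsl (xs, ys) \<bullet> lift B x + (1/2 * (xs \<bullet> Q xs) + c \<bullet> xs)
        = 1/2 * (x \<bullet> Q x) + c \<bullet> x + ys \<bullet> r"
      by simp
    have 2: "(norm (A x - b))\<^sup>2 = r \<bullet> r"
      by (simp add: r_def norm_minus_commute power2_norm_eq_inner)
    have 3: "(norm (w - ys))\<^sup>2 = (r \<bullet> r) / \<xi>\<^sup>2"
      by (simp add: w_def power_divide power2_norm_eq_inner)
    have 4: "w \<bullet> r = ys \<bullet> r + (r \<bullet> r) / \<xi>"
      by (simp add: w_def inner_add_left)
    show ?thesis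
      unfolding 1 2 3 lagrangian_def r_def[symmetric] 4 using xi
      by (simp add: field_simps power2_eq_square)
  qed
  \<comment> \<open>The squared displacement occurs twice: once to offset the penalty in the gap,
    once as the gain obtained from the variational inequality tested at \<open>xs\<close>.\<close>
  have second: "lagrangian Q c A b p y + \<xi>/2 * (norm (p - xs))\<^sup>2 + \<xi>/2 * (norm (p - xs))\<^sup>2
      \<le> 1/2 * (xs \<bullet> Q xs) + c \<bullet> xs"
  proof -
    have A_xs: "A xs = b" "A p = b + A d"
      using zs by (simp_all add: d_def linear_diff[OF A])
    have xs: "xs = p - d"
      by (simp add: d_def)
    have "1/2 * (xs \<bullet> Q xs) + c \<bullet> xs = lagrangian Q c A b p y + \<xi> * (d \<bullet> d) + 1/2 * (d \<bullet> Q d) - F \<bullet> d"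
    proof -
      have 1: "xs \<bullet> Q xs = p \<bullet> Q p - 2 * (Q p \<bullet> d) + d \<bullet> Q d"
        unfolding xs using Q_sym[of p d]
        by (simp add: linear_diff[OF Q(1)] inner_diff inner_commute[of d "Q p"])
      have 2: "c \<bullet> xs = c \<bullet> p - c \<bullet> d"
        unfolding xs by (rule inner_diff_right)
      have 3: "y \<bullet> (b - A p) = - (y \<bullet> A d)"
        by (simp add: A_xs(2))
      have 4: "F \<bullet> d = Q p \<bullet> d + c \<bullet> d - y \<bullet> A d + \<xi> * (d \<bullet> d)"
        unfolding F_def d_def[symmetric]
        by (simp only: inner_add_left inner_diff_left inner_scaleR_left adj)
      show ?thesis
        unfolding 1 2 3 4 lagrangian_def by simp
    qed
    moreover have "(norm (p - xs))\<^sup>2 = d \<bullet> d"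
      by (simp add: d_def power2_norm_eq_inner)
    ultimately show ?thesis
      using Fd Q(3)[of d] by (simp add: field_simps)
  qed
  have "ereal (lsl (xs, ys) \<bullet> lift B x + (norm (A x - b))\<^sup>2 / (2 * \<xi>) + \<xi>/2 * (norm (p - xs))\<^sup>2)
      \<le> ereal ((lagrangian Q c A b (fst (x, y)) (snd (p, w)) - lagrangian Q c A b (fst (p, w)) (snd (x, y)))
               - \<xi>/2 * (norm (fst (p, w) - fst (xs, ys)))\<^sup>2
               - \<xi>/2 * (norm (snd (p, w) - snd (xs, ys)))\<^sup>2)"
    unfolding ereal_less_eq fst_conv snd_conv using first second by linarith
  also have "\<dots> \<le> smoothed_gap Q c A b K \<xi> (x, y) (xs, ys)"
    unfolding smoothed_gap_def by (rule SUP_upper) (use p in simp)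
  finally have gap: "ereal (lsl (xs, ys) \<bullet> lift B x + (norm (A x - b))\<^sup>2 / (2 * \<xi>) + \<xi>/2 * (norm (p - xs))\<^sup>2)
      \<le> smoothed_gap Q c A b K \<xi> (x, y) (xs, ys)" .
  have "- F \<in> normal_cone K p"
    using vi by (simp add: normal_cone_def)
  then show thesis
    using that[OF p _ d_le gap] by (simp add: F_def)
qed

text \<open>The first projection is nonexpansive and maps lifted solutions to primal ones.\<close>

lemma dist_primal_solutions:
  assumes z: "(x0, y0) \<in> kkt"
  shows "infdist x (fst ` kkt) \<le> infdist (lift B x) (lifted_solutions c A b K B)"
proof (rule le_infdistI)
  show "lifted_solutions c A b K B \<noteq> {}"
    using lift_solution[OF z] by blast
  fix chi assume "chi \<in> lifted_solutions c A b K B"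
  then have "fst chi \<in> fst ` kkt"
    using lifted_solutions_fst[OF z] by (metis fst_conv image_eqI)
  then have "infdist x (fst ` kkt) \<le> dist x (fst chi)"
    by (rule infdist_le)
  also have "\<dots> \<le> dist (lift B x) chi"
    using dist_fst_le[of "lift B x" chi] by (simp add: lift_def)
  finally show "infdist x (fst ` kkt) \<le> dist (lift B x) chi" .
qed

text \<open>The dual face orthogonal to \<open>x\<close> is the negative of the normal cone at
  \<open>x\<close>; the rest is the triangle inequality through \<open>- v\<close>.\<close>

lemma dist_slack_face:
  assumes x: "x \<in> K"
  shows "infdist s {t \<in> dual_cone K. t \<bullet> x = 0} \<le> norm (s + v) + infdist v (normal_cone K x)"
proof -
  have "infdist s {t \<in> dual_cone K. t \<bullet> x = 0} - norm (s + v) \<le> infdist v (normal_cone K x)"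
  proof (rule le_infdistI)
    have "0 \<in> normal_cone K x"
      by (simp add: normal_cone_def)
    then show "normal_cone K x \<noteq> {}" by blast
    fix n assume "n \<in> normal_cone K x"
    then have "- n \<in> {t \<in> dual_cone K. t \<bullet> x = 0}"
      using normal_cone_iff[OF x] by (auto simp: dual_cone_eq inner_commute)
    then have "infdist s {t \<in> dual_cone K. t \<bullet> x = 0} \<le> norm (s + n)"
      by (metis infdist_le dist_norm diff_minus_eq_add)
    also have "s + n = (s + v) - (v - n)"
      by simp
    also have "norm \<dots> \<le> norm (s + v) + norm (v - n)"
      by (rule norm_triangle_ineq4)
    finally show "infdist s {t \<in> dual_cone K. t \<bullet> x = 0} - norm (s + v) \<le> dist v n"
      by (simp add: dist_norm)
  qed
  then show ?thesis by simp
qed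

text \<open>\<open>sl (xs, y)\<close> lies in the affine set of (S), so only its distance to the
  face counts. Adding the normal vector at \<open>p\<close> leaves the negative of
  \<open>Q (p - xs) + \<xi> *\<^sub>R (p - xs)\<close>, and (N) contributes
  \<open>\<kappa>B\<close>: hence the sum \<open>onorm Q + \<xi> + \<kappa>B\<close>.\<close>

lemma dist_dual_le:
  assumes z: "(xs, ys) \<in> kkt" and zb: "(xb, yb) \<in> kkt"
    and A0: "A \<noteq> (\<lambda>_. 0)" and pos: "\<kappa>A > 0" "\<kappa>B > 0" "\<xi> > 0"
    and S: "infdist (sl (xs, y)) (sl ` kkt) \<le> \<kappa>A *
      (infdist (sl (xs, y)) {Q xs + c - r | r. r \<in> range (adjoint A)} +
       infdist (sl (xs, y)) {t \<in> dual_cone K. t \<bullet> xs = 0})"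
    and N: "infdist (- (Q p + c - adjoint A y + \<xi> *\<^sub>R (p - xs))) (normal_cone K xs) \<le> \<kappa>B * norm (p - xs)"
  shows "infdist y (snd ` kkt) \<le> onorm_on (range (adjoint A)) (pseudoinverse (adjoint A)) *
    (\<kappa>A * ((onorm Q + \<xi> + \<kappa>B) * norm (p - xs)))"
proof -
  let ?v = "- (Q p + c - adjoint A y + \<xi> *\<^sub>R (p - xs))"
  note \<nu> = dist_dual_solutions[OF z A0]
  have "sl (xs, y) \<in> {Q xs + c - r | r. r \<in> range (adjoint A)}"
    by (auto simp: slack_def)
  then have D: "infdist (sl (xs, y)) {Q xs + c - r | r. r \<in> range (adjoint A)} = 0"
    by simp
  have "sl (xs, y) + ?v = - (Q (p - xs) + \<xi> *\<^sub>R (p - xs))"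
    by (simp add: slack_def linear_diff[OF Q(1)])
  then have "norm (sl (xs, y) + ?v) \<le> norm (Q (p - xs)) + \<xi> * norm (p - xs)"
    using pos(3) norm_triangle_ineq[of "Q (p - xs)" "\<xi> *\<^sub>R (p - xs)"]
    by (simp only: norm_minus_cancel) simp
  also have "\<dots> \<le> (onorm Q + \<xi>) * norm (p - xs)"
    using onorm[of Q "p - xs"] Q(1) by (simp add: linear_conv_bounded_linear distrib_right)
  finally have "norm (sl (xs, y) + ?v) \<le> (onorm Q + \<xi>) * norm (p - xs)" .
  then have "infdist (sl (xs, y)) {t \<in> dual_cone K. t \<bullet> xs = 0} \<le> (onorm Q + \<xi> + \<kappa>B) * norm (p - xs)"
    using dist_slack_face[of xs "sl (xs, y)" ?v] N z by (simp add: kkt_iff distrib_right)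
  then have "\<kappa>A * (infdist (sl (xs, y)) {Q xs + c - r | r. r \<in> range (adjoint A)} +
      infdist (sl (xs, y)) {t \<in> dual_cone K. t \<bullet> xs = 0})
      \<le> \<kappa>A * ((onorm Q + \<xi> + \<kappa>B) * norm (p - xs))"
    using pos(1) unfolding D by (intro mult_left_mono) auto
  with S have "infdist (sl (xs, y)) (sl ` kkt) \<le> \<kappa>A * ((onorm Q + \<xi> + \<kappa>B) * norm (p - xs))"
    by linarith
  then show ?thesis
    using \<nu>(2)[of y] mult_left_mono[OF _ less_imp_le[OF \<nu>(1)]] by (meson order_trans)
qed

lemma growth_constant_pos:
  assumes z: "(xs, ys) \<in> kkt" and pos: "\<kappa>L > 0" "\<gamma>L > 0" "\<kappa>A > 0" "\<kappa>B > 0" "\<xi> > 0"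
  shows "growth_constant Q A \<xi> \<kappa>L \<gamma>L \<kappa>A \<kappa>B > 0"
proof -
  have "onorm Q \<ge> 0"
    using Q(1) by (intro onorm_pos_le) (simp add: linear_conv_bounded_linear)
  then have "onorm Q + \<xi> + \<kappa>B > 0"
    using pos by linarith
  then show ?thesis
    using pos dist_dual_solutions(1)[OF z]
    by (auto simp: growth_constant_def Let_def intro!: divide_pos_pos mult_pos_pos zero_less_power)
qed

text \<open>The origin of the first two entries of the constant: the square of a sum is at most
  twice the sum of squares, and the resulting \<open>2 * \<kappa>L\<^sup>2\<close> and
  \<open>2 * \<gamma>L\<^sup>2\<close> are matched against the coefficients 1 and
  \<open>1 / (2 * \<xi>)\<close>.\<close>

lemma primal_growth:
  assumes le: "\<alpha> \<le> 1 / (2 * \<kappa>L\<^sup>2)" "\<alpha> \<le> 1 / (4 * \<xi> * \<gamma>L\<^sup>2)"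
    and pos: "\<alpha> > 0" "\<kappa>L > 0" "\<gamma>L > 0" "\<xi> > 0"
    and D: "0 \<le> D" and dX: "0 \<le> dX" "dX \<le> \<kappa>L * sqrt D + \<gamma>L * r"
  shows "\<alpha> * dX\<^sup>2 \<le> D + r\<^sup>2 / (2 * \<xi>)"
proof -
  have "dX\<^sup>2 \<le> (\<kappa>L * sqrt D + \<gamma>L * r)\<^sup>2"
    using dX by (intro power_mono)
  also have "\<dots> \<le> 2 * (\<kappa>L * sqrt D)\<^sup>2 + 2 * (\<gamma>L * r)\<^sup>2"
    using zero_le_power2[of "\<kappa>L * sqrt D - \<gamma>L * r"] by (simp add: power2_sum power2_diff)
  also have "\<dots> = (2 * \<kappa>L\<^sup>2) * D + (2 * \<gamma>L\<^sup>2) * r\<^sup>2"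
    using D by (simp add: power_mult_distrib)
  finally have "\<alpha> * dX\<^sup>2 \<le> \<alpha> * ((2 * \<kappa>L\<^sup>2) * D + (2 * \<gamma>L\<^sup>2) * r\<^sup>2)"
    using pos(1) by (intro mult_left_mono) auto
  also have "\<dots> = (\<alpha> * (2 * \<kappa>L\<^sup>2)) * D + (\<alpha> * (2 * \<gamma>L\<^sup>2)) * r\<^sup>2"
    by (simp add: algebra_simps)
  also have "\<dots> \<le> 1 * D + (1 / (2 * \<xi>)) * r\<^sup>2"
  proof (intro add_mono mult_right_mono D)
    show "\<alpha> * (2 * \<kappa>L\<^sup>2) \<le> 1"
      using le(1) pos by (simp add: pos_le_divide_eq)
    have "\<alpha> * (2 * \<gamma>L\<^sup>2) \<le> 1 / (4 * \<xi> * \<gamma>L\<^sup>2) * (2 * \<gamma>L\<^sup>2)"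
      using le(2) by (intro mult_right_mono) auto
    also have "\<dots> = 1 / (2 * \<xi>)"
      using pos by (simp add: field_simps)
    finally show "\<alpha> * (2 * \<gamma>L\<^sup>2) \<le> 1 / (2 * \<xi>)" .
  qed simp
  finally show ?thesis by simp
qed

theorem gap_growth_of_regularity:
  assumes xi: "\<xi> > 0" and K: "closed K" "convex K" and zb: "(xb, yb) \<in> kkt"
    and pos: "\<kappa>L > 0" "\<gamma>L > 0" "\<kappa>A > 0" "\<kappa>B > 0"
    and L: "lifted_error_bound Q c A b K B (xb, yb) \<kappa>L \<gamma>L"
    and S: "slack_regularity Q c A b K (xb, yb) \<kappa>A"
    and N: "normal_cone_calmness Q c A b K (xb, yb) \<kappa>B"
  shows "\<exists>V. (xb, yb) \<in> interior V \<and>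
    gap_growth Q c A b K \<xi> V (growth_constant Q A \<xi> \<kappa>L \<gamma>L \<kappa>A \<kappa>B)"
proof -
  let ?sb = "sl (xb, yb)"
  define \<alpha> where "\<alpha> = growth_constant Q A \<xi> \<kappa>L \<gamma>L \<kappa>A \<kappa>B"
  have \<alpha>: "\<alpha> > 0"
    unfolding \<alpha>_def by (rule growth_constant_pos[OF zb pos xi])
  have \<alpha>_le: "\<alpha> \<le> 1 / (2 * \<kappa>L\<^sup>2)" "\<alpha> \<le> 1 / (4 * \<xi> * \<gamma>L\<^sup>2)"
    by (auto simp: \<alpha>_def growth_constant_def Let_def min_le_iff_disj)
  obtain V1 N1 where V1: "(xb, yb) \<in> interior V1" and N1: "open N1" "lift B xb \<in> N1"
    and L1: "\<And>z chi. z \<in> kkt \<inter> V1 \<Longrightarrow> chi \<in> KL \<inter> N1 \<Longrightarrow>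
      infdist chi (lifted_solutions c A b K B)
        \<le> \<kappa>L * sqrt (lsl z \<bullet> chi) + \<gamma>L * norm (lifted_map A B chi - (b, 1, 0))"
    using L unfolding lifted_error_bound_def by auto
  obtain V2 W2 where V2: "(xb, yb) \<in> interior V2" and W2: "?sb \<in> interior W2"
    and S1: "\<And>x y s. (x, y) \<in> kkt \<inter> V2 \<Longrightarrow> s \<in> W2 \<Longrightarrow> infdist s (sl ` kkt) \<le> \<kappa>A *
      (infdist s {Q x + c - r | r. r \<in> range (adjoint A)} + infdist s {t \<in> dual_cone K. t \<bullet> x = 0})"
    using S unfolding slack_regularity_def by blast
  obtain V3 W3 where V3: "(xb, yb) \<in> interior V3" and W3: "(xb, - ?sb) \<in> interior W3"
    and N3: "\<And>x y u v. (x, y) \<in> kkt \<inter> V3 \<Longrightarrow> (u, v) \<in> normal_cone_graph K \<inter> W3 \<Longrightarrow>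
      infdist v (normal_cone K x) \<le> \<kappa>B * norm (u - x)"
    using N unfolding normal_cone_calmness_def by fastforce
  obtain e2 where e2: "e2 > 0" "ball ?sb e2 \<subseteq> W2"
    using W2 by (auto simp: mem_interior)
  obtain e3 where e3: "e3 > 0" "ball (xb, - ?sb) e3 \<subseteq> W3"
    using W3 by (auto simp: mem_interior)
  obtain a where a: "a > 0" "\<And>v. norm (adjoint A v) \<le> a * norm v"
    using onorm_pos_bound[OF adj_linear] by blast
  obtain q where q: "q > 0" "\<And>v. norm (Q v) \<le> q * norm v"
    using onorm_pos_bound[OF Q(1)] by blast
  \<comment> \<open>As \<open>y\<close> and \<open>ys\<close> are at most \<open>2 * r\<close>
    apart, \<open>norm (p - xs) \<le> m * r\<close>. Then \<open>M * r\<close> bounds the distance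
    of \<open>p\<close> and its normal vector from the reference pair: \<open>e3 / M\<close> serves
    (N), and \<open>e2 / a\<close> serves (S).\<close>
  define m where "m = a * 2 / \<xi>"
  define M where "M = m + 1 + a + (q + \<xi>) * m"
  have m: "m > 0" and M: "M > 0"
    using a(1) q(1) xi by (simp_all add: m_def M_def add_pos_pos)
  define r where "r = min (e2 / a) (e3 / M)"
  have r: "r > 0" "a * r \<le> e2" "M * r \<le> e3"
    using e2(1) e3(1) a(1) M by (simp_all add: r_def min_def field_simps)
  define N4 where "N4 = {z :: 'e \<times> 'y. lift B (fst z) \<in> N1}"
  have "continuous_on UNIV (\<lambda>z :: 'e \<times> 'y. lift B (fst z))"
    unfolding lift_def by (intro continuous_intros linear_continuous_on_compose[OF _ B(1)])
  then have "open N4"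
    using N1(1) open_vimage[of N1 "\<lambda>z :: 'e \<times> 'y. lift B (fst z)"] by (simp add: N4_def vimage_def)
  define V where "V = V1 \<inter> V2 \<inter> V3 \<inter> N4 \<inter> ball (xb, yb) r"
  have "(xb, yb) \<in> interior V"
    using V1 V2 V3 \<open>open N4\<close> N1(2) r(1) by (simp add: V_def interior_open N4_def)
  moreover have "gap_growth Q c A b K \<xi> V \<alpha>"
    unfolding gap_growth_def
  proof (intro ballI)
    fix z zs assume "z \<in> (K \<times> UNIV) \<inter> V" "zs \<in> kkt \<inter> V"
    moreover obtain x y where z: "z = (x, y)" by (cases z)
    moreover obtain xs ys where zs: "zs = (xs, ys)" by (cases zs)
    ultimately have x: "x \<in> K" "(x, y) \<in> V" and kkt: "(xs, ys) \<in> kkt" "(xs, ys) \<in> V"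
      by auto
    have near: "norm (x - xb) < r" "norm (y - yb) < r" "norm (xs - xb) < r" "norm (ys - yb) < r"
      using x(2) kkt(2) dist_fst_le[of "(x, y)" "(xb, yb)"] dist_snd_le[of "(x, y)" "(xb, yb)"]
        dist_fst_le[of "(xs, ys)" "(xb, yb)"] dist_snd_le[of "(xs, ys)" "(xb, yb)"]
      by (auto simp: V_def dist_commute dist_norm[symmetric])
    obtain p where p: "p \<in> K"
      and nc: "- (Q p + c - adjoint A y + \<xi> *\<^sub>R (p - xs)) \<in> normal_cone K p"
      and dle: "norm (p - xs) \<le> norm (adjoint A (y - ys)) / \<xi>"
      and gap: "ereal (lsl (xs, ys) \<bullet> lift B x + (norm (A x - b))\<^sup>2 / (2 * \<xi>) + \<xi>/2 * (norm (p - xs))\<^sup>2)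
      \<le> smoothed_gap Q c A b K \<xi> (x, y) (xs, ys)"
      using smoothed_gap_ge[OF xi K kkt(1) x(1)] by metis
    define v where "v = - (Q p + c - adjoint A y + \<xi> *\<^sub>R (p - xs))"
    define dX where "dX = infdist x (fst ` kkt)"
    define dY where "dY = infdist y (snd ` kkt)"
    define D where "D = lsl (xs, ys) \<bullet> lift B x"
    interpret KL: full_peirce_cone KL by (rule KL_peirce)
    have "0 \<le> D"
      unfolding D_def by (intro KL.inner_nonneg lifted_slack_mem lift_mem kkt x)
    moreover have "dX \<le> \<kappa>L * sqrt D + \<gamma>L * norm (A x - b)"
    proof -
      have "lift B x \<in> KL \<inter> N1"
        using lift_mem[OF x(1)] x(2) by (simp add: V_def N4_def)
      moreover have "norm (lifted_map A B (lift B x) - (b, 1, 0)) = norm (A x - b)"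
        by (simp add: lifted_map_def lift_def norm_Pair)
      ultimately show ?thesis
        using L1[of "(xs, ys)" "lift B x"] dist_primal_solutions[OF zb, of x] kkt
        by (simp add: V_def D_def dX_def)
    qed
    ultimately have primal: "\<alpha> * dX\<^sup>2 \<le> D + (norm (A x - b))\<^sup>2 / (2 * \<xi>)"
      using infdist_nonneg[of x "fst ` kkt"] unfolding dX_def[symmetric]
      by (intro primal_growth[OF \<alpha>_le \<alpha> pos(1,2) xi])
    have dual: "\<alpha> * dY\<^sup>2 \<le> \<xi>/2 * (norm (p - xs))\<^sup>2"
    proof (cases "A = (\<lambda>_. 0)")
      \<comment> \<open>For \<open>A = 0\<close> the slack does not depend on the multiplier, so
        every \<open>y\<close> is dual optimal.\<close>
      case True
      have "adjoint A y \<bullet> u = adjoint A ys \<bullet> u" for u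
        unfolding adj using True by simp
      then have "adjoint A y = adjoint A ys"
        using vector_eq_rdot by blast
      then have "sl (xs, y) = sl (xs, ys)"
        by (simp add: slack_def)
      then have "(xs, y) \<in> kkt"
        using kkt(1) by (simp add: kkt_iff)
      then have "y \<in> snd ` kkt"
        by force
      then have "dY = 0"
        by (simp add: dY_def)
      then show ?thesis
        using xi by simp
    next
      case False
      define \<nu> where "\<nu> = onorm_on (range (adjoint A)) (pseudoinverse (adjoint A))"
      define \<mu> where "\<mu> = onorm Q + \<xi> + \<kappa>B"
      have \<nu>: "\<nu> > 0"
        unfolding \<nu>_def by (rule dist_dual_solutions(1)[OF zb False])
      have \<mu>: "\<mu> > 0"
        using onorm_pos_le[of Q] Q(1) xi pos(4) by (simp add: \<mu>_def linear_conv_bounded_linear)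
      have Qxs: "Q xs = Q xb"
        using kkt_Q_eq(1)[OF kkt(1) zb] .
      have s_diff: "sl (xs, y) - ?sb = - adjoint A (y - yb)"
        by (simp add: slack_def Qxs linear_diff[OF adj_linear])
      have ay: "norm (adjoint A (y - yb)) < a * r"
        using a(2)[of "y - yb"] mult_strict_left_mono[OF near(2) a(1)] by linarith
      have "dist (sl (xs, y)) ?sb < e2"
        using ay r(2) by (simp add: dist_norm s_diff)
      then have W: "sl (xs, y) \<in> W2"
        using e2(2) by (auto simp: dist_commute)
      have S2: "infdist (sl (xs, y)) (sl ` kkt) \<le> \<kappa>A *
          (infdist (sl (xs, y)) {Q xs + c - r | r. r \<in> range (adjoint A)} +
           infdist (sl (xs, y)) {t \<in> dual_cone K. t \<bullet> xs = 0})"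
        by (rule S1[OF _ W]) (use kkt in \<open>auto simp: V_def\<close>)
      have dm: "norm (p - xs) \<le> m * r"
      proof -
        have "norm (y - ys) \<le> 2 * r"
          using near(2,4) norm_triangle_ineq4[of "y - yb" "ys - yb"] by simp
        then have "norm (adjoint A (y - ys)) \<le> a * (2 * r)"
          using a(2)[of "y - ys"] a(1) by (meson mult_left_mono less_imp_le order_trans)
        then have "norm (adjoint A (y - ys)) / \<xi> \<le> a * (2 * r) / \<xi>"
          using xi by (intro divide_right_mono) auto
        then show ?thesis
          using dle by (simp add: m_def)
      qed
      have v_diff: "v + ?sb = adjoint A (y - yb) - (Q (p - xs) + \<xi> *\<^sub>R (p - xs))"
        by (simp add: v_def slack_def Qxs linear_diff[OF Q(1)] linear_diff[OF adj_linear])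
      have "norm (v + ?sb) \<le> norm (adjoint A (y - yb)) + norm (Q (p - xs) + \<xi> *\<^sub>R (p - xs))"
        unfolding v_diff by (rule norm_triangle_ineq4)
      also have "norm (Q (p - xs) + \<xi> *\<^sub>R (p - xs)) \<le> (q + \<xi>) * norm (p - xs)"
        using norm_triangle_ineq[of "Q (p - xs)" "\<xi> *\<^sub>R (p - xs)"] q(2)[of "p - xs"] xi
        by (simp add: distrib_right)
      also have "(q + \<xi>) * norm (p - xs) \<le> (q + \<xi>) * (m * r)"
        using dm q(1) xi by (intro mult_left_mono) auto
      finally have vle: "norm (v + ?sb) < a * r + (q + \<xi>) * (m * r)"
        using ay by linarith
      have ple: "norm (p - xb) \<le> m * r + r"
        using norm_triangle_ineq[of "p - xs" "xs - xb"] dm near(3) by simp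
      have "dist (p, v) (xb, - ?sb) \<le> norm (p - xb) + norm (v + ?sb)"
        using norm_Pair_le[of "p - xb" "v + ?sb"] by (simp add: dist_norm)
      also have "\<dots> < M * r"
        using vle ple by (simp add: M_def algebra_simps)
      finally have "(p, v) \<in> W3"
        using r(3) e3(2) by (auto simp: dist_commute)
      then have "infdist v (normal_cone K xs) \<le> \<kappa>B * norm (p - xs)"
        using N3 kkt p nc by (auto simp: V_def normal_cone_graph_def v_def)
      from dist_dual_le[OF kkt(1) zb False pos(3,4) xi S2 this[unfolded v_def]]
      have "dY \<le> \<nu> * (\<kappa>A * (\<mu> * norm (p - xs)))"
        by (simp add: dY_def \<nu>_def \<mu>_def)
      then have "dY\<^sup>2 \<le> (\<nu> * (\<kappa>A * (\<mu> * norm (p - xs))))\<^sup>2"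
        by (intro power_mono) (auto simp: dY_def infdist_nonneg)
      also have "\<dots> = (\<nu>\<^sup>2 * \<kappa>A\<^sup>2 * \<mu>\<^sup>2) * (norm (p - xs))\<^sup>2"
        by (simp add: power_mult_distrib)
      finally have "\<alpha> * dY\<^sup>2 \<le> \<alpha> * ((\<nu>\<^sup>2 * \<kappa>A\<^sup>2 * \<mu>\<^sup>2) * (norm (p - xs))\<^sup>2)"
        using \<alpha> by (intro mult_left_mono) auto
      also have "\<dots> = \<alpha> * (\<nu>\<^sup>2 * \<kappa>A\<^sup>2 * \<mu>\<^sup>2) * (norm (p - xs))\<^sup>2"
        by (simp add: mult.assoc)
      also have "\<dots> \<le> \<xi>/2 * (norm (p - xs))\<^sup>2"
      proof (intro mult_right_mono)
        have "\<alpha> \<le> \<xi> / (2 * \<nu>\<^sup>2 * \<kappa>A\<^sup>2 * \<mu>\<^sup>2)"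
          using False by (simp add: \<alpha>_def growth_constant_def Let_def \<nu>_def \<mu>_def)
        then have "\<alpha> * (\<nu>\<^sup>2 * \<kappa>A\<^sup>2 * \<mu>\<^sup>2) \<le> \<xi> / (2 * \<nu>\<^sup>2 * \<kappa>A\<^sup>2 * \<mu>\<^sup>2) * (\<nu>\<^sup>2 * \<kappa>A\<^sup>2 * \<mu>\<^sup>2)"
          by (intro mult_right_mono) auto
        also have "\<dots> = \<xi> / 2"
          using \<nu> \<mu> pos(3) by (simp add: field_simps)
        finally show "\<alpha> * (\<nu>\<^sup>2 * \<kappa>A\<^sup>2 * \<mu>\<^sup>2) \<le> \<xi> / 2" .
      qed simp
      finally show ?thesis .
    qed
    \<comment> \<open>The KKT set is a product, so squared distances add; the primal and dual
      estimates draw on different terms of the lower bound and may be added too.\<close>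
    have "(infdist z kkt)\<^sup>2 \<le> dX\<^sup>2 + dY\<^sup>2"
      unfolding z dX_def dY_def using infdist_Times_le[of "fst ` kkt" "snd ` kkt" x y] kkt(1)
      by (metis kkt_Times empty_iff image_is_empty)
    then have "\<alpha> * (infdist z kkt)\<^sup>2 \<le> \<alpha> * (dX\<^sup>2 + dY\<^sup>2)"
      using \<alpha> by (intro mult_left_mono) auto
    also have "\<dots> \<le> D + (norm (A x - b))\<^sup>2 / (2 * \<xi>) + \<xi>/2 * (norm (p - xs))\<^sup>2"
      using primal dual by (simp add: distrib_left)
    finally have "ereal (\<alpha> * (infdist z kkt)\<^sup>2)
        \<le> ereal (D + (norm (A x - b))\<^sup>2 / (2 * \<xi>) + \<xi>/2 * (norm (p - xs))\<^sup>2)"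
      by simp
    also have "\<dots> \<le> smoothed_gap Q c A b K \<xi> z zs"
      using gap by (simp add: D_def z zs)
    finally show "ereal (\<alpha> * (infdist z kkt)\<^sup>2) \<le> smoothed_gap Q c A b K \<xi> z zs" .
  qed
  ultimately show ?thesis
    unfolding \<alpha>_def by blast
qed

end

text \<open>The formula for the growth constant is asserted for every choice of constants admissible
  in (L), (S) and (N), not only for those whose existence is shown; the first claim is free of any
  factor of \<open>Q\<close>.\<close>

theorem corollary3p13:
  fixes A :: "'e::euclidean_space \<Rightarrow> 'y::euclidean_space"
    and Q :: "'e \<Rightarrow> 'e"
    and c :: 'e
    and b :: 'y
    and K :: "'e set"
    and zbar :: "'e \<times> 'y"
    and V_SC :: "('e \<times> 'y) set"
    and \<xi> :: real
  assumes A: "linear A"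
    and Q: "linear Q" "adjoint Q = Q" "\<And>x. 0 \<le> x \<bullet> Q x"
    and K: "convex_cone K" "closed K"
    and K_product: "is_cone_product K"
    and xi: "\<xi> > 0"
    and zbar: "zbar \<in> kkt_set Q c A b K"
    and V_SC: "zbar \<in> interior V_SC"
    and SC: "\<And>xs ys. (xs, ys) \<in> kkt_set Q c A b K \<inter> V_SC
                \<Longrightarrow> xs + (Q xs + c - adjoint A ys) \<in> interior K"
  shows "(\<exists>V \<alpha>. zbar \<in> interior V \<and> \<alpha> > 0 \<and> gap_growth Q c A b K \<xi> V \<alpha>) \<and>
    (\<forall>B :: 'e \<Rightarrow> 'w::euclidean_space. linear B \<and> Q = adjoint B \<circ> B \<longrightarrow>
       (\<exists>\<kappa>L \<gamma>L \<kappa>A \<kappa>B. \<kappa>L > 0 \<and> \<gamma>L > 0 \<and> \<kappa>A > 0 \<and> \<kappa>B > 0 \<and>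
          lifted_error_bound Q c A b K B zbar \<kappa>L \<gamma>L \<and>
          slack_regularity Q c A b K zbar \<kappa>A \<and>
          normal_cone_calmness Q c A b K zbar \<kappa>B) \<and>
       (\<forall>\<kappa>L \<gamma>L \<kappa>A \<kappa>B. \<kappa>L > 0 \<and> \<gamma>L > 0 \<and> \<kappa>A > 0 \<and> \<kappa>B > 0 \<and>
          lifted_error_bound Q c A b K B zbar \<kappa>L \<gamma>L \<and>
          slack_regularity Q c A b K zbar \<kappa>A \<and>
          normal_cone_calmness Q c A b K zbar \<kappa>B
          \<longrightarrow> growth_constant Q A \<xi> \<kappa>L \<gamma>L \<kappa>A \<kappa>B > 0 \<and>
              (\<exists>V. zbar \<in> interior V \<and>
                 gap_growth Q c A b K \<xi> V (growth_constant Q A \<xi> \<kappa>L \<gamma>L \<kappa>A \<kappa>B))))"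
proof -
  obtain xb yb where zb: "zbar = (xb, yb)"
    by (cases zbar)
  obtain \<delta> where \<delta>: "\<delta> > 0" "ball zbar \<delta> \<subseteq> V_SC"
    using V_SC by (auto simp: mem_interior)
  have qp: "conic_qp K Q A"
    by (intro conic_qp.intro conic_qp_axioms.intro full_peirce_cone.intro
        peirce_cone_product K_product A Q)
  then interpret conic_qp K Q c A b .
  have sc: "strictly_complementary_qp K Q c A b xb yb \<delta>"
  proof (intro strictly_complementary_qp.intro strictly_complementary_qp_axioms.intro qp)
    show "x + slack Q c A (x, y) \<in> interior K"
      if "(x, y) \<in> kkt_set Q c A b K" "dist (x, y) (xb, yb) < \<delta>" for x y
      using SC[of x y] that \<delta>(2) by (auto simp: zb slack_def dist_commute)
  qed (use zbar zb \<delta>(1) in auto)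
  then interpret sc: strictly_complementary_qp K Q c A b xb yb \<delta> .
  have convex: "convex K"
    using K(1) by (simp add: convex_cone_def)
  \<comment> \<open>Polymorphic in the codomain of \<open>B\<close>, since it is applied both to an
    arbitrary factor and to the square root of \<open>Q\<close>.\<close>
  have constants: "\<exists>\<kappa>L \<gamma>L \<kappa>A \<kappa>B. \<kappa>L > 0 \<and> \<gamma>L > 0 \<and> \<kappa>A > 0 \<and> \<kappa>B > 0 \<and>
      lifted_error_bound Q c A b K B zbar \<kappa>L \<gamma>L \<and> slack_regularity Q c A b K zbar \<kappa>A \<and>
      normal_cone_calmness Q c A b K zbar \<kappa>B"
    if "linear B" "Q = adjoint B \<circ> B" for B :: "'e \<Rightarrow> 'v::euclidean_space"
  proof -
    interpret strictly_complementary_factored_qp K Q c A b xb yb \<delta> B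
      by (intro strictly_complementary_factored_qp.intro factored_qp.intro
          factored_qp_axioms.intro sc qp that)
    show ?thesis
      using ex_lifted_error_bound sc.ex_slack_regularity sc.ex_normal_cone_calmness unfolding zb by blast
  qed
  have growth: "growth_constant Q A \<xi> \<kappa>L \<gamma>L \<kappa>A \<kappa>B > 0 \<and> (\<exists>V. zbar \<in> interior V \<and>
      gap_growth Q c A b K \<xi> V (growth_constant Q A \<xi> \<kappa>L \<gamma>L \<kappa>A \<kappa>B))"
    if B: "linear B" "Q = adjoint B \<circ> B" and pos: "\<kappa>L > 0" "\<gamma>L > 0" "\<kappa>A > 0" "\<kappa>B > 0"
      and reg: "lifted_error_bound Q c A b K B zbar \<kappa>L \<gamma>L" "slack_regularity Q c A b K zbar \<kappa>A"
        "normal_cone_calmness Q c A b K zbar \<kappa>B"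
    for B :: "'e \<Rightarrow> 'v::euclidean_space" and \<kappa>L \<gamma>L \<kappa>A \<kappa>B
  proof -
    interpret factored_qp K Q c A b B
      by (intro factored_qp.intro factored_qp_axioms.intro qp B)
    show ?thesis
      using growth_constant_pos[OF _ pos xi] reg zbar
        gap_growth_of_regularity[OF xi K(2) convex _ pos] unfolding zb by blast
  qed
  obtain B0 :: "'e \<Rightarrow> 'e" where B0: "linear B0" "Q = adjoint B0 \<circ> B0"
    using positive_semidefinite_factorization[OF Q] by blast
  have "\<exists>V \<alpha>. zbar \<in> interior V \<and> \<alpha> > 0 \<and> gap_growth Q c A b K \<xi> V \<alpha>"
    using constants[OF B0] growth[OF B0] by blast
  then show ?thesis
    by (rule conjI) (intro allI impI, elim conjE, intro conjI[OF constants] allI impI,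
      assumption, assumption, elim conjE, rule growth, assumption+)
qed

end
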